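(* Let $\Gamma$ be a group such that the category $\mathcal C=\mathrm{Rep}\,\Gamma$ of finite-dimensional complex representations of $\Gamma$ is semisimple. Then any rigid $\mathcal C$-algebra is (isomorphic to one) of the form $\mathrm{Fun}(\Gamma/H)$ for some subgroup $H\subset\Gamma$ of finite index.
   Context: $\mathcal C=\mathrm{Rep}\,\Gamma$ is a symmetric tensor category with the usual flip $R_{V,W}:V\otimes W\to W\otimes V$, unit $\mathbf 1=\mathbb C$ and trivial twist, so $\dim_{\mathcal C}$ is the usual dimension. $\mathrm{Fun}(\Gamma/H)$ is the space of complex-valued functions on the finite set $\Gamma/H$ with the natural $\Gamma$-action, pointwise multiplication and the constant function $1$ as unit. A $\mathcal C$-algebra is an object $A\in\mathcal C$ with morphisms $\mu:A\otimes A\to A$ and $\iota_A:\mathbf 1\hookrightarrow A$ such that $\mu(\mu\otimes \mathrm{id})=\mu(\mathrm{id}\otimes\mu)$, $\mu R_{A,A}=\mu$, $\mu(\iota_A\otimes\mathrm{id}_A)=\mathrm{id}_A$, and $\dim\mathrm{Hom}_{\mathcal C}(\mathbf 1,A)=1$. Let $\varepsilon_A:A\to\mathbf 1$ be the unique morphism with $\varepsilon_A\iota_A=\mathrm{id}$. $A$ is rigid if $e_A=\varepsilon_A\mu:A\otimes A\to\mathbf 1$ is a non-degenerate pairing (there is $i_A:\mathbf 1\to A\otimes A$ such that $e_A,i_A$ satisfy the rigidity axioms) and $\dim_{\mathcal C}A\ne0$. *)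

theory Defs
  imports
    Complex_Main
    "HOL-Algebra.Left_Coset"
    "HOL-Algebra.AbelCoset"
    "Jordan_Normal_Form.VS_Connect"
begin

abbreviation complex_ring :: "complex ring"
  where "complex_ring \<equiv> class_ring"

section \<open>The category of finite-dimensional complex representations\<close>

text \<open>A representation is a complex vector space together with an action. The fields
  \<open>mult\<close> and \<open>one\<close>, which every \<open>module\<close> record inherits from \<open>ring\<close>, carry no meaning here
  and are never used.\<close>

record ('g, 'v) rep = "(complex, 'v) module" +
  act :: "'g \<Rightarrow> 'v \<Rightarrow> 'v"

locale fd_rep = group G + vectorspace complex_ring V
  for G :: "('g, 'm) monoid_scheme" and V :: "('g, 'v, 'n) rep_scheme" +
  assumes fin_dim: "vectorspace.fin_dim complex_ring V"
    and act_linear: "g \<in> carrier G \<Longrightarrow> act V g \<in> LinearCombinations.module_hom complex_ring V V"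
    and act_one: "v \<in> carrier V \<Longrightarrow> act V \<one>\<^bsub>G\<^esub> v = v"
    and act_mult: "\<lbrakk>g \<in> carrier G; h \<in> carrier G; v \<in> carrier V\<rbrakk>
      \<Longrightarrow> act V (g \<otimes>\<^bsub>G\<^esub> h) v = act V g (act V h v)"

text \<open>Morphisms are required to be extensional, so that two morphisms are equal as soon as they
  agree on the carrier of their domain.\<close>

definition rep_hom ::
    "('g, 'm) monoid_scheme \<Rightarrow> ('g, 'v) rep \<Rightarrow> ('g, 'w) rep \<Rightarrow> ('v \<Rightarrow> 'w) set"
  where "rep_hom G V W =
    {f \<in> LinearCombinations.module_hom complex_ring V W \<inter> extensional (carrier V).
      \<forall>g \<in> carrier G. \<forall>v \<in> carrier V. f (act V g v) = act W g (f v)}"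

definition hom_space ::
    "('g, 'm) monoid_scheme \<Rightarrow> ('g, 'v) rep \<Rightarrow> ('g, 'w) rep \<Rightarrow> (complex, 'v \<Rightarrow> 'w) module"
  where "hom_space G V W =
    \<lparr>carrier = rep_hom G V W,
     mult = (\<lambda>f h. \<lambda>v\<in>carrier V. \<zero>\<^bsub>W\<^esub>),
     one = (\<lambda>v\<in>carrier V. \<zero>\<^bsub>W\<^esub>),
     zero = (\<lambda>v\<in>carrier V. \<zero>\<^bsub>W\<^esub>),
     add = (\<lambda>f h. \<lambda>v\<in>carrier V. f v \<oplus>\<^bsub>W\<^esub> h v),
     smult = (\<lambda>c f. \<lambda>v\<in>carrier V. c \<odot>\<^bsub>W\<^esub> f v)\<rparr>"

abbreviation id_mor :: "('g, 'v) rep \<Rightarrow> 'v \<Rightarrow> 'v"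
  where "id_mor V \<equiv> \<lambda>v\<in>carrier V. v"

subsection \<open>Semisimplicity\<close>

definition subrep :: "('g, 'm) monoid_scheme \<Rightarrow> 'v set \<Rightarrow> ('g, 'v) rep \<Rightarrow> bool"
  where "subrep G W V \<longleftrightarrow> VectorSpace.subspace complex_ring W V \<and>
    (\<forall>g \<in> carrier G. \<forall>w \<in> W. act V g w \<in> W)"

definition simple_rep :: "('g, 'm) monoid_scheme \<Rightarrow> ('g, 'v) rep \<Rightarrow> bool"
  where "simple_rep G V \<longleftrightarrow> fd_rep G V \<and> carrier V \<noteq> {\<zero>\<^bsub>V\<^esub>} \<and>
    (\<forall>W. subrep G W V \<longrightarrow> W = {\<zero>\<^bsub>V\<^esub>} \<or> W = carrier V)"

text \<open>The representation is the internal direct sum of finitely many simple subrepresentations.\<close>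

definition semisimple_rep :: "('g, 'm) monoid_scheme \<Rightarrow> ('g, 'v) rep \<Rightarrow> bool"
  where "semisimple_rep G V \<longleftrightarrow> (\<exists>(n::nat) W.
    (\<forall>i<n. subrep G (W i) V \<and> simple_rep G (V\<lparr>carrier := W i\<rparr>)) \<and>
    bij_betw (\<lambda>w. \<Oplus>\<^bsub>V\<^esub>i\<in>{..<n}. w i) (\<Pi>\<^sub>E i\<in>{..<n}. W i) (carrier V))"

text \<open>HOL cannot quantify over all types inside a formula. The carriers are therefore taken in one
  fixed type, which is large enough: every finite-dimensional representation, on whatever type, is
  isomorphic to one on a set of functions \<open>nat \<Rightarrow> complex\<close> (lemma \<open>fd_rep_iso_nat_complex\<close> below).\<close>

definition semisimple_Rep :: "('g, 'm) monoid_scheme \<Rightarrow> bool"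
  where "semisimple_Rep G \<longleftrightarrow>
    (\<forall>V :: ('g, nat \<Rightarrow> complex) rep. fd_rep G V \<longrightarrow> semisimple_rep G V)"

subsection \<open>Tensor products\<close>

text \<open>The tensor product is the quotient of the free vector space on the set of pairs by the
  span of the bilinearity relations.\<close>

definition free_space :: "'x set \<Rightarrow> (complex, 'x \<Rightarrow> complex) module"
  where "free_space X =
    \<lparr>carrier = {f. finite {x. f x \<noteq> 0} \<and> {x. f x \<noteq> 0} \<subseteq> X},
     mult = (\<lambda>f h x. 0), one = (\<lambda>x. 0), zero = (\<lambda>x. 0),
     add = (\<lambda>f h x. f x + h x),
     smult = (\<lambda>c f x. c * f x)\<rparr>"

definition quotient_space :: "(complex, 'v) module \<Rightarrow> 'v set \<Rightarrow> (complex, 'v set) module"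
  where "quotient_space V N =
    \<lparr>carrier = a_rcosets\<^bsub>V\<^esub> N,
     mult = (\<lambda>X Y. N), one = N, zero = N,
     add = (\<lambda>X Y. X <+>\<^bsub>V\<^esub> Y),
     smult = (\<lambda>c X. \<Union>x\<in>X. N +>\<^bsub>V\<^esub> (c \<odot>\<^bsub>V\<^esub> x))\<rparr>"

definition delta :: "'x \<Rightarrow> 'x \<Rightarrow> complex"
  where "delta x = (\<lambda>y. if y = x then 1 else 0)"

definition bilinear_relations ::
    "(complex, 'v, 'm) module_scheme \<Rightarrow> (complex, 'w, 'n) module_scheme \<Rightarrow> ('v \<times> 'w \<Rightarrow> complex) set"
  where "bilinear_relations V W =
    {\<lambda>p. delta (v \<oplus>\<^bsub>V\<^esub> v', w) p - delta (v, w) p - delta (v', w) p | v v' w.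
       v \<in> carrier V \<and> v' \<in> carrier V \<and> w \<in> carrier W} \<union>
    {\<lambda>p. delta (v, w \<oplus>\<^bsub>W\<^esub> w') p - delta (v, w) p - delta (v, w') p | v w w'.
       v \<in> carrier V \<and> w \<in> carrier W \<and> w' \<in> carrier W} \<union>
    {\<lambda>p. delta (c \<odot>\<^bsub>V\<^esub> v, w) p - c * delta (v, w) p | c v w.
       v \<in> carrier V \<and> w \<in> carrier W} \<union>
    {\<lambda>p. delta (v, c \<odot>\<^bsub>W\<^esub> w) p - c * delta (v, w) p | c v w.
       v \<in> carrier V \<and> w \<in> carrier W}"

definition tensor_null ::
    "(complex, 'v, 'm) module_scheme \<Rightarrow> (complex, 'w, 'n) module_scheme \<Rightarrow> ('v \<times> 'w \<Rightarrow> complex) set"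
  where "tensor_null V W =
    LinearCombinations.module.span complex_ring (free_space (carrier V \<times> carrier W)) (bilinear_relations V W)"

definition tensor_space ::
    "(complex, 'v, 'm) module_scheme \<Rightarrow> (complex, 'w, 'n) module_scheme
      \<Rightarrow> (complex, ('v \<times> 'w \<Rightarrow> complex) set) module"
  where "tensor_space V W =
    quotient_space (free_space (carrier V \<times> carrier W)) (tensor_null V W)"

definition tens ::
    "(complex, 'v, 'm) module_scheme \<Rightarrow> (complex, 'w, 'n) module_scheme
      \<Rightarrow> 'v \<Rightarrow> 'w \<Rightarrow> ('v \<times> 'w \<Rightarrow> complex) set"
  where "tens V W v w =
    tensor_null V W +>\<^bsub>free_space (carrier V \<times> carrier W)\<^esub> delta (v, w)"

definition bilinear_map ::
    "(complex, 'v, 'm) module_scheme \<Rightarrow> (complex, 'w, 'n) module_scheme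
      \<Rightarrow> (complex, 'u, 'k) module_scheme \<Rightarrow> ('v \<Rightarrow> 'w \<Rightarrow> 'u) \<Rightarrow> bool"
  where "bilinear_map V W U b \<longleftrightarrow>
    (\<forall>v\<in>carrier V. b v \<in> LinearCombinations.module_hom complex_ring W U) \<and>
    (\<forall>w\<in>carrier W. (\<lambda>v. b v w) \<in> LinearCombinations.module_hom complex_ring V U)"

text \<open>The linear map on the tensor product induced by a bilinear map; it exists uniquely by the
  universal property (lemma \<open>tensor_universal\<close> below).\<close>

definition tensor_lift ::
    "(complex, 'v, 'm) module_scheme \<Rightarrow> (complex, 'w, 'n) module_scheme
      \<Rightarrow> (complex, 'u, 'k) module_scheme \<Rightarrow> ('v \<Rightarrow> 'w \<Rightarrow> 'u)
      \<Rightarrow> ('v \<times> 'w \<Rightarrow> complex) set \<Rightarrow> 'u"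
  where "tensor_lift V W U b =
    (THE h. h \<in> LinearCombinations.module_hom complex_ring (tensor_space V W) U \<and>
            h \<in> extensional (carrier (tensor_space V W)) \<and>
            (\<forall>v \<in> carrier V. \<forall>w \<in> carrier W. h (tens V W v w) = b v w))"

definition tensor_rep ::
    "('g, 'v) rep \<Rightarrow> ('g, 'w) rep \<Rightarrow> ('g, ('v \<times> 'w \<Rightarrow> complex) set) rep"  (infixr \<open>\<otimes>\<^sub>R\<close> 70)
  where "V \<otimes>\<^sub>R W = module.extend (tensor_space V W)
    (rep.fields (\<lambda>g. tensor_lift V W (tensor_space V W) (\<lambda>v w. tens V W (act V g v) (act W g w))))"

definition tensor_mor ::
    "('g, 'v) rep \<Rightarrow> ('g, 'w) rep \<Rightarrow> ('g, 'v') rep \<Rightarrow> ('g, 'w') rep \<Rightarrow> ('v \<Rightarrow> 'v') \<Rightarrow> ('w \<Rightarrow> 'w')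
      \<Rightarrow> ('v \<times> 'w \<Rightarrow> complex) set \<Rightarrow> ('v' \<times> 'w' \<Rightarrow> complex) set"
  where "tensor_mor V W V' W' f h =
    tensor_lift V W (V' \<otimes>\<^sub>R W') (\<lambda>v w. tens V' W' (f v) (h w))"

definition unit_rep :: "('g, complex) rep"
  where "unit_rep = module.extend
    \<lparr>carrier = UNIV, mult = (*), one = 1, zero = 0, add = (+), smult = (*)\<rparr>
    (rep.fields (\<lambda>g z. z))"

definition flip_mor ::
    "('g, 'v) rep \<Rightarrow> ('g, 'w) rep \<Rightarrow> ('v \<times> 'w \<Rightarrow> complex) set \<Rightarrow> ('w \<times> 'v \<Rightarrow> complex) set"
  where "flip_mor V W = tensor_lift V W (W \<otimes>\<^sub>R V) (\<lambda>v w. tens W V w v)"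

definition assoc_mor :: "('g, 'u) rep \<Rightarrow> ('g, 'v) rep \<Rightarrow> ('g, 'w) rep
    \<Rightarrow> (('u \<times> 'v \<Rightarrow> complex) set \<times> 'w \<Rightarrow> complex) set \<Rightarrow> ('u \<times> ('v \<times> 'w \<Rightarrow> complex) set \<Rightarrow> complex) set"
  where "assoc_mor U V W =
    tensor_lift (U \<otimes>\<^sub>R V) W (U \<otimes>\<^sub>R (V \<otimes>\<^sub>R W))
      (\<lambda>x w. tensor_lift U V (U \<otimes>\<^sub>R (V \<otimes>\<^sub>R W)) (\<lambda>u v. tens U (V \<otimes>\<^sub>R W) u (tens V W v w)) x)"

definition assoc_inv_mor :: "('g, 'u) rep \<Rightarrow> ('g, 'v) rep \<Rightarrow> ('g, 'w) rep
    \<Rightarrow> ('u \<times> ('v \<times> 'w \<Rightarrow> complex) set \<Rightarrow> complex) set \<Rightarrow> (('u \<times> 'v \<Rightarrow> complex) set \<times> 'w \<Rightarrow> complex) set"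
  where "assoc_inv_mor U V W =
    tensor_lift U (V \<otimes>\<^sub>R W) ((U \<otimes>\<^sub>R V) \<otimes>\<^sub>R W)
      (\<lambda>u y. tensor_lift V W ((U \<otimes>\<^sub>R V) \<otimes>\<^sub>R W) (\<lambda>v w. tens (U \<otimes>\<^sub>R V) W (tens U V u v) w) y)"

text \<open>The unit isomorphisms $\mathbf 1 \otimes V \cong V \cong V \otimes \mathbf 1$ and their inverses.\<close>

definition lunit_mor :: "('g, 'v) rep \<Rightarrow> (complex \<times> 'v \<Rightarrow> complex) set \<Rightarrow> 'v"
  where "lunit_mor V = tensor_lift (unit_rep :: ('g, complex) rep) V V (\<lambda>c v. c \<odot>\<^bsub>V\<^esub> v)"
    for V :: "('g, 'v) rep"

definition runit_mor :: "('g, 'v) rep \<Rightarrow> ('v \<times> complex \<Rightarrow> complex) set \<Rightarrow> 'v"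
  where "runit_mor V = tensor_lift V (unit_rep :: ('g, complex) rep) V (\<lambda>v c. c \<odot>\<^bsub>V\<^esub> v)"
    for V :: "('g, 'v) rep"

definition lunit_inv_mor :: "('g, 'v) rep \<Rightarrow> 'v \<Rightarrow> (complex \<times> 'v \<Rightarrow> complex) set"
  where "lunit_inv_mor V = (\<lambda>v\<in>carrier V. tens (unit_rep :: ('g, complex) rep) V 1 v)"
    for V :: "('g, 'v) rep"

definition runit_inv_mor :: "('g, 'v) rep \<Rightarrow> 'v \<Rightarrow> ('v \<times> complex \<Rightarrow> complex) set"
  where "runit_inv_mor V = (\<lambda>v\<in>carrier V. tens V (unit_rep :: ('g, complex) rep) v 1)"
    for V :: "('g, 'v) rep"

subsection \<open>Rigidity axioms\<close>

text \<open>\<open>e : U \<otimes> V \<rightarrow> 1\<close> and \<open>i : 1 \<rightarrow> V \<otimes> U\<close> exhibit \<open>U\<close> as dual to \<open>V\<close>: the composites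
  \<open>V \<rightarrow> 1 \<otimes> V \<rightarrow> (V \<otimes> U) \<otimes> V \<rightarrow> V \<otimes> (U \<otimes> V) \<rightarrow> V \<otimes> 1 \<rightarrow> V\<close> and
  \<open>U \<rightarrow> U \<otimes> 1 \<rightarrow> U \<otimes> (V \<otimes> U) \<rightarrow> (U \<otimes> V) \<otimes> U \<rightarrow> 1 \<otimes> U \<rightarrow> U\<close> are identities.\<close>

definition rigidity_axioms :: "('g, 'u) rep \<Rightarrow> ('g, 'v) rep
    \<Rightarrow> (('u \<times> 'v \<Rightarrow> complex) set \<Rightarrow> complex) \<Rightarrow> (complex \<Rightarrow> ('v \<times> 'u \<Rightarrow> complex) set) \<Rightarrow> bool"
  where "rigidity_axioms U V e i \<longleftrightarrow>
    compose (carrier V) (runit_mor V \<circ> tensor_mor V (U \<otimes>\<^sub>R V) V unit_rep (id_mor V) e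
      \<circ> assoc_mor V U V \<circ> tensor_mor unit_rep V (V \<otimes>\<^sub>R U) V i (id_mor V)) (lunit_inv_mor V)
      = id_mor V \<and>
    compose (carrier U) (lunit_mor U \<circ> tensor_mor (U \<otimes>\<^sub>R V) U unit_rep U e (id_mor U)
      \<circ> assoc_inv_mor U V U \<circ> tensor_mor U unit_rep U (V \<otimes>\<^sub>R U) (id_mor U) i) (runit_inv_mor U)
      = id_mor U"

definition nondegenerate_pairing :: "('g, 'm) monoid_scheme \<Rightarrow> ('g, 'u) rep \<Rightarrow> ('g, 'v) rep
    \<Rightarrow> (('u \<times> 'v \<Rightarrow> complex) set \<Rightarrow> complex) \<Rightarrow> bool"
  where "nondegenerate_pairing G U V e \<longleftrightarrow> e \<in> rep_hom G (U \<otimes>\<^sub>R V) unit_rep \<and>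
    (\<exists>i \<in> rep_hom G unit_rep (V \<otimes>\<^sub>R U). rigidity_axioms U V e i)"

section \<open>Algebras in the category of representations\<close>

locale rep_algebra = fd_rep G A
  for G :: "('g, 'm) monoid_scheme" and A :: "('g, 'v) rep" +
  fixes \<mu> :: "('v \<times> 'v \<Rightarrow> complex) set \<Rightarrow> 'v" and \<iota> :: "complex \<Rightarrow> 'v"
  assumes mu_hom: "\<mu> \<in> rep_hom G (A \<otimes>\<^sub>R A) A"
    and iota_hom: "\<iota> \<in> rep_hom G unit_rep A"
    and iota_inj: "inj \<iota>"
    and mu_assoc: "compose (carrier ((A \<otimes>\<^sub>R A) \<otimes>\<^sub>R A)) \<mu> (tensor_mor (A \<otimes>\<^sub>R A) A A A \<mu> (id_mor A))
      = compose (carrier ((A \<otimes>\<^sub>R A) \<otimes>\<^sub>R A)) (\<mu> \<circ> tensor_mor A (A \<otimes>\<^sub>R A) A A (id_mor A) \<mu>)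
          (assoc_mor A A A)"
    and mu_comm: "compose (carrier (A \<otimes>\<^sub>R A)) \<mu> (flip_mor A A) = \<mu>"
    and mu_unit: "compose (carrier (unit_rep \<otimes>\<^sub>R A)) \<mu> (tensor_mor unit_rep A A A \<iota> (id_mor A))
      = lunit_mor A"
    and dim_hom_unit: "vectorspace.dim complex_ring (hom_space G unit_rep A) = 1"

definition counit :: "('g, 'm) monoid_scheme \<Rightarrow> ('g, 'v) rep \<Rightarrow> (complex \<Rightarrow> 'v) \<Rightarrow> 'v \<Rightarrow> complex"
  where "counit G A \<iota> =
    (THE \<epsilon>. \<epsilon> \<in> rep_hom G A unit_rep \<and> compose UNIV \<epsilon> \<iota> = id_mor (unit_rep :: ('g, complex) rep))"
    for A :: "('g, 'v) rep"

text \<open>The categorical dimension of a representation is its usual dimension, because the braiding is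
  the flip and the twist is trivial.\<close>

locale rigid_rep_algebra = rep_algebra +
  assumes nondegenerate:
      "nondegenerate_pairing G A A (compose (carrier (A \<otimes>\<^sub>R A)) (counit G A \<iota>) \<mu>)"
    and dim_nonzero: "vectorspace.dim complex_ring A \<noteq> 0"

definition rep_algebra_iso :: "('g, 'm) monoid_scheme
    \<Rightarrow> ('g, 'v) rep \<Rightarrow> (('v \<times> 'v \<Rightarrow> complex) set \<Rightarrow> 'v) \<Rightarrow> (complex \<Rightarrow> 'v)
    \<Rightarrow> ('g, 'w) rep \<Rightarrow> (('w \<times> 'w \<Rightarrow> complex) set \<Rightarrow> 'w) \<Rightarrow> (complex \<Rightarrow> 'w) \<Rightarrow> bool"
  where "rep_algebra_iso G A \<mu>A \<iota>A B \<mu>B \<iota>B \<longleftrightarrow>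
    (\<exists>\<phi> \<in> rep_hom G A B. bij_betw \<phi> (carrier A) (carrier B) \<and>
      compose (carrier (A \<otimes>\<^sub>R A)) \<phi> \<mu>A = compose (carrier (A \<otimes>\<^sub>R A)) \<mu>B (tensor_mor A A B B \<phi> \<phi>) \<and>
      compose UNIV \<phi> \<iota>A = \<iota>B)"

subsection \<open>Functions on a coset space\<close>

definition fun_rep :: "('g, 'm) monoid_scheme \<Rightarrow> 'g set \<Rightarrow> ('g, 'g set \<Rightarrow> complex) rep"
  where "fun_rep G H = module.extend (ring.func_space complex_ring (lcosets\<^bsub>G\<^esub> H))
    (rep.fields (\<lambda>g f. \<lambda>x\<in>lcosets\<^bsub>G\<^esub> H. f ((inv\<^bsub>G\<^esub> g) <#\<^bsub>G\<^esub> x)))"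

definition fun_mult :: "('g, 'm) monoid_scheme \<Rightarrow> 'g set
    \<Rightarrow> (('g set \<Rightarrow> complex) \<times> ('g set \<Rightarrow> complex) \<Rightarrow> complex) set \<Rightarrow> 'g set \<Rightarrow> complex"
  where "fun_mult G H = tensor_lift (fun_rep G H) (fun_rep G H) (fun_rep G H)
    (\<lambda>f h. \<lambda>x\<in>lcosets\<^bsub>G\<^esub> H. f x * h x)"

definition fun_unit :: "('g, 'm) monoid_scheme \<Rightarrow> 'g set \<Rightarrow> complex \<Rightarrow> 'g set \<Rightarrow> complex"
  where "fun_unit G H = (\<lambda>c. \<lambda>x\<in>lcosets\<^bsub>G\<^esub> H. c)"

section \<open>The definitions are as intended\<close>

lemma tensor_rep_simps [simp]:
  "carrier (V \<otimes>\<^sub>R W) = carrier (tensor_space V W)"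
  "add (V \<otimes>\<^sub>R W) = add (tensor_space V W)"
  "zero (V \<otimes>\<^sub>R W) = zero (tensor_space V W)"
  "smult (V \<otimes>\<^sub>R W) = smult (tensor_space V W)"
  "act (V \<otimes>\<^sub>R W) g =
    tensor_lift V W (tensor_space V W) (\<lambda>v w. tens V W (act V g v) (act W g w))"
  by (simp_all add: tensor_rep_def module.defs rep.defs)

lemma unit_rep_simps [simp]:
  "carrier unit_rep = UNIV" "add unit_rep = (+)" "zero unit_rep = 0" "smult unit_rep = (*)"
  "act unit_rep g z = z"
  by (simp_all add: unit_rep_def module.defs rep.defs)

lemma fun_rep_simps [simp]:
  "carrier (fun_rep G H) = (lcosets\<^bsub>G\<^esub> H) \<rightarrow>\<^sub>E UNIV"
  "act (fun_rep G H) g f = (\<lambda>x\<in>lcosets\<^bsub>G\<^esub> H. f ((inv\<^bsub>G\<^esub> g) <#\<^bsub>G\<^esub> x))"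
  by (simp_all add: fun_rep_def module.defs rep.defs class_ring.func_space_def)

subsection \<open>Carriers in \<open>nat \<Rightarrow> complex\<close> suffice\<close>

lemma fd_rep_iso_nat_complex:
  fixes V :: "('g, 'v) rep"
  assumes "fd_rep G V"
  obtains V' :: "('g, nat \<Rightarrow> complex) rep" and \<phi>
  where "fd_rep G V'" "\<phi> \<in> rep_hom G V V'" "bij_betw \<phi> (carrier V) (carrier V')"
proof -
  interpret V: fd_rep G V by fact
  obtain A where A: "finite A" "A \<subseteq> carrier V" "V.span A = carrier V"
    using V.fin_dim unfolding V.fin_dim_def by auto
  have "\<forall>v\<in>carrier V. \<exists>a. v = V.lincomb a A"
    using V.finite_span[OF A(1,2)] A(3) by blast
  then obtain a where a: "\<And>v. v \<in> carrier V \<Longrightarrow> v = V.lincomb (a v) A" by metis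
  obtain e where e: "bij_betw e {..<card A} A"
    using ex_bij_betw_nat_finite[OF A(1)] by (auto simp: atLeast0LessThan)
  define c where "c v = (\<lambda>i. if i < card A then a v (e i) else 0)" for v
  have inj: "inj_on c (carrier V)"
  proof
    fix v w assume vw: "v \<in> carrier V" "w \<in> carrier V" "c v = c w"
    have "a v x = a w x" if x: "x \<in> A" for x
    proof -
      obtain i where i: "i < card A" "x = e i" using e x by (auto simp: bij_betw_def)
      then show ?thesis using fun_cong[OF vw(3), of i] by (simp add: c_def)
    qed
    moreover have "x \<in> carrier V" "k \<odot>\<^bsub>V\<^esub> x \<in> carrier V" if "x \<in> A" for x k
      using that A(2) V.smult_closed[of k x] by auto
    ultimately have "V.lincomb (a v) A = V.lincomb (a w) A"
      unfolding V.lincomb_def by (intro V.finsum_cong') auto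
    then show "v = w" using a vw by metis
  qed
  define d where "d = inv_into (carrier V) c"
  have dc: "d (c v) = v" if "v \<in> carrier V" for v
    using inj that by (simp add: d_def)
  define V' :: "('g, nat \<Rightarrow> complex) rep" where "V' =
    \<lparr>carrier = c ` carrier V, mult = (\<lambda>x y. c \<zero>\<^bsub>V\<^esub>), one = c \<zero>\<^bsub>V\<^esub>, zero = c \<zero>\<^bsub>V\<^esub>,
     add = (\<lambda>x y. c (d x \<oplus>\<^bsub>V\<^esub> d y)), smult = (\<lambda>k x. c (k \<odot>\<^bsub>V\<^esub> d x)),
     act = (\<lambda>g x. c (act V g (d x)))\<rparr>"
  have act: "act V g v \<in> carrier V" if "g \<in> carrier G" "v \<in> carrier V" for g v
    using V.act_linear[OF that(1)] that(2) by (auto simp: LinearCombinations.module_hom_def)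
  have act_add: "act V g (v \<oplus>\<^bsub>V\<^esub> w) = act V g v \<oplus>\<^bsub>V\<^esub> act V g w"
    and act_smult: "act V g (k \<odot>\<^bsub>V\<^esub> v) = k \<odot>\<^bsub>V\<^esub> act V g v"
    if "g \<in> carrier G" "v \<in> carrier V" "w \<in> carrier V" for g v w k
    using V.act_linear[OF that(1)] that(2,3) by (auto simp: LinearCombinations.module_hom_def)
  have cl: "k \<odot>\<^bsub>V\<^esub> v \<in> carrier V" if "v \<in> carrier V" for k v
    using that by (intro V.smult_closed) auto
  have sd: "(x + y) \<odot>\<^bsub>V\<^esub> v = x \<odot>\<^bsub>V\<^esub> v \<oplus>\<^bsub>V\<^esub> y \<odot>\<^bsub>V\<^esub> v" "(x * y) \<odot>\<^bsub>V\<^esub> v = x \<odot>\<^bsub>V\<^esub> (y \<odot>\<^bsub>V\<^esub> v)"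
    "1 \<odot>\<^bsub>V\<^esub> v = v"
    if "v \<in> carrier V" for x y v
    using V.smult_l_distr[of x y v] V.smult_assoc1[of x y v] V.smult_one[of v] that by simp_all
  have vs: "vectorspace complex_ring V'"
  proof (rule vs_criteria)
    show "\<forall>v\<in>carrier V'. \<exists>neg_v\<in>carrier V'. v \<oplus>\<^bsub>V'\<^esub> neg_v = \<zero>\<^bsub>V'\<^esub>"
    proof
      fix x assume "x \<in> carrier V'"
      then obtain v where "v \<in> carrier V" "x = c v" by (auto simp: V'_def)
      then show "\<exists>neg_v\<in>carrier V'. x \<oplus>\<^bsub>V'\<^esub> neg_v = \<zero>\<^bsub>V'\<^esub>"
        by (intro bexI[of _ "c (\<ominus>\<^bsub>V\<^esub> v)"]) (auto simp: V'_def dc V.r_neg)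
    qed
  qed (auto simp: V'_def dc cl class_field V.a_ac V.smult_r_distr sd)
  interpret V': vectorspace complex_ring V' by fact
  define \<phi> where "\<phi> = restrict c (carrier V)"
  have \<phi>: "\<phi> \<in> rep_hom G V V'"
    by (auto simp: rep_hom_def LinearCombinations.module_hom_def \<phi>_def V'_def dc cl act)
  have "V'.fin_dim"
  proof -
    have cA: "c ` A \<subseteq> carrier V'" using A by (auto simp: V'_def)
    interpret S: submodule complex_ring "V'.span (c ` A)" V'
      by (rule V'.span_is_submodule[OF cA])
    have "submodule complex_ring {v \<in> carrier V. c v \<in> V'.span (c ` A)} V"
    proof (unfold_locales, goal_cases)
      case (2 v w)
      then have "c v \<oplus>\<^bsub>V'\<^esub> c w \<in> V'.span (c ` A)" by auto
      with 2 show ?case by (auto simp: V'_def dc)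
    next
      case 3
      have "\<zero>\<^bsub>V'\<^esub> \<in> V'.span (c ` A)" by (rule S.zero_closed)
      then show ?case by (auto simp: V'_def)
    next
      case (4 k v)
      then have "k \<odot>\<^bsub>V'\<^esub> c v \<in> V'.span (c ` A)" by auto
      with 4 show ?case by (auto simp: V'_def dc cl)
    qed auto
    then have "V.span A \<subseteq> {v \<in> carrier V. c v \<in> V'.span (c ` A)}"
      using A(2) V'.in_own_span[OF cA] by (intro V.span_is_subset) auto
    then have "V'.span (c ` A) = carrier V'"
      using A(3) V'.span_is_subset2[OF cA] by (auto simp: V'_def)
    then show ?thesis unfolding V'.fin_dim_def using A(1) cA by blast
  qed
  then have "fd_rep G V'"
    using vs
    by (intro fd_rep.intro fd_rep_axioms.intro V.group_axioms)
      (auto simp: V'_def LinearCombinations.module_hom_def dc cl act act_add act_smult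
        V.act_one V.act_mult)
  moreover have "bij_betw \<phi> (carrier V) (carrier V')"
    using inj by (auto simp: \<phi>_def V'_def bij_betw_def inj_on_def)
  ultimately show ?thesis using that \<phi> by blast
qed

subsection \<open>Universal property of the tensor product\<close>

lemma free_space_vs: "vectorspace complex_ring (free_space X)"
proof (rule vs_criteria)
  show "\<forall>v w. v \<in> carrier (free_space X) \<and> w \<in> carrier (free_space X) \<longrightarrow>
      v \<oplus>\<^bsub>free_space X\<^esub> w \<in> carrier (free_space X)"
  proof safe
    fix v w :: "'a \<Rightarrow> complex"
    assume "v \<in> carrier (free_space X)" "w \<in> carrier (free_space X)"
    moreover have "{x. v x + w x \<noteq> 0} \<subseteq> {x. v x \<noteq> 0} \<union> {x. w x \<noteq> 0}" by auto
    ultimately show "v \<oplus>\<^bsub>free_space X\<^esub> w \<in> carrier (free_space X)"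
      by (auto simp: free_space_def intro: finite_subset)
  qed
  show "\<forall>v\<in>carrier (free_space X). \<exists>neg_v\<in>carrier (free_space X).
      v \<oplus>\<^bsub>free_space X\<^esub> neg_v = \<zero>\<^bsub>free_space X\<^esub>"
  proof
    fix v assume "v \<in> carrier (free_space X)"
    then show "\<exists>neg_v\<in>carrier (free_space X). v \<oplus>\<^bsub>free_space X\<^esub> neg_v = \<zero>\<^bsub>free_space X\<^esub>"
      by (intro bexI[of _ "\<lambda>x. - v x"]) (auto simp: free_space_def)
  qed
  show "\<forall>c v. c \<in> carrier complex_ring \<and> v \<in> carrier (free_space X) \<longrightarrow>
      c \<odot>\<^bsub>free_space X\<^esub> v \<in> carrier (free_space X)"
    by (auto simp: free_space_def intro: finite_subset[rotated])
qed (auto simp: free_space_def class_field algebra_simps)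

lemma quotient_space_vs:
  assumes "vectorspace complex_ring V" and N: "submodule complex_ring N V"
  shows quotient_space_is_vs: "vectorspace complex_ring (quotient_space V N)"
    and quotient_proj: "(\<lambda>v. N +>\<^bsub>V\<^esub> v)
      \<in> LinearCombinations.module_hom complex_ring V (quotient_space V N)"
    and quotient_eq_iff: "\<And>v w. v \<in> carrier V \<Longrightarrow> w \<in> carrier V \<Longrightarrow>
      N +>\<^bsub>V\<^esub> v = N +>\<^bsub>V\<^esub> w \<longleftrightarrow> (\<exists>n\<in>N. w = n \<oplus>\<^bsub>V\<^esub> v)"
    and quotient_carrier: "carrier (quotient_space V N) = (\<lambda>v. N +>\<^bsub>V\<^esub> v) ` carrier V"
proof -
  interpret V: vectorspace complex_ring V by fact
  interpret N: submodule complex_ring N V by fact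
  have neg: "\<ominus>\<^bsub>V\<^esub> n \<in> N" if "n \<in> N" for n
  proof -
    have "(-1) \<odot>\<^bsub>V\<^esub> n \<in> N" using that N.smult_closed[of "-1" n] by simp
    moreover have "(-1) \<odot>\<^bsub>V\<^esub> n = \<ominus>\<^bsub>V\<^esub> n"
      using V.smult_l_minus[of 1 n] that N.subset V.smult_one[of n]
      by (auto simp: class_ring_simps)
    ultimately show ?thesis by simp
  qed
  have "N \<noteq> {}" using N.zero_closed by blast
  then have "subgroup N (add_monoid V)"
  proof (intro V.add.subgroupI)
    show "\<ominus>\<^bsub>V\<^esub> n \<in> N" if "n \<in> N" for n
      by (rule neg[OF that])
    show "v \<oplus>\<^bsub>V\<^esub> w \<in> N" if "v \<in> N" "w \<in> N" for v w
      by (rule N.m_closed[OF that])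
  qed (use N.subset \<open>N \<noteq> {}\<close> in simp_all)
  then interpret N: abelian_subgroup N V
    by (intro abelian_subgroupI3 additive_subgroupI V.abelian_group_axioms)
  show car: "carrier (quotient_space V N) = (\<lambda>v. N +>\<^bsub>V\<^esub> v) ` carrier V"
    by (auto simp: quotient_space_def A_RCOSETS_def')
  show eq: "N +>\<^bsub>V\<^esub> v = N +>\<^bsub>V\<^esub> w \<longleftrightarrow> (\<exists>n\<in>N. w = n \<oplus>\<^bsub>V\<^esub> v)"
    if "v \<in> carrier V" "w \<in> carrier V" for v w
  proof
    assume "N +>\<^bsub>V\<^esub> v = N +>\<^bsub>V\<^esub> w"
    then have "w \<in> N +>\<^bsub>V\<^esub> v" using N.a_rcos_self[OF that(2)] by simp
    then show "\<exists>n\<in>N. w = n \<oplus>\<^bsub>V\<^esub> v" by (auto simp: a_r_coset_def')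
  next
    assume "\<exists>n\<in>N. w = n \<oplus>\<^bsub>V\<^esub> v"
    then have "w \<in> N +>\<^bsub>V\<^esub> v" by (auto simp: a_r_coset_def')
    then show "N +>\<^bsub>V\<^esub> v = N +>\<^bsub>V\<^esub> w"
      using V.a_repr_independence[OF _ that(1)] \<open>subgroup N (add_monoid V)\<close> by blast
  qed
  have add: "(N +>\<^bsub>V\<^esub> v) \<oplus>\<^bsub>quotient_space V N\<^esub> (N +>\<^bsub>V\<^esub> w) = N +>\<^bsub>V\<^esub> (v \<oplus>\<^bsub>V\<^esub> w)"
    if "v \<in> carrier V" "w \<in> carrier V" for v w
    using N.a_rcos_sum[OF that] by (simp add: quotient_space_def)
  have smult: "c \<odot>\<^bsub>quotient_space V N\<^esub> (N +>\<^bsub>V\<^esub> v) = N +>\<^bsub>V\<^esub> (c \<odot>\<^bsub>V\<^esub> v)"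
    if "v \<in> carrier V" for c v
  proof -
    have "N +>\<^bsub>V\<^esub> (c \<odot>\<^bsub>V\<^esub> x) = N +>\<^bsub>V\<^esub> (c \<odot>\<^bsub>V\<^esub> v)" if x: "x \<in> N +>\<^bsub>V\<^esub> v" for x
    proof -
      obtain n where n: "n \<in> N" "x = n \<oplus>\<^bsub>V\<^esub> v" using x by (auto simp: a_r_coset_def')
      have nV: "n \<in> carrier V" using n N.subset by auto
      have "c \<odot>\<^bsub>V\<^esub> x = c \<odot>\<^bsub>V\<^esub> n \<oplus>\<^bsub>V\<^esub> c \<odot>\<^bsub>V\<^esub> v"
        using n nV \<open>v \<in> carrier V\<close> by (simp add: V.smult_r_distr)
      moreover have "c \<odot>\<^bsub>V\<^esub> n \<in> N" using n by (simp add: N.smult_closed)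
      moreover have "c \<odot>\<^bsub>V\<^esub> x \<in> carrier V"
        using n nV \<open>v \<in> carrier V\<close> by (intro V.smult_closed) auto
      moreover have "c \<odot>\<^bsub>V\<^esub> v \<in> carrier V"
        using \<open>v \<in> carrier V\<close> by (intro V.smult_closed) auto
      ultimately show ?thesis using eq[of "c \<odot>\<^bsub>V\<^esub> v" "c \<odot>\<^bsub>V\<^esub> x"] by blast
    qed
    then have "(\<Union>x\<in>N +>\<^bsub>V\<^esub> v. N +>\<^bsub>V\<^esub> (c \<odot>\<^bsub>V\<^esub> x)) = (\<Union>x\<in>N +>\<^bsub>V\<^esub> v. N +>\<^bsub>V\<^esub> (c \<odot>\<^bsub>V\<^esub> v))"
      by (intro SUP_cong) simp_all
    also have "\<dots> = N +>\<^bsub>V\<^esub> (c \<odot>\<^bsub>V\<^esub> v)"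
    proof -
      have "N +>\<^bsub>V\<^esub> v \<noteq> {}" using N.a_rcos_self[OF that] by blast
      then show ?thesis by (simp only: UN_constant if_False)
    qed
    finally show ?thesis by (simp only: quotient_space_def module.simps)
  qed
  have zero: "\<zero>\<^bsub>quotient_space V N\<^esub> = N +>\<^bsub>V\<^esub> \<zero>\<^bsub>V\<^esub>"
    using V.a_coset_add_zero[OF N.subset] by (simp add: quotient_space_def)
  have cl: "c \<odot>\<^bsub>V\<^esub> v \<in> carrier V" if "v \<in> carrier V" for c v
    using that by (intro V.smult_closed) auto
  show "(\<lambda>v. N +>\<^bsub>V\<^esub> v) \<in> LinearCombinations.module_hom complex_ring V (quotient_space V N)"
    by (auto simp: LinearCombinations.module_hom_def car add smult)
  have sd: "(a + b) \<odot>\<^bsub>V\<^esub> v = a \<odot>\<^bsub>V\<^esub> v \<oplus>\<^bsub>V\<^esub> b \<odot>\<^bsub>V\<^esub> v" "(a * b) \<odot>\<^bsub>V\<^esub> v = a \<odot>\<^bsub>V\<^esub> (b \<odot>\<^bsub>V\<^esub> v)"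
    "1 \<odot>\<^bsub>V\<^esub> v = v"
    if "v \<in> carrier V" for a b v
    using V.smult_l_distr[of a b v] V.smult_assoc1[of a b v] V.smult_one[of v] that by simp_all
  have All: "\<forall>X\<in>carrier (quotient_space V N). P X" if "\<And>v. v \<in> carrier V \<Longrightarrow> P (N +>\<^bsub>V\<^esub> v)" for P
    unfolding car using that by (intro ballI, elim imageE) simp
  have in_car: "N +>\<^bsub>V\<^esub> v \<in> carrier (quotient_space V N)" if "v \<in> carrier V" for v
    unfolding car using that by (rule imageI)
  let ?Q = "quotient_space V N"
  have "\<forall>X\<in>carrier ?Q. \<forall>Y\<in>carrier ?Q. X \<oplus>\<^bsub>?Q\<^esub> Y \<in> carrier ?Q"
    by (intro All) (simp add: add in_car)
  moreover have "\<forall>X\<in>carrier ?Q. \<exists>Y\<in>carrier ?Q. X \<oplus>\<^bsub>?Q\<^esub> Y = \<zero>\<^bsub>?Q\<^esub>"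
  proof (intro All)
    fix v assume v: "v \<in> carrier V"
    show "\<exists>Y\<in>carrier ?Q. (N +>\<^bsub>V\<^esub> v) \<oplus>\<^bsub>?Q\<^esub> Y = \<zero>\<^bsub>?Q\<^esub>"
      by (rule bexI[of _ "N +>\<^bsub>V\<^esub> (\<ominus>\<^bsub>V\<^esub> v)"]) (use v in \<open>simp_all add: in_car add zero V.r_neg\<close>)
  qed
  moreover have "\<forall>X\<in>carrier ?Q. c \<odot>\<^bsub>?Q\<^esub> X \<in> carrier ?Q" for c
    by (intro All) (simp add: smult cl in_car)
  moreover have "\<forall>X\<in>carrier ?Q. \<forall>Y\<in>carrier ?Q. X \<oplus>\<^bsub>?Q\<^esub> Y = Y \<oplus>\<^bsub>?Q\<^esub> X"
    by (intro All) (simp add: add V.a_comm)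
  moreover have "\<forall>X\<in>carrier ?Q. \<forall>Y\<in>carrier ?Q. \<forall>Z\<in>carrier ?Q.
      (X \<oplus>\<^bsub>?Q\<^esub> Y) \<oplus>\<^bsub>?Q\<^esub> Z = X \<oplus>\<^bsub>?Q\<^esub> (Y \<oplus>\<^bsub>?Q\<^esub> Z)"
    by (intro All) (simp add: add V.a_assoc)
  moreover have "\<forall>X\<in>carrier ?Q. X \<oplus>\<^bsub>?Q\<^esub> \<zero>\<^bsub>?Q\<^esub> = X"
    by (intro All) (simp add: add zero)
  moreover have "\<forall>X\<in>carrier ?Q. (a * b) \<odot>\<^bsub>?Q\<^esub> X = a \<odot>\<^bsub>?Q\<^esub> (b \<odot>\<^bsub>?Q\<^esub> X)" for a b
    by (intro All) (simp add: smult cl sd(2))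
  moreover have "\<forall>X\<in>carrier ?Q. 1 \<odot>\<^bsub>?Q\<^esub> X = X"
    by (intro All) (simp add: smult sd(3))
  moreover have "\<forall>X\<in>carrier ?Q. (a + b) \<odot>\<^bsub>?Q\<^esub> X = a \<odot>\<^bsub>?Q\<^esub> X \<oplus>\<^bsub>?Q\<^esub> b \<odot>\<^bsub>?Q\<^esub> X" for a b
    by (intro All) (simp add: smult add cl sd(1))
  moreover have "\<forall>X\<in>carrier ?Q. \<forall>Y\<in>carrier ?Q.
      a \<odot>\<^bsub>?Q\<^esub> (X \<oplus>\<^bsub>?Q\<^esub> Y) = a \<odot>\<^bsub>?Q\<^esub> X \<oplus>\<^bsub>?Q\<^esub> a \<odot>\<^bsub>?Q\<^esub> Y" for a
    by (intro All) (simp add: smult add cl V.smult_r_distr)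
  ultimately show "vectorspace complex_ring ?Q"
    by (intro vs_criteria class_field) (simp_all add: zero in_car)
qed

lemma bilinear_relations_carrier:
  assumes "vectorspace complex_ring V" "vectorspace complex_ring W"
  shows "bilinear_relations V W \<subseteq> carrier (free_space (carrier V \<times> carrier W))"
proof -
  interpret V: vectorspace complex_ring V by fact
  interpret W: vectorspace complex_ring W by fact
  have V: "c \<odot>\<^bsub>V\<^esub> v \<in> carrier V" if "v \<in> carrier V" for c v
    using that by (intro V.smult_closed) auto
  have W: "c \<odot>\<^bsub>W\<^esub> v \<in> carrier W" if "v \<in> carrier W" for c v
    using that by (intro W.smult_closed) auto
  have *: "f \<in> carrier (free_space X)" if "finite S" "S \<subseteq> X" "\<And>x. x \<notin> S \<Longrightarrow> f x = 0"
    for f :: "'x \<Rightarrow> complex" and X S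
  proof -
    have "{x. f x \<noteq> 0} \<subseteq> S" using that(3) by blast
    then show ?thesis using that finite_subset by (auto simp: free_space_def)
  qed
  show ?thesis
    unfolding bilinear_relations_def
  proof (safe, goal_cases)
    case (1 _ v v' w)
    then show ?case by (intro *[of "{(v \<oplus>\<^bsub>V\<^esub> v', w), (v, w), (v', w)}"]) (auto simp: delta_def)
  next
    case (2 _ v w w')
    then show ?case by (intro *[of "{(v, w \<oplus>\<^bsub>W\<^esub> w'), (v, w), (v, w')}"]) (auto simp: delta_def)
  next
    case (3 _ c v w)
    then show ?case by (intro *[of "{(c \<odot>\<^bsub>V\<^esub> v, w), (v, w)}"]) (auto simp: delta_def V)
  next
    case (4 _ c v w)
    then show ?case by (intro *[of "{(v, c \<odot>\<^bsub>W\<^esub> w), (v, w)}"]) (auto simp: delta_def W)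
  qed
qed

lemma delta_carrier: "x \<in> X \<Longrightarrow> delta x \<in> carrier (free_space X)"
  by (auto simp: delta_def free_space_def)

lemma free_space_hom_eqI:
  assumes "vectorspace complex_ring U"
    and h: "h \<in> LinearCombinations.module_hom complex_ring (free_space X) U"
    and k: "k \<in> LinearCombinations.module_hom complex_ring (free_space X) U"
    and eq: "\<And>x. x \<in> X \<Longrightarrow> h (delta x) = k (delta x)"
    and f: "f \<in> carrier (free_space X)"
  shows "h f = k f"
proof -
  interpret U: vectorspace complex_ring U by fact
  interpret F: vectorspace complex_ring "free_space X" by (rule free_space_vs)
  interpret h: mod_hom complex_ring "free_space X" U h
    using h by unfold_locales auto
  interpret k: mod_hom complex_ring "free_space X" U k
    using k by unfold_locales auto
  have "h f = k f" if "finite S" "S \<subseteq> X" "{x. f x \<noteq> 0} \<subseteq> S" for S f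
    using that
  proof (induction S arbitrary: f)
    case empty
    then have "f = \<zero>\<^bsub>free_space X\<^esub>" by (auto simp: free_space_def)
    then show ?case by (simp only: h.f0_is_0 k.f0_is_0)
  next
    case (insert x S)
    define g where "g = f(x := 0)"
    have g: "{y. g y \<noteq> 0} \<subseteq> S" using insert.prems by (auto simp: g_def)
    have gF: "g \<in> carrier (free_space X)"
      using g insert finite_subset by (auto simp: free_space_def)
    have d: "delta x \<in> carrier (free_space X)" using insert by (auto intro: delta_carrier)
    have fx: "f = g \<oplus>\<^bsub>free_space X\<^esub> (f x \<odot>\<^bsub>free_space X\<^esub> delta x)"
      by (auto simp: free_space_def g_def delta_def fun_eq_iff)
    have sF: "f x \<odot>\<^bsub>free_space X\<^esub> delta x \<in> carrier (free_space X)"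
      using d by (intro F.smult_closed) auto
    have "h f = h g \<oplus>\<^bsub>U\<^esub> (f x \<odot>\<^bsub>U\<^esub> h (delta x))"
      using h.f_smult[of "f x" "delta x"] d by (subst fx, subst h.f_add[OF gF sF]) simp
    moreover have "k f = k g \<oplus>\<^bsub>U\<^esub> (f x \<odot>\<^bsub>U\<^esub> k (delta x))"
      using k.f_smult[of "f x" "delta x"] d by (subst fx, subst k.f_add[OF gF sF]) simp
    moreover have "h g = k g" using insert g by simp
    ultimately show ?case using eq[of x] insert.prems by simp
  qed
  then show ?thesis using f by (auto simp: free_space_def)
qed

lemma free_space_lift:
  assumes "vectorspace complex_ring U" and b: "\<And>x. x \<in> X \<Longrightarrow> b x \<in> carrier U"
  shows "\<exists>h \<in> LinearCombinations.module_hom complex_ring (free_space X) U. \<forall>x\<in>X. h (delta x) = b x"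
proof -
  interpret U: vectorspace complex_ring U by fact
  define h where "h f = (\<Oplus>\<^bsub>U\<^esub>x\<in>{x. f x \<noteq> 0}. f x \<odot>\<^bsub>U\<^esub> b x)" for f
  have cl: "c \<odot>\<^bsub>U\<^esub> v \<in> carrier U" if "v \<in> carrier U" for c v
    using that by (intro U.smult_closed) auto
  have sd: "(a + b) \<odot>\<^bsub>U\<^esub> v = a \<odot>\<^bsub>U\<^esub> v \<oplus>\<^bsub>U\<^esub> b \<odot>\<^bsub>U\<^esub> v" "(a * b) \<odot>\<^bsub>U\<^esub> v = a \<odot>\<^bsub>U\<^esub> (b \<odot>\<^bsub>U\<^esub> v)"
    "1 \<odot>\<^bsub>U\<^esub> v = v" "0 \<odot>\<^bsub>U\<^esub> v = \<zero>\<^bsub>U\<^esub>"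
    if "v \<in> carrier U" for a b v
    using U.smult_l_distr[of a b v] U.smult_assoc1[of a b v] U.smult_one[of v] U.lmult_0[of v] that
    by simp_all
  have h_S: "h f = (\<Oplus>\<^bsub>U\<^esub>x\<in>S. f x \<odot>\<^bsub>U\<^esub> b x)"
    if "finite S" "S \<subseteq> X" "{x. f x \<noteq> 0} \<subseteq> S" for f S
    unfolding h_def using that b
    by (intro U.add.finprod_mono_neutral_cong_left) (auto simp: sd intro!: cl)
  have "h \<in> LinearCombinations.module_hom complex_ring (free_space X) U"
    unfolding LinearCombinations.module_hom_def
  proof (safe, goal_cases)
    case (1 f)
    then show ?case unfolding h_def
      by (intro U.finsum_closed) (auto simp: free_space_def intro!: cl b)
  next
    case (2 f g)
    let ?S = "{x. f x \<noteq> 0} \<union> {x. g x \<noteq> 0}"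
    have S: "finite ?S" "?S \<subseteq> X" using 2 by (auto simp: free_space_def)
    have "h (f \<oplus>\<^bsub>free_space X\<^esub> g) = (\<Oplus>\<^bsub>U\<^esub>x\<in>?S. (f x + g x) \<odot>\<^bsub>U\<^esub> b x)"
      using S by (subst h_S[of ?S]) (auto simp: free_space_def)
    also have "\<dots> = (\<Oplus>\<^bsub>U\<^esub>x\<in>?S. f x \<odot>\<^bsub>U\<^esub> b x \<oplus>\<^bsub>U\<^esub> g x \<odot>\<^bsub>U\<^esub> b x)"
      using S b by (intro U.finsum_cong') (auto simp: sd subset_iff intro!: cl)
    also have "\<dots> = (\<Oplus>\<^bsub>U\<^esub>x\<in>?S. f x \<odot>\<^bsub>U\<^esub> b x) \<oplus>\<^bsub>U\<^esub> (\<Oplus>\<^bsub>U\<^esub>x\<in>?S. g x \<odot>\<^bsub>U\<^esub> b x)"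
      using S b by (intro U.finsum_addf) (auto simp: subset_iff intro!: cl)
    also have "\<dots> = h f \<oplus>\<^bsub>U\<^esub> h g"
      using S by (simp add: h_S[of ?S])
    finally show ?case .
  next
    case (3 c f)
    let ?S = "{x. f x \<noteq> 0}"
    have S: "finite ?S" "?S \<subseteq> X" using 3 by (auto simp: free_space_def)
    have "h (c \<odot>\<^bsub>free_space X\<^esub> f) = (\<Oplus>\<^bsub>U\<^esub>x\<in>?S. (c * f x) \<odot>\<^bsub>U\<^esub> b x)"
      using S by (subst h_S[of ?S]) (auto simp: free_space_def)
    also have "\<dots> = (\<Oplus>\<^bsub>U\<^esub>x\<in>?S. c \<odot>\<^bsub>U\<^esub> (f x \<odot>\<^bsub>U\<^esub> b x))"
      using S b by (intro U.finsum_cong') (auto simp: sd subset_iff intro!: cl)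
    also have "\<dots> = c \<odot>\<^bsub>U\<^esub> h f"
      unfolding h_def using S b
      by (intro U.finsum_smult[symmetric]) (auto simp: subset_iff intro!: cl)
    finally show ?case .
  qed
  moreover have "h (delta x) = b x" if "x \<in> X" for x
  proof -
    have "h (delta x) = (\<Oplus>\<^bsub>U\<^esub>y\<in>{x}. delta x y \<odot>\<^bsub>U\<^esub> b y)"
      using that by (intro h_S) (auto simp: delta_def)
    also have "\<dots> = b x" using b[OF that] by (simp add: delta_def sd)
    finally show ?thesis .
  qed
  ultimately show ?thesis by blast
qed

lemma
  assumes V: "vectorspace complex_ring V" and W: "vectorspace complex_ring W"
  shows tensor_null_submodule:
      "submodule complex_ring (tensor_null V W) (free_space (carrier V \<times> carrier W))"
    and tensor_space_is_vs: "vectorspace complex_ring (tensor_space V W)"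
proof -
  interpret F: vectorspace complex_ring "free_space (carrier V \<times> carrier W)" by (rule free_space_vs)
  show N: "submodule complex_ring (tensor_null V W) (free_space (carrier V \<times> carrier W))"
    unfolding tensor_null_def by (rule F.span_is_submodule[OF bilinear_relations_carrier[OF V W]])
  show "vectorspace complex_ring (tensor_space V W)"
    unfolding tensor_space_def by (rule quotient_space_is_vs[OF free_space_vs N])
qed

lemma quotient_lift:
  assumes V: "vectorspace complex_ring V" and N: "submodule complex_ring N V"
    and U: "vectorspace complex_ring U"
    and E: "E \<in> LinearCombinations.module_hom complex_ring V U"
    and E0: "\<And>n. n \<in> N \<Longrightarrow> E n = \<zero>\<^bsub>U\<^esub>"
  shows "\<exists>h. h \<in> LinearCombinations.module_hom complex_ring (quotient_space V N) U \<and>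
    h \<in> extensional (carrier (quotient_space V N)) \<and> (\<forall>v\<in>carrier V. h (N +>\<^bsub>V\<^esub> v) = E v)"
proof -
  interpret V: vectorspace complex_ring V by fact
  interpret U: vectorspace complex_ring U by fact
  let ?Q = "quotient_space V N" and ?p = "\<lambda>v. N +>\<^bsub>V\<^esub> v"
  have Q: "carrier ?Q = ?p ` carrier V" by (rule quotient_carrier[OF V N])
  have pQ: "?p v \<in> carrier ?Q" if "v \<in> carrier V" for v unfolding Q using that by (rule imageI)
  note p = quotient_proj[OF V N]
  have Ecl: "E v \<in> carrier U" if "v \<in> carrier V" for v
    using LinearCombinations.module_hom_closed[OF E] that by blast
  have sub: "N \<subseteq> carrier V" using N by (simp add: submodule_def)
  have E_eq: "E v = E w" if vw: "v \<in> carrier V" "w \<in> carrier V" "?p v = ?p w" for v w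
  proof -
    have "\<exists>n\<in>N. w = n \<oplus>\<^bsub>V\<^esub> v" using vw(3) unfolding quotient_eq_iff[OF V N vw(1,2)] .
    then obtain n where n: "n \<in> N" "w = n \<oplus>\<^bsub>V\<^esub> v" by (rule bexE)
    have nV: "n \<in> carrier V" using n(1) sub by blast
    have "E w = E n \<oplus>\<^bsub>U\<^esub> E v"
      unfolding n(2) by (rule LinearCombinations.module_hom_add[OF E nV vw(1)])
    then show ?thesis using E0[OF n(1)] Ecl[OF vw(1)] by simp
  qed
  define h where "h = (\<lambda>x\<in>carrier ?Q. E (SOME v. v \<in> carrier V \<and> ?p v = x))"
  have h: "h (?p v) = E v" if v: "v \<in> carrier V" for v
  proof -
    let ?w = "SOME w. w \<in> carrier V \<and> ?p w = ?p v"
    have "?w \<in> carrier V \<and> ?p ?w = ?p v" by (rule someI[of _ v]) (use v in simp)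
    then have "E ?w = E v" using E_eq[of ?w v] v by simp
    then show ?thesis using pQ[OF v] by (simp add: h_def)
  qed
  have "h \<in> LinearCombinations.module_hom complex_ring ?Q U"
    unfolding LinearCombinations.module_hom_def mem_Collect_eq
  proof (intro conjI allI impI funcsetI)
    fix x assume "x \<in> carrier ?Q"
    then obtain v where v: "x = ?p v" "v \<in> carrier V" unfolding Q by (rule imageE)
    then show "h x \<in> carrier U" using h Ecl by simp
  next
    fix x y assume xy: "x \<in> carrier ?Q \<and> y \<in> carrier ?Q"
    obtain v where v: "x = ?p v" "v \<in> carrier V"
      using conjunct1[OF xy] unfolding Q by (rule imageE)
    obtain w where w: "y = ?p w" "w \<in> carrier V"
      using conjunct2[OF xy] unfolding Q by (rule imageE)
    have "x \<oplus>\<^bsub>?Q\<^esub> y = ?p (v \<oplus>\<^bsub>V\<^esub> w)"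
      using LinearCombinations.module_hom_add[OF p v(2) w(2)] v w by simp
    then show "h (x \<oplus>\<^bsub>?Q\<^esub> y) = h x \<oplus>\<^bsub>U\<^esub> h y"
      using v w h LinearCombinations.module_hom_add[OF E v(2) w(2)] by simp
  next
    fix c x assume x: "c \<in> carrier complex_ring \<and> x \<in> carrier ?Q"
    obtain v where v: "x = ?p v" "v \<in> carrier V"
      using conjunct2[OF x] unfolding Q by (rule imageE)
    have "c \<odot>\<^bsub>?Q\<^esub> x = ?p (c \<odot>\<^bsub>V\<^esub> v)"
      using LinearCombinations.module_hom_smult[OF p _ v(2), of c] v by simp
    moreover have "c \<odot>\<^bsub>V\<^esub> v \<in> carrier V" using v by (intro V.smult_closed) auto
    ultimately show "h (c \<odot>\<^bsub>?Q\<^esub> x) = c \<odot>\<^bsub>U\<^esub> h x"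
      using v h LinearCombinations.module_hom_smult[OF E _ v(2), of c] by simp
  qed
  moreover have "h \<in> extensional (carrier ?Q)" by (simp add: h_def)
  moreover have "\<forall>v\<in>carrier V. h (?p v) = E v" using h by (rule ballI)
  ultimately show ?thesis by (intro exI conjI)
qed

lemma free_space_diff:
  assumes f: "f \<in> carrier (free_space X)" and g: "g \<in> carrier (free_space X)"
  shows "(\<lambda>x. f x - c * g x) \<in> carrier (free_space X)"
    and "\<lbrakk>vectorspace complex_ring U; E \<in> LinearCombinations.module_hom complex_ring (free_space X) U\<rbrakk>
      \<Longrightarrow> E (\<lambda>x. f x - c * g x) = E f \<ominus>\<^bsub>U\<^esub> (c \<odot>\<^bsub>U\<^esub> E g)"
proof -
  interpret F: vectorspace complex_ring "free_space X" by (rule free_space_vs)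
  have eq: "(\<lambda>x. f x - c * g x) = f \<oplus>\<^bsub>free_space X\<^esub> ((- c) \<odot>\<^bsub>free_space X\<^esub> g)"
    by (auto simp: free_space_def)
  have cg: "(- c) \<odot>\<^bsub>free_space X\<^esub> g \<in> carrier (free_space X)"
    using g by (intro F.smult_closed) auto
  show "(\<lambda>x. f x - c * g x) \<in> carrier (free_space X)"
    unfolding eq using f cg by (rule F.a_closed)
  assume U: "vectorspace complex_ring U"
    and E: "E \<in> LinearCombinations.module_hom complex_ring (free_space X) U"
  interpret U: vectorspace complex_ring U by fact
  have Eg: "E g \<in> carrier U" using LinearCombinations.module_hom_closed[OF E] g by blast
  have "E (\<lambda>x. f x - c * g x) = E f \<oplus>\<^bsub>U\<^esub> ((- c) \<odot>\<^bsub>U\<^esub> E g)"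
    unfolding eq LinearCombinations.module_hom_add[OF E f cg]
    using LinearCombinations.module_hom_smult[OF E _ g, of "- c"] by simp
  also have "(- c) \<odot>\<^bsub>U\<^esub> E g = \<ominus>\<^bsub>U\<^esub> (c \<odot>\<^bsub>U\<^esub> E g)"
    using U.smult_l_minus[of c "E g"] Eg by (simp add: class_ring_simps)
  finally show "E (\<lambda>x. f x - c * g x) = E f \<ominus>\<^bsub>U\<^esub> (c \<odot>\<^bsub>U\<^esub> E g)" by (simp add: a_minus_def)
qed

lemma tensor_null_vanish:
  assumes V: "vectorspace complex_ring V" and W: "vectorspace complex_ring W"
    and U: "vectorspace complex_ring U" and b: "bilinear_map V W U b"
    and E: "E \<in> LinearCombinations.module_hom complex_ring (free_space (carrier V \<times> carrier W)) U"
    and Ed: "\<And>v w. v \<in> carrier V \<Longrightarrow> w \<in> carrier W \<Longrightarrow> E (delta (v, w)) = b v w"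
    and n: "n \<in> tensor_null V W"
  shows "E n = \<zero>\<^bsub>U\<^esub>"
proof -
  let ?X = "carrier V \<times> carrier W"
  let ?F = "free_space ?X"
  interpret U: vectorspace complex_ring U by fact
  have Vcl: "v \<oplus>\<^bsub>V\<^esub> v' \<in> carrier V" "c \<odot>\<^bsub>V\<^esub> v \<in> carrier V"
    if "v \<in> carrier V" "v' \<in> carrier V" for c v v'
  proof -
    interpret V: vectorspace complex_ring V by fact
    show "v \<oplus>\<^bsub>V\<^esub> v' \<in> carrier V" using that by simp
    show "c \<odot>\<^bsub>V\<^esub> v \<in> carrier V" using that by (intro V.smult_closed) auto
  qed
  have Wcl: "v \<oplus>\<^bsub>W\<^esub> v' \<in> carrier W" "c \<odot>\<^bsub>W\<^esub> v \<in> carrier W"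
    if "v \<in> carrier W" "v' \<in> carrier W" for c v v'
  proof -
    interpret W: vectorspace complex_ring W by fact
    show "v \<oplus>\<^bsub>W\<^esub> v' \<in> carrier W" using that by simp
    show "c \<odot>\<^bsub>W\<^esub> v \<in> carrier W" using that by (intro W.smult_closed) auto
  qed
  have b1: "b v \<in> LinearCombinations.module_hom complex_ring W U" if "v \<in> carrier V" for v
    using b that unfolding bilinear_map_def by blast
  have b2: "(\<lambda>v. b v w) \<in> LinearCombinations.module_hom complex_ring V U" if "w \<in> carrier W" for w
    using b that unfolding bilinear_map_def by blast
  have bc: "b v w \<in> carrier U" if "v \<in> carrier V" "w \<in> carrier W" for v w
    using LinearCombinations.module_hom_closed[OF b1[OF that(1)]] that(2) by blast
  have d: "delta (v, w) \<in> carrier ?F" if "v \<in> carrier V" "w \<in> carrier W" for v w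
    using that by (intro delta_carrier) auto
  have sub: "E (\<lambda>x. f x - g x) = E f \<ominus>\<^bsub>U\<^esub> E g" "(\<lambda>x. f x - g x) \<in> carrier ?F"
    if fg: "f \<in> carrier ?F" "g \<in> carrier ?F" for f g
  proof -
    have "E g \<in> carrier U" using LinearCombinations.module_hom_closed[OF E] fg by blast
    then have "1 \<odot>\<^bsub>U\<^esub> E g = E g" using U.smult_one[of "E g"] by simp
    then show "E (\<lambda>x. f x - g x) = E f \<ominus>\<^bsub>U\<^esub> E g"
      using free_space_diff(2)[OF fg U E, of 1] by simp
    show "(\<lambda>x. f x - g x) \<in> carrier ?F" using free_space_diff(1)[OF fg, of 1] by simp
  qed
  have ucancel: "(x \<oplus>\<^bsub>U\<^esub> y) \<ominus>\<^bsub>U\<^esub> x \<ominus>\<^bsub>U\<^esub> y = \<zero>\<^bsub>U\<^esub>" "x \<ominus>\<^bsub>U\<^esub> x = \<zero>\<^bsub>U\<^esub>"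
    if "x \<in> carrier U" "y \<in> carrier U" for x y
  proof -
    have "(x \<oplus>\<^bsub>U\<^esub> y) \<ominus>\<^bsub>U\<^esub> x = y"
      using that by (simp add: a_minus_def U.a_comm[of x y] U.a_assoc U.r_neg)
    then show "(x \<oplus>\<^bsub>U\<^esub> y) \<ominus>\<^bsub>U\<^esub> x \<ominus>\<^bsub>U\<^esub> y = \<zero>\<^bsub>U\<^esub>"
      using that by (simp add: a_minus_def U.r_neg)
    show "x \<ominus>\<^bsub>U\<^esub> x = \<zero>\<^bsub>U\<^esub>" using that by (simp add: a_minus_def U.r_neg)
  qed
  have Ucl: "c \<odot>\<^bsub>U\<^esub> u \<in> carrier U" if "u \<in> carrier U" for c u
    using that by (intro U.smult_closed) auto
  have rel: "E r = \<zero>\<^bsub>U\<^esub>" if "r \<in> bilinear_relations V W" for r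
    using that unfolding bilinear_relations_def
  proof (safe, goal_cases)
    case (1 v v' w)
    have "b (v \<oplus>\<^bsub>V\<^esub> v') w = b v w \<oplus>\<^bsub>U\<^esub> b v' w"
      using LinearCombinations.module_hom_add[OF b2] 1 by simp
    then show ?case
      using 1 by (simp add: sub d Ed Vcl bc ucancel)
  next
    case (2 v w w')
    have "b v (w \<oplus>\<^bsub>W\<^esub> w') = b v w \<oplus>\<^bsub>U\<^esub> b v w'"
      using LinearCombinations.module_hom_add[OF b1] 2 by simp
    then show ?case
      using 2 by (simp add: sub d Ed Wcl bc ucancel)
  next
    case (3 c v w)
    have "b (c \<odot>\<^bsub>V\<^esub> v) w = c \<odot>\<^bsub>U\<^esub> b v w"
      using LinearCombinations.module_hom_smult[OF b2] 3 by simp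
    then show ?case
      using 3 Vcl(2)[of v v c] by (simp add: free_space_diff(2)[OF _ _ U E] d Ed bc Ucl ucancel)
  next
    case (4 c v w)
    have "b v (c \<odot>\<^bsub>W\<^esub> w) = c \<odot>\<^bsub>U\<^esub> b v w"
      using LinearCombinations.module_hom_smult[OF b1] 4 by simp
    then show ?case
      using 4 Wcl(2)[of w w c] by (simp add: free_space_diff(2)[OF _ _ U E] d Ed bc Ucl ucancel)
  qed
  interpret F: vectorspace complex_ring ?F by (rule free_space_vs)
  interpret E: mod_hom complex_ring ?F U E by (unfold_locales, rule E)
  have "bilinear_relations V W \<subseteq> E.ker"
    using bilinear_relations_carrier[OF V W] rel unfolding E.ker_def by blast
  then have "tensor_null V W \<subseteq> E.ker"
    unfolding tensor_null_def by (rule F.span_is_subset[OF _ E.ker_is_submodule])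
  then show ?thesis using n unfolding E.ker_def by blast
qed

lemma tensor_universal:
  assumes V: "vectorspace complex_ring V" and W: "vectorspace complex_ring W"
    and U: "vectorspace complex_ring U" and b: "bilinear_map V W U b"
  shows "\<exists>!h. h \<in> LinearCombinations.module_hom complex_ring (tensor_space V W) U \<and>
            h \<in> extensional (carrier (tensor_space V W)) \<and>
            (\<forall>v \<in> carrier V. \<forall>w \<in> carrier W. h (tens V W v w) = b v w)"
proof -
  let ?X = "carrier V \<times> carrier W" and ?T = "tensor_space V W" and ?N = "tensor_null V W"
  let ?F = "free_space ?X"
  let ?p = "\<lambda>f. ?N +>\<^bsub>?F\<^esub> f"
  have N: "submodule complex_ring ?N ?F" by (rule tensor_null_submodule[OF V W])
  have b1: "b v \<in> LinearCombinations.module_hom complex_ring W U" if "v \<in> carrier V" for v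
    using b that unfolding bilinear_map_def by blast
  have bc: "b v w \<in> carrier U" if "v \<in> carrier V" "w \<in> carrier W" for v w
    using LinearCombinations.module_hom_closed[OF b1[OF that(1)]] that(2) by blast
  then have "\<And>x. x \<in> ?X \<Longrightarrow> case_prod b x \<in> carrier U" by auto
  from free_space_lift[OF U this] obtain E
    where E: "E \<in> LinearCombinations.module_hom complex_ring ?F U"
      and Ed': "\<forall>x\<in>?X. E (delta x) = case_prod b x"
    by (rule bexE)
  have Ed: "E (delta (v, w)) = b v w" if "v \<in> carrier V" "w \<in> carrier W" for v w
    using Ed' that by simp
  have E0: "E n = \<zero>\<^bsub>U\<^esub>" if "n \<in> ?N" for n
    by (rule tensor_null_vanish[OF V W U b E Ed that])
  have T: "carrier ?T = ?p ` carrier ?F"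
    unfolding tensor_space_def by (rule quotient_carrier[OF free_space_vs N])
  have p: "?p \<in> LinearCombinations.module_hom complex_ring ?F ?T"
    unfolding tensor_space_def by (rule quotient_proj[OF free_space_vs N])
  have d: "delta (v, w) \<in> carrier ?F" if "v \<in> carrier V" "w \<in> carrier W" for v w
    using that by (intro delta_carrier) auto
  obtain h where h': "h \<in> LinearCombinations.module_hom complex_ring ?T U \<and>
      h \<in> extensional (carrier ?T) \<and> (\<forall>f\<in>carrier ?F. h (?p f) = E f)"
    using quotient_lift[OF free_space_vs N U E E0] unfolding tensor_space_def by (rule exE)
  note h = conjunct1[OF h'] conjunct1[OF conjunct2[OF h']] conjunct2[OF conjunct2[OF h']]
  have pT: "?p f \<in> carrier ?T" if "f \<in> carrier ?F" for f
    unfolding T using that by (rule imageI)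
  have hom_p: "(\<lambda>f. k (?p f)) \<in> LinearCombinations.module_hom complex_ring ?F U"
    if k: "k \<in> LinearCombinations.module_hom complex_ring ?T U" for k
    unfolding LinearCombinations.module_hom_def mem_Collect_eq
  proof (intro conjI allI impI funcsetI)
    fix f assume "f \<in> carrier ?F"
    then show "k (?p f) \<in> carrier U"
      using LinearCombinations.module_hom_closed[OF k] pT by blast
  next
    fix f g assume fg: "f \<in> carrier ?F \<and> g \<in> carrier ?F"
    show "k (?p (f \<oplus>\<^bsub>?F\<^esub> g)) = k (?p f) \<oplus>\<^bsub>U\<^esub> k (?p g)"
      unfolding LinearCombinations.module_hom_add[OF p conjunct1[OF fg] conjunct2[OF fg]]
      using fg by (intro LinearCombinations.module_hom_add[OF k] pT) simp_all
  next
    fix c f assume f: "c \<in> carrier complex_ring \<and> f \<in> carrier ?F"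
    show "k (?p (c \<odot>\<^bsub>?F\<^esub> f)) = c \<odot>\<^bsub>U\<^esub> k (?p f)"
      unfolding LinearCombinations.module_hom_smult[OF p conjunct1[OF f] conjunct2[OF f]]
      using f by (intro LinearCombinations.module_hom_smult[OF k] pT) simp_all
  qed
  show ?thesis
  proof (rule ex1I[of _ h], intro conjI ballI)
    show "h (tens V W v w) = b v w" if "v \<in> carrier V" "w \<in> carrier W" for v w
      using h(3) d[OF that] Ed[OF that] by (simp add: tens_def)
  next
    fix k
    assume k: "k \<in> LinearCombinations.module_hom complex_ring ?T U \<and> k \<in> extensional (carrier ?T) \<and>
      (\<forall>v\<in>carrier V. \<forall>w\<in>carrier W. k (tens V W v w) = b v w)"
    have "k (?p f) = E f" if "f \<in> carrier ?F" for f
    proof (rule free_space_hom_eqI[OF U hom_p[OF conjunct1[OF k]] E _ that])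
      fix x assume "x \<in> ?X"
      then obtain v w where vw: "x = (v, w)" "v \<in> carrier V" "w \<in> carrier W" by blast
      then show "k (?p (delta x)) = E (delta x)"
        using k Ed by (simp add: tens_def)
    qed
    then have "k x = h x" if "x \<in> carrier ?T" for x
      using that h(3) unfolding T by auto
    then show "k = h"
      using k h(2) by (intro extensionalityI[of k "carrier ?T" h]) simp_all
  qed (use h in simp_all)
qed

end

theory Submission
  imports Defs "HOL-Computational_Algebra.Fundamental_Theorem_Algebra"
begin

text \<open>
  The idea is to recover the set \<open>\<Gamma>/H\<close> as the spectrum of the algebra. Forgetting the action, \<open>A\<close> is a
  nonzero finite-dimensional commutative complex algebra, with product \<open>\<mu> (a \<otimes> b)\<close> and unit \<open>\<iota> 1\<close>. The
  operators of multiplication commute, so they have a common eigenvector, and the eigenvalues define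
  a character \<open>\<chi>\<close> of \<open>A\<close> (\<open>character_exists\<close>). The group permutes the characters. Let \<open>H\<close> be the
  stabilizer of \<open>\<chi>\<close>, so that \<open>\<Gamma>/H\<close> is the orbit of \<open>\<chi>\<close>, and send \<open>a\<close> to the function
  \<open>g H \<mapsto> \<chi> (g\<^sup>-\<^sup>1 a)\<close>. This is an equivariant homomorphism of algebras \<open>A \<rightarrow> Fun(\<Gamma>/H)\<close>.

  It is surjective, and \<open>H\<close> has finite index, for reasons that concern only the algebra: distinct
  characters are linearly independent, so there are at most \<open>dim A\<close> of them
  (\<open>characters_finite\<close>), and their values can be prescribed (\<open>characters_interpolate\<close>).

  It is injective because of rigidity (\<open>orbit_separates\<close>). The kernel \<open>N\<close> is an invariant ideal that does
  not contain 1. The condition on \<open>Hom(1, A)\<close> says that every invariant of \<open>A\<close> is a multiple of 1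
  (\<open>invariants_eq_scalars\<close>), so \<open>N\<close> has no nonzero invariants. In a semisimple category a representation
  without invariants has no nonzero invariant functionals either (\<open>invariant_functional\<close>). Hence the
  counit \<open>\<epsilon>\<close> vanishes on \<open>N\<close>, and so does \<open>\<epsilon>(b a)\<close> for all \<open>a\<close> in \<open>N\<close> and \<open>b\<close> in \<open>A\<close>. The zigzag identities
  make this pairing nondegenerate in the elementary sense (\<open>rigidity_axioms_nondegenerate\<close>),
  and therefore \<open>N = 0\<close>.
\<close>

section \<open>Finite-dimensional complex vector spaces\<close>

abbreviation linear_maps ::
    "(complex, 'v, 'm) module_scheme \<Rightarrow> (complex, 'w, 'n) module_scheme \<Rightarrow> ('v \<Rightarrow> 'w) set"
  where "linear_maps \<equiv> LinearCombinations.module_hom complex_ring"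

lemma linear_mapsI:
  assumes "\<And>v. v \<in> carrier V \<Longrightarrow> f v \<in> carrier W"
    and "\<And>v w. \<lbrakk>v \<in> carrier V; w \<in> carrier V\<rbrakk> \<Longrightarrow> f (v \<oplus>\<^bsub>V\<^esub> w) = f v \<oplus>\<^bsub>W\<^esub> f w"
    and "\<And>c v. v \<in> carrier V \<Longrightarrow> f (c \<odot>\<^bsub>V\<^esub> v) = c \<odot>\<^bsub>W\<^esub> f v"
  shows "f \<in> linear_maps V W"
  using assms by (auto simp: LinearCombinations.module_hom_def)

lemma linear_mapsD:
  assumes "f \<in> linear_maps V W"
  shows linear_maps_closed: "v \<in> carrier V \<Longrightarrow> f v \<in> carrier W"
    and linear_maps_add: "\<lbrakk>v \<in> carrier V; w \<in> carrier V\<rbrakk> \<Longrightarrow> f (v \<oplus>\<^bsub>V\<^esub> w) = f v \<oplus>\<^bsub>W\<^esub> f w"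
    and linear_maps_scale: "v \<in> carrier V \<Longrightarrow> f (c \<odot>\<^bsub>V\<^esub> v) = c \<odot>\<^bsub>W\<^esub> f v"
  using assms by (auto simp: LinearCombinations.module_hom_def)

lemma linear_maps_compose:
  "\<lbrakk>f \<in> linear_maps V W; h \<in> linear_maps W U\<rbrakk> \<Longrightarrow> (\<lambda>v. h (f v)) \<in> linear_maps V U"
  by (rule linear_mapsI) (simp_all add: linear_mapsD)

locale complex_space = vectorspace complex_ring V
  for V :: "(complex, 'v, 'n) module_scheme" (structure)
begin

lemma scale_closed [simp]: "v \<in> carrier V \<Longrightarrow> c \<odot> v \<in> carrier V"
  using smult_closed[of c v] by simp

lemma scale_add_left: "v \<in> carrier V \<Longrightarrow> (a + b) \<odot> v = a \<odot> v \<oplus> b \<odot> v"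
  using smult_l_distr[of a b v] by simp

lemma scale_add_right:
  "v \<in> carrier V \<Longrightarrow> w \<in> carrier V \<Longrightarrow> a \<odot> (v \<oplus> w) = a \<odot> v \<oplus> a \<odot> w"
  using smult_r_distr[of a v w] by simp

lemma scale_scale: "v \<in> carrier V \<Longrightarrow> a \<odot> (b \<odot> v) = (a * b) \<odot> v"
  using smult_assoc1[of a b v] by simp

lemma scale_one [simp]: "v \<in> carrier V \<Longrightarrow> 1 \<odot> v = v"
  using smult_one[of v] by simp

lemma scale_zero_left [simp]: "v \<in> carrier V \<Longrightarrow> 0 \<odot> v = \<zero>"
  using lmult_0[of v] by simp

lemma scale_zero_right [simp]: "c \<odot> \<zero> = \<zero>"
  using rmult_0[of c] by simp

lemma scale_minus_one: "v \<in> carrier V \<Longrightarrow> (- 1) \<odot> v = \<ominus> v"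
  using smult_minus_1[of v] by (simp add: class_ring_simps)

lemma add_scale_minus_eq_zero_iff:
  assumes "v \<in> carrier V" "w \<in> carrier V"
  shows "v \<oplus> (- c) \<odot> w = \<zero> \<longleftrightarrow> v = c \<odot> w"
proof -
  have "(- c) \<odot> w = \<ominus> (c \<odot> w)"
    using assms scale_minus_one[of "c \<odot> w"] by (simp add: scale_scale)
  then show ?thesis
    using assms by (metis local.minus_equality minus_minus r_neg scale_closed)
qed

lemma scale_eq_zero_iff:
  assumes "v \<in> carrier V"
  shows "c \<odot> v = \<zero> \<longleftrightarrow> c = 0 \<or> v = \<zero>"
proof -
  have "v = \<zero>" if "c \<odot> v = \<zero>" "c \<noteq> 0"
  proof -
    have "v = inverse c \<odot> (c \<odot> v)" using assms that(2) by (simp add: scale_scale)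
    then show ?thesis using that(1) by simp
  qed
  then show ?thesis using assms by auto
qed

lemma scale_left_cancel:
  assumes "v \<in> carrier V" "v \<noteq> \<zero>" "a \<odot> v = b \<odot> v"
  shows "a = b"
proof -
  have "(a - b) \<odot> v = \<zero>"
    using assms add_scale_minus_eq_zero_iff[of "a \<odot> v" v b] scale_add_left[of v a "- b"] by simp
  then show ?thesis using assms scale_eq_zero_iff by auto
qed

text \<open>The vectors are indexed, so that the two ways of being dependent, a repetition and a linear
  relation between distinct vectors, need not be told apart where the lemma is applied.\<close>

lemma linear_dependence:
  assumes "fin_dim" and f: "\<And>i. i \<le> dim \<Longrightarrow> f i \<in> carrier V"
  obtains c where "(\<Oplus>i\<in>{..dim}. c i \<odot> f i) = \<zero>" and "\<exists>i\<le>dim. c i \<noteq> 0"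
proof (cases "inj_on f {..dim}")
  case True
  let ?S = "f ` {..dim}"
  have S: "?S \<subseteq> carrier V" using f by auto
  have "\<not> card ?S \<le> dim" using True by (simp add: card_image)
  then have "lin_dep ?S" using li_le_dim(2)[OF assms(1) S] by blast
  then obtain a v where a: "lincomb a ?S = \<zero>" "v \<in> ?S" "a v \<noteq> 0"
    using finite_lin_dep[of ?S] S by auto
  have "lincomb a ?S = (\<Oplus>i\<in>{..dim}. a (f i) \<odot> f i)"
    unfolding lincomb_def using True f by (intro add.finprod_reindex) auto
  then show ?thesis using a by (intro that[of "a \<circ> f"]) auto
next
  case False
  then obtain i j where ij: "i \<le> dim" "j \<le> dim" "i \<noteq> j" "f i = f j"
    by (auto simp: inj_on_def)
  \<comment> \<open>a repetition is a relation with coefficients 1 and -1\<close>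
  define c where "c = (\<lambda>k. if k = i then 1 else if k = j then - 1 else (0::complex))"
  have "(\<Oplus>k\<in>{..dim}. c k \<odot> f k) = (\<Oplus>k\<in>{i, j}. c k \<odot> f k)"
    using f ij by (intro add.finprod_mono_neutral_cong_right) (auto simp: c_def)
  also have "\<dots> = c i \<odot> f i \<oplus> c j \<odot> f j"
    using f ij by (subst finsum_insert) auto
  also have "\<dots> = \<zero>"
    using ij f[of j] add_scale_minus_eq_zero_iff[of "f j" "f j" 1] by (simp add: c_def)
  finally show ?thesis using ij by (intro that[of c]) (auto simp: c_def)
qed

text \<open>Independent subsets of \<open>W\<close> are independent in \<open>V\<close>, so their size is bounded; one of maximal
  size generates \<open>W\<close>.\<close>

lemma subspace_fin_dim:
  assumes "fin_dim" and W: "VectorSpace.subspace complex_ring W V"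
  shows "vectorspace.fin_dim complex_ring (V\<lparr>carrier := W\<rparr>)"
proof -
  interpret W: vectorspace complex_ring "V\<lparr>carrier := W\<rparr>" by (rule subspace_is_vs[OF W])
  have sub: "submodule complex_ring W V" using W by simp
  have "finite S \<and> card S \<le> dim" if "S \<subseteq> carrier (V\<lparr>carrier := W\<rparr>) \<and> W.lin_indpt S" for S
  proof -
    have "S \<subseteq> W" using that by simp
    then have "S \<subseteq> carrier V" "lin_indpt S"
      using that sub span_li_not_depend(2)[OF _ sub, of S] by (auto simp: submodule_def)
    then show ?thesis using li_le_dim[OF assms(1)] by blast
  qed
  moreover have "{} \<subseteq> carrier (V\<lparr>carrier := W\<rparr>) \<and> W.lin_indpt {}"
    by (auto simp: W.lin_dep_def)
  ultimately obtain S where S: "finite S"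
      "maximal S (\<lambda>S. S \<subseteq> carrier (V\<lparr>carrier := W\<rparr>) \<and> W.lin_indpt S)"
    using maximal_exists[of "\<lambda>S. S \<subseteq> carrier (V\<lparr>carrier := W\<rparr>) \<and> W.lin_indpt S" dim "{}"] by blast
  then show ?thesis
    using W.max_li_is_gen[OF S(2)] unfolding W.fin_dim_def by (auto simp: maximal_def)
qed

end

lemma subspaceI:
  assumes "vectorspace complex_ring V" and "W \<subseteq> carrier V" and "\<zero>\<^bsub>V\<^esub> \<in> W"
    and "\<And>v w. \<lbrakk>v \<in> W; w \<in> W\<rbrakk> \<Longrightarrow> v \<oplus>\<^bsub>V\<^esub> w \<in> W" and "\<And>c v. v \<in> W \<Longrightarrow> c \<odot>\<^bsub>V\<^esub> v \<in> W"
  shows "VectorSpace.subspace complex_ring W V"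
  using assms by (auto simp: VectorSpace.subspace_def submodule_def vectorspace_def)

lemma linear_functional_zero:
  assumes "vectorspace complex_ring V" "\<delta> \<in> linear_maps V unit_rep"
  shows "\<delta> \<zero>\<^bsub>V\<^esub> = 0"
proof -
  interpret V: complex_space V by (rule complex_space.intro[OF assms(1)])
  show ?thesis using linear_maps_scale[OF assms(2), of "\<zero>\<^bsub>V\<^esub>" 0] by simp
qed

section \<open>Characters of finite-dimensional commutative algebras\<close>

text \<open>A commutative, associative, unital algebra is given here by a product on the elements of the space;
  the product of an algebra in the category of representations is the restriction of \<open>\<mu>\<close> to pure
  tensors.\<close>

locale comm_algebra = complex_space V
  for V :: "(complex, 'v, 'n) module_scheme" (structure) +
  fixes times :: "'v \<Rightarrow> 'v \<Rightarrow> 'v" (infixl \<open>\<cdot>\<close> 70) and unit :: 'v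
  assumes times_closed [simp]: "a \<in> carrier V \<Longrightarrow> b \<in> carrier V \<Longrightarrow> a \<cdot> b \<in> carrier V"
    and times_add_right: "\<lbrakk>a \<in> carrier V; b \<in> carrier V; c \<in> carrier V\<rbrakk>
      \<Longrightarrow> a \<cdot> (b \<oplus> c) = a \<cdot> b \<oplus> a \<cdot> c"
    and times_scale_right: "\<lbrakk>a \<in> carrier V; b \<in> carrier V\<rbrakk> \<Longrightarrow> a \<cdot> (k \<odot> b) = k \<odot> (a \<cdot> b)"
    and times_commute: "\<lbrakk>a \<in> carrier V; b \<in> carrier V\<rbrakk> \<Longrightarrow> a \<cdot> b = b \<cdot> a"
    and times_assoc: "\<lbrakk>a \<in> carrier V; b \<in> carrier V; c \<in> carrier V\<rbrakk> \<Longrightarrow> a \<cdot> b \<cdot> c = a \<cdot> (b \<cdot> c)"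
    and unit_closed [simp]: "unit \<in> carrier V"
    and unit_times [simp]: "a \<in> carrier V \<Longrightarrow> unit \<cdot> a = a"
begin

lemma times_add_left: "\<lbrakk>a \<in> carrier V; b \<in> carrier V; c \<in> carrier V\<rbrakk>
    \<Longrightarrow> (a \<oplus> b) \<cdot> c = a \<cdot> c \<oplus> b \<cdot> c"
  using times_add_right[of c a b] by (simp add: times_commute)

lemma times_scale_left: "\<lbrakk>a \<in> carrier V; b \<in> carrier V\<rbrakk> \<Longrightarrow> (k \<odot> a) \<cdot> b = k \<odot> (a \<cdot> b)"
  using times_scale_right[of b a k] by (simp add: times_commute)

lemma times_zero_right [simp]: "a \<in> carrier V \<Longrightarrow> a \<cdot> \<zero> = \<zero>"
  using times_scale_right[of a \<zero> 0] by simp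

lemma times_zero_left [simp]: "a \<in> carrier V \<Longrightarrow> \<zero> \<cdot> a = \<zero>"
  using times_zero_right[of a] by (simp add: times_commute)

text \<open>The vector \<open>p(a) \<cdot> v\<close>.\<close>

definition poly_times :: "'v \<Rightarrow> 'v \<Rightarrow> complex poly \<Rightarrow> 'v"
  where "poly_times a v p = fold_coeffs (\<lambda>k x. k \<odot> v \<oplus> a \<cdot> x) p \<zero>"

lemma poly_times_0 [simp]: "poly_times a v 0 = \<zero>"
  by (simp add: poly_times_def)

lemma poly_times_pCons:
  "\<lbrakk>a \<in> carrier V; v \<in> carrier V\<rbrakk> \<Longrightarrow>
    poly_times a v (pCons k p) = k \<odot> v \<oplus> a \<cdot> poly_times a v p"
  by (cases "k = 0 \<and> p = 0") (auto simp: poly_times_def)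

lemma poly_times_closed [simp]:
  "\<lbrakk>a \<in> carrier V; v \<in> carrier V\<rbrakk> \<Longrightarrow> poly_times a v p \<in> carrier V"
  by (induction p) (simp_all add: poly_times_pCons)

lemma poly_times_add: "\<lbrakk>a \<in> carrier V; v \<in> carrier V\<rbrakk> \<Longrightarrow>
    poly_times a v (p + q) = poly_times a v p \<oplus> poly_times a v q"
  by (induction p q rule: poly_induct2)
    (simp_all add: poly_times_pCons scale_add_left times_add_right a_ac)

lemma poly_times_smult: "\<lbrakk>a \<in> carrier V; v \<in> carrier V\<rbrakk> \<Longrightarrow>
    poly_times a v (Polynomial.smult k p) = k \<odot> poly_times a v p"
  by (induction p)
    (simp_all add: poly_times_pCons scale_add_right times_scale_right scale_scale)

lemma poly_times_linear_factor: "\<lbrakk>a \<in> carrier V; v \<in> carrier V\<rbrakk> \<Longrightarrow>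
    poly_times a v ([:- c, 1:] * q) = a \<cdot> poly_times a v q \<oplus> (- c) \<odot> poly_times a v q"
  using a_comm[of "(- c) \<odot> poly_times a v q" "a \<cdot> poly_times a v q"]
  by (simp add: poly_times_add poly_times_smult poly_times_pCons mult_pCons_left del: Polynomial.smult_minus_left)

lemma poly_times_in_ideal:
  assumes a: "a \<in> carrier V" and v: "v \<in> carrier V"
  shows "\<exists>b\<in>carrier V. poly_times a v p = b \<cdot> v"
proof (induction p)
  case 0
  then show ?case using v by (intro bexI[of _ \<zero>]) simp_all
next
  case (pCons k p)
  then obtain b where "b \<in> carrier V" "poly_times a v p = b \<cdot> v" by blast
  then show ?case
    using a v by (intro bexI[of _ "k \<odot> unit \<oplus> a \<cdot> b"])
      (simp_all add: poly_times_pCons times_add_left times_scale_left times_assoc)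
qed

text \<open>Finite dimension makes the vectors \<open>v, a \<cdot> v, a\<^sup>2 \<cdot> v, \<dots>\<close> linearly dependent.\<close>

lemma annihilating_poly:
  assumes "fin_dim" and a: "a \<in> carrier V" and v: "v \<in> carrier V"
  shows "\<exists>p. p \<noteq> 0 \<and> poly_times a v p = \<zero>"
proof -
  obtain c where c: "(\<Oplus>i\<in>{..dim}. c i \<odot> poly_times a v (monom 1 i)) = \<zero>" "\<exists>i\<le>dim. c i \<noteq> 0"
    by (rule linear_dependence[OF assms(1), of "\<lambda>i. poly_times a v (monom 1 i)"]) (use a v in auto)
  define p where "p = (\<Sum>i\<le>dim. Polynomial.smult (c i) (monom 1 i))"
  have "poly_times a v (\<Sum>i\<in>S. Polynomial.smult (c i) (monom 1 i)) = (\<Oplus>i\<in>S. c i \<odot> poly_times a v (monom 1 i))"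
    if "finite S" for S
    using that a v by induction (simp_all add: poly_times_add poly_times_smult)
  then have "poly_times a v p = \<zero>" using c(1) by (simp add: p_def)
  moreover have "coeff p i = c i" if "i \<le> dim" for i
    using that by (simp add: p_def coeff_sum if_distrib cong: if_cong)
  then have "p \<noteq> 0" using c(2) by auto
  ultimately show ?thesis by blast
qed

text \<open>The eigenvector is sought inside the ideal generated by \<open>v\<close>, because every vector that is already
  an eigenvector of some other element passes this property on to all its multiples. Take a nonzero
  polynomial \<open>p\<close> of least degree with \<open>p(a) \<cdot> v = 0\<close>. It has a root \<open>c\<close>, and if \<open>p = (X - c) q\<close> then
  \<open>q(a) \<cdot> v\<close> is an eigenvector of \<open>a\<close> for \<open>c\<close>.\<close>

lemma eigenvector_in_ideal:
  assumes "fin_dim" and a: "a \<in> carrier V" and v: "v \<in> carrier V" "v \<noteq> \<zero>"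
  shows "\<exists>b\<in>carrier V. \<exists>c. b \<cdot> v \<noteq> \<zero> \<and> a \<cdot> (b \<cdot> v) = c \<odot> (b \<cdot> v)"
proof -
  have "\<exists>q c. poly_times a v q \<noteq> \<zero> \<and> a \<cdot> poly_times a v q = c \<odot> poly_times a v q"
    if "p \<noteq> 0" "poly_times a v p = \<zero>" for p
    using that
  proof (induction "degree p" arbitrary: p rule: less_induct)
    case less
    have "degree p \<noteq> 0"
    proof
      assume "degree p = 0"
      then obtain k where "p = [:k:]" by (rule degree_eq_zeroE)
      then show False using less.prems a v by (simp add: poly_times_pCons scale_eq_zero_iff)
    qed
    then obtain c where "poly p c = 0"
      using fundamental_theorem_of_algebra[of p] by (auto simp: constant_degree)
    then obtain q where q: "p = [:- c, 1:] * q" by (auto simp: poly_eq_0_iff_dvd)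
    then have "q \<noteq> 0" using less.prems by auto
    then have "degree q < degree p" unfolding q by (subst degree_mult_eq) auto
    show ?case
    proof (cases "poly_times a v q = \<zero>")
      case True
      then show ?thesis using less.hyps \<open>degree q < degree p\<close> \<open>q \<noteq> 0\<close> by blast
    next
      case False
      have "a \<cdot> poly_times a v q \<oplus> (- c) \<odot> poly_times a v q = \<zero>"
        using less.prems(2) a v poly_times_linear_factor unfolding q by simp
      then have "a \<cdot> poly_times a v q = c \<odot> poly_times a v q"
        using a v by (simp add: add_scale_minus_eq_zero_iff)
      with False show ?thesis by blast
    qed
  qed
  then show ?thesis
    using annihilating_poly[OF assms(1) a v(1)] poly_times_in_ideal[OF a v(1)] by metis
qed

text \<open>To include a further element \<open>a\<close>, replace \<open>v\<close> by a multiple of it that is an eigenvector of \<open>a\<close>; it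
  remains an eigenvector of the elements treated before, because the product is commutative.\<close>

lemma common_eigenvector_finite:
  assumes "fin_dim" and "unit \<noteq> \<zero>" and "finite S" "S \<subseteq> carrier V"
  shows "\<exists>v\<in>carrier V. v \<noteq> \<zero> \<and> (\<forall>a\<in>S. \<exists>c. a \<cdot> v = c \<odot> v)"
  using assms(3,4)
proof induction
  case empty
  then show ?case using assms(2) unit_closed by blast
next
  case (insert a S)
  then obtain v where v: "v \<in> carrier V" "v \<noteq> \<zero>" "\<forall>s\<in>S. \<exists>c. s \<cdot> v = c \<odot> v" by auto
  have a: "a \<in> carrier V" using insert.prems by simp
  then obtain b c where b: "b \<in> carrier V" "b \<cdot> v \<noteq> \<zero>" "a \<cdot> (b \<cdot> v) = c \<odot> (b \<cdot> v)"
    using eigenvector_in_ideal[OF assms(1) _ v(1,2)] by blast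
  have "\<exists>c. s \<cdot> (b \<cdot> v) = c \<odot> (b \<cdot> v)" if sS: "s \<in> S" for s
  proof -
    obtain c where c: "s \<cdot> v = c \<odot> v" using v(3) sS by blast
    have s: "s \<in> carrier V" using sS insert.prems by auto
    have "s \<cdot> (b \<cdot> v) = b \<cdot> (s \<cdot> v)"
      using s b(1) v(1) times_assoc[of s b v] times_assoc[of b s v] times_commute[of s b] by simp
    also have "\<dots> = c \<odot> (b \<cdot> v)" using b(1) v(1) by (simp add: c times_scale_right)
    finally have "s \<cdot> (b \<cdot> v) = c \<odot> (b \<cdot> v)" .
    then show ?thesis by blast
  qed
  then show ?case using b v(1) by (intro bexI[of _ "b \<cdot> v"]) auto
qed

definition character :: "('v \<Rightarrow> complex) \<Rightarrow> bool"
  where "character \<chi> \<longleftrightarrow> \<chi> unit = 1 \<and>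
    (\<forall>a\<in>carrier V. \<forall>b\<in>carrier V. \<chi> (a \<oplus> b) = \<chi> a + \<chi> b \<and> \<chi> (a \<cdot> b) = \<chi> a * \<chi> b) \<and>
    (\<forall>a\<in>carrier V. \<forall>k. \<chi> (k \<odot> a) = k * \<chi> a)"

text \<open>A common eigenvector \<open>v\<close> for a spanning set is one for the whole algebra, and the eigenvalue of \<open>a\<close>
  on \<open>v\<close> depends multiplicatively on \<open>a\<close>.\<close>

theorem character_exists:
  assumes "fin_dim" and "unit \<noteq> \<zero>"
  shows "\<exists>\<chi>. character \<chi>"
proof -
  obtain S where S: "finite S" "S \<subseteq> carrier V" "span S = carrier V"
    using assms(1) unfolding fin_dim_def by blast
  obtain v where v: "v \<in> carrier V" "v \<noteq> \<zero>" "\<forall>a\<in>S. \<exists>c. a \<cdot> v = c \<odot> v"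
    using common_eigenvector_finite[OF assms S(1,2)] by blast
  let ?E = "{a \<in> carrier V. \<exists>c. a \<cdot> v = c \<odot> v}"
  have "submodule complex_ring ?E V"
  proof (unfold_locales, goal_cases)
    case (2 a b)
    then show ?case using v(1) by (auto simp: times_add_left simp flip: scale_add_left)
  next
    case 3
    then show ?case using v(1) scale_zero_left by (auto intro!: exI[of _ 0])
  next
    case (4 k a)
    then show ?case using v(1) by (auto simp: times_scale_left scale_scale)
  qed auto
  then have "span S \<subseteq> ?E" using v(3) S(2) by (intro span_is_subset) auto
  then have "\<forall>a\<in>carrier V. \<exists>c. a \<cdot> v = c \<odot> v" using S(3) by auto
  then obtain \<chi> where \<chi>: "\<And>a. a \<in> carrier V \<Longrightarrow> a \<cdot> v = \<chi> a \<odot> v" by metis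
  have eqI: "\<chi> a = c" if "a \<in> carrier V" "a \<cdot> v = c \<odot> v" for a c
    using that \<chi>[of a] scale_left_cancel[OF v(1,2)] by simp
  have "\<chi> (a \<cdot> b) = \<chi> a * \<chi> b" if "a \<in> carrier V" "b \<in> carrier V" for a b
  proof (rule eqI)
    have "a \<cdot> b \<cdot> v = a \<cdot> (\<chi> b \<odot> v)" using that v(1) by (simp only: times_assoc \<chi>)
    also have "\<dots> = \<chi> b \<odot> (\<chi> a \<odot> v)" using that v(1) \<chi>[of a] by (simp add: times_scale_right)
    finally show "a \<cdot> b \<cdot> v = (\<chi> a * \<chi> b) \<odot> v" using v(1) by (simp add: scale_scale mult.commute)
  qed (use that in simp)
  moreover have "\<chi> (a \<oplus> b) = \<chi> a + \<chi> b" if "a \<in> carrier V" "b \<in> carrier V" for a b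
    using that v(1) \<chi>[of a] \<chi>[of b] by (intro eqI) (simp_all add: times_add_left scale_add_left)
  moreover have "\<chi> (k \<odot> a) = k * \<chi> a" if "a \<in> carrier V" for k a
    using that v(1) \<chi>[of a] by (intro eqI) (simp_all add: times_scale_left scale_scale)
  moreover have "\<chi> unit = 1"
    using v(1) by (intro eqI) simp_all
  ultimately have "character \<chi>"
    unfolding character_def by blast
  then show ?thesis by blast
qed

end

section \<open>Families of distinct characters\<close>

context comm_algebra
begin

lemma characterD:
  assumes "character \<chi>"
  shows character_unit: "\<chi> unit = 1"
    and character_add: "\<lbrakk>a \<in> carrier V; b \<in> carrier V\<rbrakk> \<Longrightarrow> \<chi> (a \<oplus> b) = \<chi> a + \<chi> b"
    and character_times: "\<lbrakk>a \<in> carrier V; b \<in> carrier V\<rbrakk> \<Longrightarrow> \<chi> (a \<cdot> b) = \<chi> a * \<chi> b"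
    and character_scale: "a \<in> carrier V \<Longrightarrow> \<chi> (k \<odot> a) = k * \<chi> a"
    and character_zero: "\<chi> \<zero> = 0"
proof -
  show scale: "\<chi> (k \<odot> a) = k * \<chi> a" if "a \<in> carrier V" for k a
    using assms that by (simp add: character_def)
  show "\<chi> \<zero> = 0" using scale[of \<zero> 0] by simp
qed (use assms in \<open>simp_all add: character_def\<close>)

text \<open>Multiply, for each \<open>y\<close> in \<open>F\<close>, an element on which \<open>\<chi> x\<close> is 1 and \<open>\<chi> y\<close> is 0. Such an element is an
  affine function of any element on which the two characters differ.\<close>

lemma characters_separate:
  assumes \<chi>: "\<And>y. y \<in> insert x F \<Longrightarrow> character (\<chi> y)"
    and distinct: "\<And>y. y \<in> F \<Longrightarrow> \<exists>a\<in>carrier V. \<chi> x a \<noteq> \<chi> y a" and "finite F"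
  shows "\<exists>a\<in>carrier V. \<chi> x a = 1 \<and> (\<forall>y\<in>F. \<chi> y a = 0)"
  using assms(3) \<chi> distinct
proof (induction F)
  case empty
  then show ?case using character_unit by (intro bexI[of _ unit]) auto
next
  case (insert y F)
  have char: "character (\<chi> z)" if "z \<in> insert x (insert y F)" for z
    using insert.prems(1) that by blast
  have "\<exists>a\<in>carrier V. \<chi> x a = 1 \<and> (\<forall>y\<in>F. \<chi> y a = 0)"
    by (rule insert.IH) (use insert.prems in auto)
  then obtain a where a: "a \<in> carrier V" "\<chi> x a = 1" "\<forall>y\<in>F. \<chi> y a = 0" by blast
  obtain b where b: "b \<in> carrier V" "\<chi> x b \<noteq> \<chi> y b" using insert.prems(2) by blast
  \<comment> \<open>the affine function of \<open>b\<close> that takes the value 1 at \<open>\<chi> x\<close> and 0 at \<open>\<chi> y\<close>\<close>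
  define c where "c = inverse (\<chi> x b - \<chi> y b) \<odot> (b \<oplus> (- \<chi> y b) \<odot> unit)"
  have c: "c \<in> carrier V" using b(1) by (simp add: c_def)
  have "\<chi> z c = inverse (\<chi> x b - \<chi> y b) * (\<chi> z b - \<chi> y b)" if "z \<in> {x, y}" for z
  proof -
    have "character (\<chi> z)" using char that by blast
    from characterD[OF this] show ?thesis using b(1) by (simp add: c_def)
  qed
  then have "\<chi> x c = 1" "\<chi> y c = 0" using b(2) by simp_all
  moreover have "\<chi> z (a \<cdot> c) = \<chi> z a * \<chi> z c" if "z \<in> insert x (insert y F)" for z
    using character_times[OF char[OF that]] a(1) c by blast
  ultimately show ?case using a c by (intro bexI[of _ "a \<cdot> c"]) auto
qed

text \<open>Distinct characters are linearly independent: elements dual to \<open>dim + 1\<close> of them would be linearly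
  independent themselves.\<close>

lemma characters_finite:
  assumes "fin_dim" and \<chi>: "\<And>x. x \<in> X \<Longrightarrow> character (\<chi> x)"
    and distinct: "\<And>x y. \<lbrakk>x \<in> X; y \<in> X; x \<noteq> y\<rbrakk> \<Longrightarrow> \<exists>a\<in>carrier V. \<chi> x a \<noteq> \<chi> y a"
  shows "finite X"
proof (rule ccontr)
  assume "infinite X"
  then obtain Y where Y: "Y \<subseteq> X" "finite Y" "card Y = Suc dim"
    using infinite_arbitrarily_large by metis
  obtain x where x: "bij_betw x {..dim} Y"
    using ex_bij_betw_nat_finite[OF Y(2)] Y(3) by (auto simp: atLeast0LessThan lessThan_Suc_atMost)
  have xX: "x i \<in> X" if "i \<le> dim" for i
    using that x Y(1) by (auto simp: bij_betw_def)
  have x_inj: "x i \<noteq> x j" if "i \<le> dim" "j \<le> dim" "i \<noteq> j" for i j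
    using that x by (auto simp: bij_betw_def inj_on_def)
  have "\<forall>i\<in>{..dim}. \<exists>a. a \<in> carrier V \<and> \<chi> (x i) a = 1 \<and> (\<forall>j\<le>dim. j \<noteq> i \<longrightarrow> \<chi> (x j) a = 0)"
  proof
    fix i assume i: "i \<in> {..dim}"
    have "\<exists>a\<in>carrier V. \<chi> (x i) a = 1 \<and> (\<forall>y\<in>x ` ({..dim} - {i}). \<chi> y a = 0)"
    proof (rule characters_separate)
      fix y assume "y \<in> x ` ({..dim} - {i})"
      then obtain j where j: "j \<le> dim" "j \<noteq> i" "y = x j" by auto
      show "\<exists>a\<in>carrier V. \<chi> (x i) a \<noteq> \<chi> y a"
        unfolding j(3) by (rule distinct) (use i j x_inj[of i j] xX in simp_all)
    qed (use i xX \<chi> in auto)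
    then obtain a where "a \<in> carrier V" "\<chi> (x i) a = 1" "\<forall>y\<in>x ` ({..dim} - {i}). \<chi> y a = 0"
      by blast
    then show "\<exists>a. a \<in> carrier V \<and> \<chi> (x i) a = 1 \<and> (\<forall>j\<le>dim. j \<noteq> i \<longrightarrow> \<chi> (x j) a = 0)"
      by (intro exI[of _ a]) simp
  qed
  from bchoice[OF this] obtain e where e': "\<forall>i\<in>{..dim}. e i \<in> carrier V \<and> \<chi> (x i) (e i) = 1 \<and>
      (\<forall>j\<le>dim. j \<noteq> i \<longrightarrow> \<chi> (x j) (e i) = 0)" ..
  then have e: "\<And>i. i \<le> dim \<Longrightarrow> e i \<in> carrier V" "\<And>i. i \<le> dim \<Longrightarrow> \<chi> (x i) (e i) = 1"
      "\<And>i j. \<lbrakk>i \<le> dim; j \<le> dim; j \<noteq> i\<rbrakk> \<Longrightarrow> \<chi> (x j) (e i) = 0"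
    by simp_all
  obtain c where c: "(\<Oplus>i\<in>{..dim}. c i \<odot> e i) = \<zero>" and "\<exists>i\<le>dim. c i \<noteq> 0"
    by (rule linear_dependence[OF assms(1) e(1)])
  then obtain i where i: "i \<le> dim" "c i \<noteq> 0" by blast
  note D = characterD[OF \<chi>[OF xX[OF i(1)]]]
  have "\<chi> (x i) (\<Oplus>j\<in>S. c j \<odot> e j) = (\<Sum>j\<in>S. c j * \<chi> (x i) (e j))" if "finite S" "S \<subseteq> {..dim}" for S
    using that
  proof induction
    case (insert j S)
    then have "(\<lambda>j. c j \<odot> e j) \<in> S \<rightarrow> carrier V" "c j \<odot> e j \<in> carrier V" "e j \<in> carrier V"
      using e(1) by auto
    then show ?case using insert by (simp add: D finsum_closed)
  qed (simp add: D)
  from this[of "{..dim}"] have "(\<Sum>j\<in>{..dim}. c j * \<chi> (x i) (e j)) = 0"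
    by (simp add: c D)
  also have "(\<Sum>j\<in>{..dim}. c j * \<chi> (x i) (e j)) = (\<Sum>j\<in>{..dim}. if j = i then c i else 0)"
    using e(2,3) i(1) by (intro sum.cong) auto
  finally show False using i by simp
qed

lemma characters_interpolate:
  assumes \<chi>: "\<And>x. x \<in> X \<Longrightarrow> character (\<chi> x)"
    and distinct: "\<And>x y. \<lbrakk>x \<in> X; y \<in> X; x \<noteq> y\<rbrakk> \<Longrightarrow> \<exists>a\<in>carrier V. \<chi> x a \<noteq> \<chi> y a"
    and "finite X"
  shows "\<exists>a\<in>carrier V. \<forall>x\<in>X. \<chi> x a = f x"
  using assms(3,1,2)
proof (induction X)
  case empty
  then show ?case by auto
next
  case (insert x F)
  have char: "character (\<chi> y)" if "y \<in> insert x F" for y using insert.prems(1) that by blast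
  obtain a where a: "a \<in> carrier V" "\<forall>y\<in>F. \<chi> y a = f y"
    using insert.IH insert.prems by blast
  have "\<exists>e\<in>carrier V. \<chi> x e = 1 \<and> (\<forall>y\<in>F. \<chi> y e = 0)"
  proof (rule characters_separate)
    show "\<exists>a\<in>carrier V. \<chi> x a \<noteq> \<chi> y a" if "y \<in> F" for y
      using insert.prems(2)[of x y] insert.hyps(2) that by auto
  qed (use char insert.hyps in auto)
  then obtain e where e: "e \<in> carrier V" "\<chi> x e = 1" "\<forall>y\<in>F. \<chi> y e = 0" by blast
  \<comment> \<open>correct the value at \<open>x\<close> without changing the values on \<open>F\<close>\<close>
  let ?b = "a \<oplus> (f x - \<chi> x a) \<odot> e"
  have "\<chi> y ?b = \<chi> y a + (f x - \<chi> x a) * \<chi> y e" if "y \<in> insert x F" for y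
    using characterD[OF char[OF that]] a(1) e(1) by simp
  then show ?case using a e by (intro bexI[of _ ?b]) auto
qed

end

section \<open>Calculating with tensor products\<close>

text \<open>The same space occurs as different records: \<open>V \<otimes>\<^sub>R W\<close> and \<open>tensor_space V W\<close>, or a function space with
  and without an action. This lemma passes from one to the other.\<close>

lemma vectorspace_cong:
  assumes "vectorspace complex_ring V"
    and eq: "carrier W = carrier V" "add W = add V" "zero W = zero V" "module.smult W = module.smult V"
  shows "vectorspace complex_ring W"
proof -
  interpret V: vectorspace complex_ring V by fact
  show ?thesis
  proof (rule vs_criteria)
    show "\<forall>v\<in>carrier W. \<exists>neg_v\<in>carrier W. v \<oplus>\<^bsub>W\<^esub> neg_v = \<zero>\<^bsub>W\<^esub>"
    proof
      fix v assume "v \<in> carrier W"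
      then show "\<exists>neg_v\<in>carrier W. v \<oplus>\<^bsub>W\<^esub> neg_v = \<zero>\<^bsub>W\<^esub>"
        by (intro bexI[of _ "\<ominus>\<^bsub>V\<^esub> v"]) (simp_all add: eq V.r_neg)
    qed
    show "\<forall>v w x. v \<in> carrier W \<and> w \<in> carrier W \<and> x \<in> carrier W \<longrightarrow>
        v \<oplus>\<^bsub>W\<^esub> w \<oplus>\<^bsub>W\<^esub> x = v \<oplus>\<^bsub>W\<^esub> (w \<oplus>\<^bsub>W\<^esub> x)"
      by (simp add: eq V.a_assoc)
    show "\<forall>v w. v \<in> carrier W \<and> w \<in> carrier W \<longrightarrow> v \<oplus>\<^bsub>W\<^esub> w = w \<oplus>\<^bsub>W\<^esub> v"
      by (simp add: eq V.a_comm)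
    show "\<forall>c v. c \<in> carrier complex_ring \<and> v \<in> carrier W \<longrightarrow> c \<odot>\<^bsub>W\<^esub> v \<in> carrier W"
      by (metis V.smult_closed eq(1,4))
    show "\<forall>v\<in>carrier W. \<one>\<^bsub>complex_ring\<^esub> \<odot>\<^bsub>W\<^esub> v = v"
      using V.smult_one by (simp only: eq) blast
    show "\<forall>a b v. a \<in> carrier complex_ring \<and> b \<in> carrier complex_ring \<and> v \<in> carrier W \<longrightarrow>
        (a \<otimes>\<^bsub>complex_ring\<^esub> b) \<odot>\<^bsub>W\<^esub> v = a \<odot>\<^bsub>W\<^esub> (b \<odot>\<^bsub>W\<^esub> v)"
      using V.smult_assoc1 by (simp only: eq) blast
    show "\<forall>a b v. a \<in> carrier complex_ring \<and> b \<in> carrier complex_ring \<and> v \<in> carrier W \<longrightarrow>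
        (a \<oplus>\<^bsub>complex_ring\<^esub> b) \<odot>\<^bsub>W\<^esub> v = a \<odot>\<^bsub>W\<^esub> v \<oplus>\<^bsub>W\<^esub> b \<odot>\<^bsub>W\<^esub> v"
      using V.smult_l_distr by (simp only: eq) blast
    show "\<forall>a v w. a \<in> carrier complex_ring \<and> v \<in> carrier W \<and> w \<in> carrier W \<longrightarrow>
        a \<odot>\<^bsub>W\<^esub> (v \<oplus>\<^bsub>W\<^esub> w) = a \<odot>\<^bsub>W\<^esub> v \<oplus>\<^bsub>W\<^esub> a \<odot>\<^bsub>W\<^esub> w"
      using V.smult_r_distr by (simp only: eq) blast
  qed (simp_all add: eq class_field)
qed

lemma tensor_rep_vs:
  assumes "vectorspace complex_ring V" "vectorspace complex_ring W"
  shows "vectorspace complex_ring (V \<otimes>\<^sub>R W)"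
  by (rule vectorspace_cong[OF tensor_space_is_vs[OF assms]]) simp_all

lemma unit_rep_vs: "vectorspace complex_ring unit_rep"
proof (rule vs_criteria)
  show "\<forall>v\<in>carrier unit_rep. \<exists>neg_v\<in>carrier unit_rep. v \<oplus>\<^bsub>unit_rep\<^esub> neg_v = \<zero>\<^bsub>unit_rep\<^esub>"
    by (intro ballI bexI[of _ "- _"]) simp_all
qed (simp_all add: class_field algebra_simps)

lemma linear_maps_tensor_rep [simp]:
  "linear_maps (V \<otimes>\<^sub>R W) U = linear_maps (tensor_space V W) U"
  "linear_maps U (V \<otimes>\<^sub>R W) = linear_maps U (tensor_space V W)"
  by (simp_all add: LinearCombinations.module_hom_def)

lemma bilinear_mapI:
  assumes "\<And>v w. \<lbrakk>v \<in> carrier V; w \<in> carrier W\<rbrakk> \<Longrightarrow> b v w \<in> carrier U"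
    and "\<And>v v' w. \<lbrakk>v \<in> carrier V; v' \<in> carrier V; w \<in> carrier W\<rbrakk>
      \<Longrightarrow> b (v \<oplus>\<^bsub>V\<^esub> v') w = b v w \<oplus>\<^bsub>U\<^esub> b v' w"
    and "\<And>v w w'. \<lbrakk>v \<in> carrier V; w \<in> carrier W; w' \<in> carrier W\<rbrakk>
      \<Longrightarrow> b v (w \<oplus>\<^bsub>W\<^esub> w') = b v w \<oplus>\<^bsub>U\<^esub> b v w'"
    and "\<And>c v w. \<lbrakk>v \<in> carrier V; w \<in> carrier W\<rbrakk> \<Longrightarrow> b (c \<odot>\<^bsub>V\<^esub> v) w = c \<odot>\<^bsub>U\<^esub> b v w"
    and "\<And>c v w. \<lbrakk>v \<in> carrier V; w \<in> carrier W\<rbrakk> \<Longrightarrow> b v (c \<odot>\<^bsub>W\<^esub> w) = c \<odot>\<^bsub>U\<^esub> b v w"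
  shows "bilinear_map V W U b"
  unfolding bilinear_map_def using assms by (auto intro!: linear_mapsI)

lemma bilinear_mapD:
  assumes "bilinear_map V W U b"
  shows "\<lbrakk>v \<in> carrier V; w \<in> carrier W\<rbrakk> \<Longrightarrow> b v w \<in> carrier U"
    and "\<lbrakk>v \<in> carrier V; v' \<in> carrier V; w \<in> carrier W\<rbrakk> \<Longrightarrow> b (v \<oplus>\<^bsub>V\<^esub> v') w = b v w \<oplus>\<^bsub>U\<^esub> b v' w"
    and "\<lbrakk>v \<in> carrier V; w \<in> carrier W; w' \<in> carrier W\<rbrakk> \<Longrightarrow> b v (w \<oplus>\<^bsub>W\<^esub> w') = b v w \<oplus>\<^bsub>U\<^esub> b v w'"
    and "\<lbrakk>v \<in> carrier V; w \<in> carrier W\<rbrakk> \<Longrightarrow> b (c \<odot>\<^bsub>V\<^esub> v) w = c \<odot>\<^bsub>U\<^esub> b v w"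
    and "\<lbrakk>v \<in> carrier V; w \<in> carrier W\<rbrakk> \<Longrightarrow> b v (c \<odot>\<^bsub>W\<^esub> w) = c \<odot>\<^bsub>U\<^esub> b v w"
proof -
  have left: "b v \<in> linear_maps W U" if "v \<in> carrier V" for v
    using assms that unfolding bilinear_map_def by blast
  have right: "(\<lambda>v. b v w) \<in> linear_maps V U" if "w \<in> carrier W" for w
    using assms that unfolding bilinear_map_def by blast
  show "b v w \<in> carrier U" if "v \<in> carrier V" "w \<in> carrier W"
    using linear_maps_closed[OF left] that by blast
  show "b (v \<oplus>\<^bsub>V\<^esub> v') w = b v w \<oplus>\<^bsub>U\<^esub> b v' w" if "v \<in> carrier V" "v' \<in> carrier V" "w \<in> carrier W"
    using linear_maps_add[OF right] that by blast
  show "b v (w \<oplus>\<^bsub>W\<^esub> w') = b v w \<oplus>\<^bsub>U\<^esub> b v w'" if "v \<in> carrier V" "w \<in> carrier W" "w' \<in> carrier W"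
    using linear_maps_add[OF left] that by blast
  show "b (c \<odot>\<^bsub>V\<^esub> v) w = c \<odot>\<^bsub>U\<^esub> b v w" if "v \<in> carrier V" "w \<in> carrier W"
    using linear_maps_scale[OF right] that by blast
  show "b v (c \<odot>\<^bsub>W\<^esub> w) = c \<odot>\<^bsub>U\<^esub> b v w" if "v \<in> carrier V" "w \<in> carrier W"
    using linear_maps_scale[OF left] that by blast
qed

text \<open>Each law holds because the difference of its two sides comes from one of the relations that
  generate \<open>tensor_null V W\<close>.\<close>

lemma tens_bilinear:
  assumes V: "vectorspace complex_ring V" and W: "vectorspace complex_ring W"
  shows "bilinear_map V W (tensor_space V W) (tens V W)"
proof -
  let ?F = "free_space (carrier V \<times> carrier W)" and ?N = "tensor_null V W"
  interpret V: vectorspace complex_ring V by fact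
  interpret W: vectorspace complex_ring W by fact
  interpret F: vectorspace complex_ring ?F by (rule free_space_vs)
  note N = tensor_null_submodule[OF V W]
  let ?p = "\<lambda>f. ?N +>\<^bsub>?F\<^esub> f"
  have p: "?p \<in> linear_maps ?F (tensor_space V W)"
    unfolding tensor_space_def by (rule quotient_proj[OF free_space_vs N])
  have d: "delta (v, w) \<in> carrier ?F" if "v \<in> carrier V" "w \<in> carrier W" for v w
    using that by (intro delta_carrier) auto
  have rel: "r \<in> ?N" if "r \<in> bilinear_relations V W" for r
    unfolding tensor_null_def
    using F.in_own_span[OF bilinear_relations_carrier[OF V W]] that by blast
  have proj_eqI: "?p g = ?p f"
    if "f \<in> carrier ?F" "g \<in> carrier ?F" "(\<lambda>x. g x - f x) \<in> bilinear_relations V W" for f g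
  proof -
    have "\<exists>n\<in>?N. g = n \<oplus>\<^bsub>?F\<^esub> f"
      by (rule bexI[OF _ rel[OF that(3)]]) (simp add: free_space_def)
    then have "?p f = ?p g"
      unfolding quotient_eq_iff[OF free_space_vs N that(1,2)] .
    then show ?thesis ..
  qed
  have sc: "c \<odot>\<^bsub>V\<^esub> v \<in> carrier V" if "v \<in> carrier V" for c v
    using that V.smult_closed[of c v] by simp
  have sc': "c \<odot>\<^bsub>W\<^esub> v \<in> carrier W" if "v \<in> carrier W" for c v
    using that W.smult_closed[of c v] by simp
  have sF: "c \<odot>\<^bsub>?F\<^esub> f \<in> carrier ?F" if "f \<in> carrier ?F" for c f
    using that F.smult_closed[of c f] by simp
  have addF: "f \<oplus>\<^bsub>?F\<^esub> g = (\<lambda>x. f x + g x)" "c \<odot>\<^bsub>?F\<^esub> f = (\<lambda>x. c * f x)" for c f g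
    by (simp_all add: free_space_def)
  show ?thesis
  proof (rule bilinear_mapI)
    fix v w assume "v \<in> carrier V" "w \<in> carrier W"
    then show "tens V W v w \<in> carrier (tensor_space V W)"
      unfolding tens_def by (intro linear_maps_closed[OF p] d)
  next
    fix v v' w assume a: "v \<in> carrier V" "v' \<in> carrier V" "w \<in> carrier W"
    have "?p (delta (v \<oplus>\<^bsub>V\<^esub> v', w)) = ?p (delta (v, w) \<oplus>\<^bsub>?F\<^esub> delta (v', w))"
    proof (rule proj_eqI)
      show "(\<lambda>x. delta (v \<oplus>\<^bsub>V\<^esub> v', w) x - (delta (v, w) \<oplus>\<^bsub>?F\<^esub> delta (v', w)) x) \<in> bilinear_relations V W"
        unfolding bilinear_relations_def addF diff_diff_eq[symmetric] using a by blast
    qed (use a in \<open>auto intro!: d F.a_closed V.a_closed\<close>)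
    then show "tens V W (v \<oplus>\<^bsub>V\<^esub> v') w = tens V W v w \<oplus>\<^bsub>tensor_space V W\<^esub> tens V W v' w"
      unfolding tens_def using a by (subst (asm) linear_maps_add[OF p]) (auto intro!: d)
  next
    fix v w w' assume a: "v \<in> carrier V" "w \<in> carrier W" "w' \<in> carrier W"
    have "?p (delta (v, w \<oplus>\<^bsub>W\<^esub> w')) = ?p (delta (v, w) \<oplus>\<^bsub>?F\<^esub> delta (v, w'))"
    proof (rule proj_eqI)
      show "(\<lambda>x. delta (v, w \<oplus>\<^bsub>W\<^esub> w') x - (delta (v, w) \<oplus>\<^bsub>?F\<^esub> delta (v, w')) x) \<in> bilinear_relations V W"
        unfolding bilinear_relations_def addF diff_diff_eq[symmetric] using a by blast
    qed (use a in \<open>auto intro!: d F.a_closed W.a_closed\<close>)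
    then show "tens V W v (w \<oplus>\<^bsub>W\<^esub> w') = tens V W v w \<oplus>\<^bsub>tensor_space V W\<^esub> tens V W v w'"
      unfolding tens_def using a by (subst (asm) linear_maps_add[OF p]) (auto intro!: d)
  next
    fix c v w assume a: "v \<in> carrier V" "w \<in> carrier W"
    have "?p (delta (c \<odot>\<^bsub>V\<^esub> v, w)) = ?p (c \<odot>\<^bsub>?F\<^esub> delta (v, w))"
    proof (rule proj_eqI)
      show "(\<lambda>x. delta (c \<odot>\<^bsub>V\<^esub> v, w) x - (c \<odot>\<^bsub>?F\<^esub> delta (v, w)) x) \<in> bilinear_relations V W"
        unfolding bilinear_relations_def addF using a by blast
    qed (use a in \<open>auto intro!: d sF sc\<close>)
    then show "tens V W (c \<odot>\<^bsub>V\<^esub> v) w = c \<odot>\<^bsub>tensor_space V W\<^esub> tens V W v w"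
      unfolding tens_def using a by (subst (asm) linear_maps_scale[OF p]) (auto intro!: d)
    have "?p (delta (v, c \<odot>\<^bsub>W\<^esub> w)) = ?p (c \<odot>\<^bsub>?F\<^esub> delta (v, w))"
    proof (rule proj_eqI)
      show "(\<lambda>x. delta (v, c \<odot>\<^bsub>W\<^esub> w) x - (c \<odot>\<^bsub>?F\<^esub> delta (v, w)) x) \<in> bilinear_relations V W"
        unfolding bilinear_relations_def addF using a by blast
    qed (use a in \<open>auto intro!: d sF sc'\<close>)
    then show "tens V W v (c \<odot>\<^bsub>W\<^esub> w) = c \<odot>\<^bsub>tensor_space V W\<^esub> tens V W v w"
      unfolding tens_def using a by (subst (asm) linear_maps_scale[OF p]) (auto intro!: d)
  qed
qed

lemmas tens_closed = bilinear_mapD(1)[OF tens_bilinear]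

lemma tensor_lift:
  assumes "vectorspace complex_ring V" "vectorspace complex_ring W" "vectorspace complex_ring U"
    and "bilinear_map V W U b"
  shows tensor_lift_linear: "tensor_lift V W U b \<in> linear_maps (tensor_space V W) U"
    and tensor_lift_tens:
      "\<lbrakk>v \<in> carrier V; w \<in> carrier W\<rbrakk> \<Longrightarrow> tensor_lift V W U b (tens V W v w) = b v w"
  using theI'[OF tensor_universal[OF assms]] unfolding tensor_lift_def[symmetric] by blast+

text \<open>This is the uniqueness half of the universal property, applied to the bilinear map that both
  \<open>h\<close> and \<open>k\<close> induce. Every identity between maps out of a tensor product is derived from it.\<close>

lemma tensor_linear_eqI:
  assumes V: "vectorspace complex_ring V" and W: "vectorspace complex_ring W"
    and U: "vectorspace complex_ring U"
    and h: "h \<in> linear_maps (tensor_space V W) U" and k: "k \<in> linear_maps (tensor_space V W) U"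
    and eq: "\<And>v w. \<lbrakk>v \<in> carrier V; w \<in> carrier W\<rbrakk> \<Longrightarrow> h (tens V W v w) = k (tens V W v w)"
    and x: "x \<in> carrier (tensor_space V W)"
  shows "h x = k x"
proof -
  let ?T = "tensor_space V W"
  interpret T: vectorspace complex_ring ?T by (rule tensor_space_is_vs[OF V W])
  note tb = tens_bilinear[OF V W]
  have b: "bilinear_map V W U (\<lambda>v w. h (tens V W v w))"
    by (rule bilinear_mapI)
      (simp_all add: bilinear_mapD[OF tb] linear_maps_closed[OF h] linear_maps_add[OF h] linear_maps_scale[OF h])
  have restr: "restrict f (carrier ?T) \<in> linear_maps ?T U" if f: "f \<in> linear_maps ?T U" for f
  proof (rule linear_mapsI)
    fix c v assume "v \<in> carrier ?T"
    then show "restrict f (carrier ?T) (c \<odot>\<^bsub>?T\<^esub> v) = c \<odot>\<^bsub>U\<^esub> restrict f (carrier ?T) v"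
      using T.smult_closed[of c v] by (simp add: linear_maps_scale[OF f])
  qed (simp_all add: linear_maps_closed[OF f] linear_maps_add[OF f])
  let ?P = "\<lambda>f. f \<in> linear_maps ?T U \<and> f \<in> extensional (carrier ?T) \<and>
    (\<forall>v\<in>carrier V. \<forall>w\<in>carrier W. f (tens V W v w) = h (tens V W v w))"
  have "?P (restrict h (carrier ?T))" "?P (restrict k (carrier ?T))"
    using h k eq bilinear_mapD(1)[OF tb] by (simp_all add: restr)
  then have "restrict h (carrier ?T) = restrict k (carrier ?T)"
    using tensor_universal[OF V W U b] by blast
  then show ?thesis using x by (metis restrict_apply')
qed

section \<open>Values on pure tensors\<close>

lemma rep_homD:
  assumes "f \<in> rep_hom G V W"
  shows rep_hom_linear: "f \<in> linear_maps V W"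
    and rep_hom_act: "\<lbrakk>g \<in> carrier G; v \<in> carrier V\<rbrakk> \<Longrightarrow> f (act V g v) = act W g (f v)"
  using assms by (auto simp: rep_hom_def)

lemma id_mor_linear:
  assumes "vectorspace complex_ring V"
  shows "id_mor V \<in> linear_maps V V"
proof -
  interpret vectorspace complex_ring V by fact
  have "c \<odot>\<^bsub>V\<^esub> v \<in> carrier V" if "v \<in> carrier V" for c v
    using that smult_closed[of c v] by simp
  then show ?thesis by (intro linear_mapsI) simp_all
qed

lemma bilinear_map_tens_mor:
  assumes "vectorspace complex_ring V'" "vectorspace complex_ring W'"
    and f: "f \<in> linear_maps V V'" and h: "h \<in> linear_maps W W'"
  shows "bilinear_map V W (tensor_space V' W') (\<lambda>v w. tens V' W' (f v) (h w))"
  by (rule bilinear_mapI)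
    (simp_all add: linear_mapsD[OF f] linear_mapsD[OF h] bilinear_mapD[OF tens_bilinear[OF assms(1,2)]])

lemma bilinear_map_tensor_rep [simp]:
  "bilinear_map V W (U \<otimes>\<^sub>R U') b \<longleftrightarrow> bilinear_map V W (tensor_space U U') b"
  by (simp add: bilinear_map_def)

lemma tensor_mor:
  assumes V: "vectorspace complex_ring V" and W: "vectorspace complex_ring W"
    and V': "vectorspace complex_ring V'" and W': "vectorspace complex_ring W'"
    and f: "f \<in> linear_maps V V'" and h: "h \<in> linear_maps W W'"
  shows tensor_mor_linear: "tensor_mor V W V' W' f h \<in> linear_maps (tensor_space V W) (tensor_space V' W')"
    and tensor_mor_tens: "\<lbrakk>v \<in> carrier V; w \<in> carrier W\<rbrakk> \<Longrightarrow>
      tensor_mor V W V' W' f h (tens V W v w) = tens V' W' (f v) (h w)"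
proof -
  have b: "bilinear_map V W (V' \<otimes>\<^sub>R W') (\<lambda>v w. tens V' W' (f v) (h w))"
    using bilinear_map_tens_mor[OF V' W' f h] by simp
  note lift = tensor_lift[OF V W tensor_rep_vs[OF V' W'] b]
  show "tensor_mor V W V' W' f h \<in> linear_maps (tensor_space V W) (tensor_space V' W')"
    using lift(1) by (simp add: tensor_mor_def)
  show "tensor_mor V W V' W' f h (tens V W v w) = tens V' W' (f v) (h w)"
    if "v \<in> carrier V" "w \<in> carrier W"
    using lift(2)[OF that] by (simp add: tensor_mor_def)
qed

lemma flip_mor_tens:
  assumes V: "vectorspace complex_ring V" and W: "vectorspace complex_ring W"
    and "v \<in> carrier V" "w \<in> carrier W"
  shows "flip_mor V W (tens V W v w) = tens W V w v"
proof -
  have "bilinear_map V W (W \<otimes>\<^sub>R V) (\<lambda>v w. tens W V w v)"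
    by (rule bilinear_mapI) (simp_all add: bilinear_mapD[OF tens_bilinear[OF W V]])
  from tensor_lift(2)[OF V W tensor_rep_vs[OF W V] this assms(3,4)] show ?thesis
    by (simp add: flip_mor_def)
qed

lemma tensor_rep_act_tens:
  assumes "fd_rep G V" "fd_rep G W" and "g \<in> carrier G" "v \<in> carrier V" "w \<in> carrier W"
  shows "act (V \<otimes>\<^sub>R W) g (tens V W v w) = tens V W (act V g v) (act W g w)"
proof -
  interpret V: fd_rep G V by fact
  interpret W: fd_rep G W by fact
  note vs = V.vectorspace_axioms W.vectorspace_axioms
  show ?thesis
    using tensor_lift(2)[OF vs tensor_space_is_vs[OF vs]
        bilinear_map_tens_mor[OF vs V.act_linear W.act_linear]] assms by simp
qed

lemma scale_bilinear:
  assumes V: "vectorspace complex_ring V"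
  shows "bilinear_map unit_rep V V (\<lambda>c v. c \<odot>\<^bsub>V\<^esub> v)"
    and "bilinear_map V unit_rep V (\<lambda>v c. c \<odot>\<^bsub>V\<^esub> v)"
proof -
  interpret complex_space V by (rule complex_space.intro[OF V])
  show "bilinear_map unit_rep V V (\<lambda>c v. c \<odot>\<^bsub>V\<^esub> v)" "bilinear_map V unit_rep V (\<lambda>v c. c \<odot>\<^bsub>V\<^esub> v)"
    by (rule bilinear_mapI; simp add: scale_add_left scale_add_right scale_scale mult.commute)+
qed

lemma lunit_mor_tens:
  fixes V :: "('g, 'v) rep"
  assumes V: "vectorspace complex_ring V" and v: "v \<in> carrier V"
  shows "lunit_mor V (tens (unit_rep :: ('g, complex) rep) V c v) = c \<odot>\<^bsub>V\<^esub> v"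
  using tensor_lift(2)[OF unit_rep_vs V V scale_bilinear(1)[OF V] _ v, of c]
  by (simp add: lunit_mor_def)

lemma runit_mor:
  fixes V :: "('g, 'v) rep"
  assumes V: "vectorspace complex_ring V"
  shows runit_mor_linear: "runit_mor V \<in> linear_maps (tensor_space V (unit_rep :: ('g, complex) rep)) V"
    and runit_mor_tens:
      "v \<in> carrier V \<Longrightarrow> runit_mor V (tens V (unit_rep :: ('g, complex) rep) v c) = c \<odot>\<^bsub>V\<^esub> v"
  using tensor_lift(1,2)[OF V unit_rep_vs V scale_bilinear(2)[OF V]]
  by (simp_all add: runit_mor_def)

text \<open>The inner lift \<open>L w\<close> is a map on \<open>U \<otimes> V\<close> that depends on \<open>w\<close>. The point to check is that it is linear
  in \<open>w\<close> also at elements that are not pure tensors; both sides of each law are linear maps on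
  \<open>U \<otimes> V\<close>, so pure tensors suffice.\<close>

lemma assoc_mor:
  fixes U :: "('g, 'u) rep" and V :: "('g, 'v) rep" and W :: "('g, 'w) rep"
  assumes U: "vectorspace complex_ring U" and V: "vectorspace complex_ring V"
    and W: "vectorspace complex_ring W"
  shows assoc_mor_linear: "assoc_mor U V W
      \<in> linear_maps (tensor_space (U \<otimes>\<^sub>R V) W) (tensor_space U (V \<otimes>\<^sub>R W))"
    and assoc_mor_tens: "\<lbrakk>u \<in> carrier U; v \<in> carrier V; w \<in> carrier W\<rbrakk> \<Longrightarrow>
      assoc_mor U V W (tens (U \<otimes>\<^sub>R V) W (tens U V u v) w) = tens U (V \<otimes>\<^sub>R W) u (tens V W v w)"
proof -
  let ?T = "U \<otimes>\<^sub>R (V \<otimes>\<^sub>R W)"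
  note UV = tensor_rep_vs[OF U V] and VW = tensor_rep_vs[OF V W]
  have T: "vectorspace complex_ring ?T" by (rule tensor_rep_vs[OF U VW])
  interpret T: complex_space ?T by (rule complex_space.intro[OF T])
  interpret UV: complex_space "U \<otimes>\<^sub>R V" by (rule complex_space.intro[OF UV])
  note tVW = bilinear_mapD[OF tens_bilinear[OF V W]]
  note tT = bilinear_mapD[OF tens_bilinear[OF U VW]]
  define b where "b = (\<lambda>w. \<lambda>u v. tens U (V \<otimes>\<^sub>R W) u (tens V W v w))"
  have b: "bilinear_map U V ?T (b w)" if "w \<in> carrier W" for w
    by (rule bilinear_mapI) (use that in \<open>simp_all add: b_def tVW tT[simplified]\<close>)
  define L where "L w = tensor_lift U V ?T (b w)" for w
  note L_linear = tensor_lift(1)[OF U V T b, folded L_def]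
    and L_tens = tensor_lift(2)[OF U V T b, folded L_def]
  have "bilinear_map (U \<otimes>\<^sub>R V) W ?T (\<lambda>x w. L w x)"
  proof (rule bilinear_mapI)
    fix x w assume "x \<in> carrier (U \<otimes>\<^sub>R V)" "w \<in> carrier W"
    then show "L w x \<in> carrier ?T"
      using linear_maps_closed[OF L_linear] by simp
  next
    fix x x' w assume "x \<in> carrier (U \<otimes>\<^sub>R V)" "x' \<in> carrier (U \<otimes>\<^sub>R V)" "w \<in> carrier W"
    then show "L w (x \<oplus>\<^bsub>U \<otimes>\<^sub>R V\<^esub> x') = L w x \<oplus>\<^bsub>?T\<^esub> L w x'"
      using linear_maps_add[OF L_linear] by simp
  next
    fix x w w' assume x: "x \<in> carrier (U \<otimes>\<^sub>R V)" and w: "w \<in> carrier W" "w' \<in> carrier W"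
    interpret W: vectorspace complex_ring W by fact
    have w'': "w \<oplus>\<^bsub>W\<^esub> w' \<in> carrier W" using w by simp
    have sum: "(\<lambda>x. L w x \<oplus>\<^bsub>?T\<^esub> L w' x) \<in> linear_maps (tensor_space U V) ?T"
    proof (rule linear_mapsI)
      fix v assume v: "v \<in> carrier (tensor_space U V)"
      then show "L w v \<oplus>\<^bsub>?T\<^esub> L w' v \<in> carrier ?T"
        using linear_maps_closed[OF L_linear] w by (intro T.a_closed)
      show "L w (c \<odot>\<^bsub>tensor_space U V\<^esub> v) \<oplus>\<^bsub>?T\<^esub> L w' (c \<odot>\<^bsub>tensor_space U V\<^esub> v) =
          c \<odot>\<^bsub>?T\<^esub> (L w v \<oplus>\<^bsub>?T\<^esub> L w' v)" for c
        unfolding linear_maps_scale[OF L_linear[OF w(1)] v] linear_maps_scale[OF L_linear[OF w(2)] v]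
        using linear_maps_closed[OF L_linear] w v by (intro T.scale_add_right[symmetric])
    next
      fix v v' assume v: "v \<in> carrier (tensor_space U V)" "v' \<in> carrier (tensor_space U V)"
      note cl = linear_maps_closed[OF L_linear[OF w(1)]] linear_maps_closed[OF L_linear[OF w(2)]]
      show "L w (v \<oplus>\<^bsub>tensor_space U V\<^esub> v') \<oplus>\<^bsub>?T\<^esub> L w' (v \<oplus>\<^bsub>tensor_space U V\<^esub> v') =
          (L w v \<oplus>\<^bsub>?T\<^esub> L w' v) \<oplus>\<^bsub>?T\<^esub> (L w v' \<oplus>\<^bsub>?T\<^esub> L w' v')"
        unfolding linear_maps_add[OF L_linear[OF w(1)] v] linear_maps_add[OF L_linear[OF w(2)] v]
        using T.add.m_ac cl[OF v(1)] cl[OF v(2)] by (simp del: tensor_rep_simps)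
    qed
    show "L (w \<oplus>\<^bsub>W\<^esub> w') x = L w x \<oplus>\<^bsub>?T\<^esub> L w' x"
    proof (rule tensor_linear_eqI[OF U V T L_linear[OF w''] sum])
      show "L (w \<oplus>\<^bsub>W\<^esub> w') (tens U V u v) = L w (tens U V u v) \<oplus>\<^bsub>?T\<^esub> L w' (tens U V u v)"
        if "u \<in> carrier U" "v \<in> carrier V" for u v
        unfolding L_tens[OF w'' that] L_tens[OF w(1) that] L_tens[OF w(2) that]
        using that w by (simp add: b_def tVW tT[simplified])
    qed (use x in simp)
  next
    fix c x w assume "x \<in> carrier (U \<otimes>\<^sub>R V)" "w \<in> carrier W"
    then show "L w (c \<odot>\<^bsub>U \<otimes>\<^sub>R V\<^esub> x) = c \<odot>\<^bsub>?T\<^esub> L w x"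
      using linear_maps_scale[OF L_linear] by simp
  next
    fix c x w assume x: "x \<in> carrier (U \<otimes>\<^sub>R V)" and w: "w \<in> carrier W"
    interpret W: complex_space W by (rule complex_space.intro[OF W])
    have cw: "c \<odot>\<^bsub>W\<^esub> w \<in> carrier W" using w by simp
    have scale: "(\<lambda>x. c \<odot>\<^bsub>?T\<^esub> L w x) \<in> linear_maps (tensor_space U V) ?T"
    proof (rule linear_mapsI)
      fix v assume v: "v \<in> carrier (tensor_space U V)"
      then show "c \<odot>\<^bsub>?T\<^esub> L w v \<in> carrier ?T"
        using linear_maps_closed[OF L_linear] w by (intro T.scale_closed)
      show "c \<odot>\<^bsub>?T\<^esub> L w (k \<odot>\<^bsub>tensor_space U V\<^esub> v) = k \<odot>\<^bsub>?T\<^esub> (c \<odot>\<^bsub>?T\<^esub> L w v)" for k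
        unfolding linear_maps_scale[OF L_linear[OF w] v]
        using linear_maps_closed[OF L_linear[OF w] v]
        by (simp add: T.scale_scale mult.commute del: tensor_rep_simps)
    next
      fix v v' assume v: "v \<in> carrier (tensor_space U V)" "v' \<in> carrier (tensor_space U V)"
      show "c \<odot>\<^bsub>?T\<^esub> L w (v \<oplus>\<^bsub>tensor_space U V\<^esub> v') = c \<odot>\<^bsub>?T\<^esub> L w v \<oplus>\<^bsub>?T\<^esub> c \<odot>\<^bsub>?T\<^esub> L w v'"
        unfolding linear_maps_add[OF L_linear[OF w] v]
        using linear_maps_closed[OF L_linear[OF w]] v by (intro T.scale_add_right)
    qed
    show "L (c \<odot>\<^bsub>W\<^esub> w) x = c \<odot>\<^bsub>?T\<^esub> L w x"
    proof (rule tensor_linear_eqI[OF U V T L_linear[OF cw] scale])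
      show "L (c \<odot>\<^bsub>W\<^esub> w) (tens U V u v) = c \<odot>\<^bsub>?T\<^esub> L w (tens U V u v)"
        if "u \<in> carrier U" "v \<in> carrier V" for u v
        unfolding L_tens[OF cw that] L_tens[OF w that]
        using that w by (simp add: b_def tVW tT[simplified])
    qed (use x in simp)
  qed
  note lift = tensor_lift(1,2)[OF UV W T this]
  have eq: "assoc_mor U V W = tensor_lift (U \<otimes>\<^sub>R V) W ?T (\<lambda>x w. L w x)"
    by (simp add: assoc_mor_def L_def b_def)
  show "assoc_mor U V W \<in> linear_maps (tensor_space (U \<otimes>\<^sub>R V) W) (tensor_space U (V \<otimes>\<^sub>R W))"
    using lift(1) by (simp add: eq)
  show "assoc_mor U V W (tens (U \<otimes>\<^sub>R V) W (tens U V u v) w) = tens U (V \<otimes>\<^sub>R W) u (tens V W v w)"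
    if "u \<in> carrier U" "v \<in> carrier V" "w \<in> carrier W"
    using that lift(2)[of "tens U V u v" w] tens_closed[OF U V] L_tens[OF that(3,1,2)]
    by (simp add: eq b_def)
qed

text \<open>Write \<open>i(1)\<close> as a sum of tensors \<open>x\<^sub>k \<otimes> y\<^sub>k\<close>. The first zigzag identity says that \<open>v\<close> is the sum of the
  \<open>e(y\<^sub>k, v) x\<^sub>k\<close>, which is zero if \<open>e(-, v)\<close> vanishes. To avoid the decomposition, the proof
  shows that the linear map \<open>T\<close> with \<open>T (x \<otimes> y) = e(y, v) x\<close> is zero and that \<open>T (i 1) = v\<close>.\<close>

lemma rigidity_axioms_nondegenerate:
  fixes U :: "('g, 'u) rep" and V :: "('g, 'v) rep"
  assumes U: "vectorspace complex_ring U" and V: "vectorspace complex_ring V"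
    and e: "e \<in> linear_maps (U \<otimes>\<^sub>R V) (unit_rep :: ('g, complex) rep)"
    and i: "i \<in> linear_maps (unit_rep :: ('g, complex) rep) (V \<otimes>\<^sub>R U)"
    and zigzag: "rigidity_axioms U V e i"
    and v: "v \<in> carrier V" and ev: "\<And>u. u \<in> carrier U \<Longrightarrow> e (tens U V u v) = 0"
  shows "v = \<zero>\<^bsub>V\<^esub>"
proof -
  let ?I = "unit_rep :: ('g, complex) rep"
  interpret V: complex_space V by (rule complex_space.intro[OF V])
  note I = unit_rep_vs and VU = tensor_rep_vs[OF V U] and UV = tensor_rep_vs[OF U V]
  note idV = id_mor_linear[OF V]
  let ?m = "tensor_mor V (U \<otimes>\<^sub>R V) V ?I (id_mor V) e"
  note m = tensor_mor[OF V UV V I idV e]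
  define T where "T x = runit_mor V (?m (assoc_mor V U V (tens (V \<otimes>\<^sub>R U) V x v)))" for x
  have "(\<lambda>x. tens (V \<otimes>\<^sub>R U) V x v) \<in> linear_maps (tensor_space V U) (tensor_space (V \<otimes>\<^sub>R U) V)"
    using tens_bilinear[OF VU V] v unfolding bilinear_map_def by simp
  from linear_maps_compose[OF linear_maps_compose[OF linear_maps_compose[OF this
        assoc_mor_linear[OF V U V]] m(1)] runit_mor_linear[OF V]]
  have T: "T \<in> linear_maps (tensor_space V U) V" unfolding T_def .
  have zero: "(\<lambda>x. \<zero>\<^bsub>V\<^esub>) \<in> linear_maps (tensor_space V U) V"
    by (rule linear_mapsI) simp_all
  have "T x = \<zero>\<^bsub>V\<^esub>" if "x \<in> carrier (tensor_space V U)" for x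
  proof (rule tensor_linear_eqI[OF V U V T zero _ that])
    fix w u assume wu: "w \<in> carrier V" "u \<in> carrier U"
    have "?m (assoc_mor V U V (tens (V \<otimes>\<^sub>R U) V (tens V U w u) v)) = tens V ?I w (e (tens U V u v))"
      using wu v tens_closed[OF U V] by (simp add: assoc_mor_tens[OF V U V] m(2))
    then show "T (tens V U w u) = \<zero>\<^bsub>V\<^esub>"
      using wu by (simp add: T_def ev runit_mor_tens[OF V])
  qed
  moreover have "i 1 \<in> carrier (tensor_space V U)"
    using linear_maps_closed[OF i, of 1] by simp
  moreover have "T (i 1) = v"
  proof -
    have "tensor_mor ?I V (V \<otimes>\<^sub>R U) V i (id_mor V) (lunit_inv_mor V v) = tens (V \<otimes>\<^sub>R U) V (i 1) v"
      using v by (simp add: lunit_inv_mor_def tensor_mor_tens[OF I V VU V i idV])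
    moreover have "compose (carrier V) (runit_mor V \<circ> ?m \<circ> assoc_mor V U V \<circ>
        tensor_mor ?I V (V \<otimes>\<^sub>R U) V i (id_mor V)) (lunit_inv_mor V) v = id_mor V v"
      using zigzag unfolding rigidity_axioms_def by simp
    ultimately show ?thesis using v by (simp add: T_def compose_def)
  qed
  ultimately show ?thesis by simp
qed

section \<open>Invariants\<close>

lemma fd_rep_act_linear:
  assumes "fd_rep G V" "g \<in> carrier G"
  shows fd_rep_act_closed: "v \<in> carrier V \<Longrightarrow> act V g v \<in> carrier V"
    and fd_rep_act_add: "\<lbrakk>v \<in> carrier V; w \<in> carrier V\<rbrakk> \<Longrightarrow>
      act V g (v \<oplus>\<^bsub>V\<^esub> w) = act V g v \<oplus>\<^bsub>V\<^esub> act V g w"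
    and fd_rep_act_scale: "v \<in> carrier V \<Longrightarrow> act V g (c \<odot>\<^bsub>V\<^esub> v) = c \<odot>\<^bsub>V\<^esub> act V g v"
  using linear_mapsD[OF fd_rep.act_linear[OF assms]] by blast+

text \<open>The functional is nonzero on some simple summand \<open>W i\<close>. Its kernel there is a proper
  subrepresentation, hence zero. For \<open>w\<close> in \<open>W i\<close> the vector \<open>g w - w\<close> lies in that kernel, so \<open>w\<close> is
  invariant.\<close>

lemma semisimple_invariant_functional:
  fixes V :: "('g, 'v) rep" and \<delta> :: "'v \<Rightarrow> complex"
  assumes V: "fd_rep G V" and ss: "semisimple_rep G V"
    and \<delta>: "\<delta> \<in> linear_maps V (unit_rep :: ('g, complex) rep)"
    and inv: "\<And>g v. \<lbrakk>g \<in> carrier G; v \<in> carrier V\<rbrakk> \<Longrightarrow> \<delta> (act V g v) = \<delta> v"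
    and v: "v \<in> carrier V" "\<delta> v \<noteq> 0"
  shows "\<exists>w\<in>carrier V. (\<forall>g\<in>carrier G. act V g w = w) \<and> \<delta> w \<noteq> 0"
proof -
  interpret V: fd_rep G V by fact
  interpret V: complex_space V by (rule complex_space.intro[OF V.vectorspace_axioms])
  note \<delta>_zero = linear_functional_zero[OF V.vectorspace_axioms \<delta>]
  have \<delta>_add: "\<delta> (x \<oplus>\<^bsub>V\<^esub> y) = \<delta> x + \<delta> y" if "x \<in> carrier V" "y \<in> carrier V" for x y
    using linear_maps_add[OF \<delta> that] by simp
  have \<delta>_scale: "\<delta> (c \<odot>\<^bsub>V\<^esub> x) = c * \<delta> x" if "x \<in> carrier V" for c x
    using linear_maps_scale[OF \<delta> that] by simp
  obtain n :: nat and W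
    where W: "\<And>i. i < n \<Longrightarrow> subrep G (W i) V \<and> simple_rep G (V\<lparr>carrier := W i\<rparr>)"
      and bij: "bij_betw (\<lambda>w. \<Oplus>\<^bsub>V\<^esub>i\<in>{..<n}. w i) (\<Pi>\<^sub>E i\<in>{..<n}. W i) (carrier V)"
    using ss unfolding semisimple_rep_def by blast
  have W_sub: "submodule complex_ring (W i) V" if "i < n" for i
    using W[OF that] by (simp add: subrep_def)
  note W_subset = submodule.subset[OF W_sub]
  obtain w where w: "w \<in> (\<Pi>\<^sub>E i\<in>{..<n}. W i)" "v = (\<Oplus>\<^bsub>V\<^esub>i\<in>{..<n}. w i)"
    using v(1) bij by (auto simp: bij_betw_def image_iff)
  have "\<delta> (\<Oplus>\<^bsub>V\<^esub>i\<in>S. w i) = 0" if "finite S" "S \<subseteq> {..<n}" "\<forall>i\<in>S. \<delta> (w i) = 0" for S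
    using that
  proof induction
    case (insert i S)
    have "w j \<in> carrier V" if "j \<in> insert i S" for j
      using that insert.prems w(1) W_subset by blast
    then have "w \<in> S \<rightarrow> carrier V" "w i \<in> carrier V" by auto
    then show ?case
      using insert V.finsum_insert[of S i w] V.finsum_closed[of w S] by (simp add: \<delta>_add)
  qed (simp add: \<delta>_zero)
  then obtain i where i: "i < n" "\<delta> (w i) \<noteq> 0"
    using v(2) w(2) by blast
  have wi: "w i \<in> W i" using w(1) i(1) by blast
  let ?W = "V\<lparr>carrier := W i\<rparr>" and ?K = "{x \<in> W i. \<delta> x = 0}"
  interpret Wi: submodule complex_ring "W i" V by (rule W_sub[OF i(1)])
  have simple: "simple_rep G ?W" and stable: "\<And>g x. \<lbrakk>g \<in> carrier G; x \<in> W i\<rbrakk> \<Longrightarrow> act V g x \<in> W i"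
    using W[OF i(1)] by (auto simp: subrep_def)
  have sc: "c \<odot>\<^bsub>V\<^esub> x \<in> W i" if "x \<in> W i" for c x
    using that Wi.smult_closed[of c x] by simp
  have WV: "x \<in> carrier V" if "x \<in> W i" for x using W_subset[OF i(1)] that by blast
  have "VectorSpace.subspace complex_ring ?K ?W"
  proof (rule subspaceI)
    show "vectorspace complex_ring ?W"
      using simple by (simp add: simple_rep_def fd_rep_def)
  qed (auto simp: \<delta>_zero \<delta>_add \<delta>_scale sc WV)
  then have "subrep G ?K ?W"
    by (auto simp: subrep_def stable inv WV)
  then have K: "?K = {\<zero>\<^bsub>V\<^esub>}"
    using simple wi i(2) unfolding simple_rep_def by auto
  have "act V g (w i) = w i" if g: "g \<in> carrier G" for g
  proof -
    note cl = WV[OF wi] WV[OF stable[OF g wi]]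
    let ?x = "act V g (w i) \<oplus>\<^bsub>V\<^esub> (- 1) \<odot>\<^bsub>V\<^esub> w i"
    have "?x \<in> ?K"
      using stable[OF g wi] sc[OF wi, of "- 1"] cl
      by (simp add: \<delta>_add \<delta>_scale inv[OF g])
    then have "?x = \<zero>\<^bsub>V\<^esub>" using K by blast
    then show ?thesis
      using V.add_scale_minus_eq_zero_iff[OF cl(2,1), of 1] cl by simp
  qed
  then show ?thesis using WV[OF wi] i(2) by blast
qed

text \<open>The same for a representation on any type, by transport to a copy on functions \<open>nat \<Rightarrow> complex\<close>,
  which is where semisimplicity of the category is stated.\<close>

lemma invariant_functional:
  fixes V :: "('g, 'v) rep" and \<delta> :: "'v \<Rightarrow> complex"
  assumes G: "semisimple_Rep G" and V: "fd_rep G V"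
    and \<delta>: "\<delta> \<in> linear_maps V (unit_rep :: ('g, complex) rep)"
    and inv: "\<And>g v. \<lbrakk>g \<in> carrier G; v \<in> carrier V\<rbrakk> \<Longrightarrow> \<delta> (act V g v) = \<delta> v"
    and v: "v \<in> carrier V" "\<delta> v \<noteq> 0"
  shows "\<exists>w\<in>carrier V. (\<forall>g\<in>carrier G. act V g w = w) \<and> \<delta> w \<noteq> 0"
proof -
  interpret V: fd_rep G V by fact
  interpret V: complex_space V by (rule complex_space.intro[OF V.vectorspace_axioms])
  obtain V' :: "('g, nat \<Rightarrow> complex) rep" and \<phi>
    where V': "fd_rep G V'" and \<phi>: "\<phi> \<in> rep_hom G V V'" "bij_betw \<phi> (carrier V) (carrier V')"
    by (rule fd_rep_iso_nat_complex[OF V])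
  have \<phi>_lin: "\<phi> \<in> linear_maps V V'"
    and \<phi>_act: "\<And>g v. \<lbrakk>g \<in> carrier G; v \<in> carrier V\<rbrakk> \<Longrightarrow> \<phi> (act V g v) = act V' g (\<phi> v)"
    using \<phi>(1) by (auto simp: rep_hom_def)
  define \<psi> where "\<psi> = inv_into (carrier V) \<phi>"
  have \<psi>\<phi>: "\<psi> (\<phi> v) = v" if "v \<in> carrier V" for v
    using \<phi>(2) that by (simp add: \<psi>_def bij_betw_def)
  have surj: "\<exists>v\<in>carrier V. x = \<phi> v" if "x \<in> carrier V'" for x
    using \<phi>(2) that by (auto simp: bij_betw_def)
  have "(\<lambda>x. \<delta> (\<psi> x)) \<in> linear_maps V' (unit_rep :: ('g, complex) rep)"
  proof (rule linear_mapsI)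
    fix x y assume xy: "x \<in> carrier V'" "y \<in> carrier V'"
    obtain v w where vw: "v \<in> carrier V" "w \<in> carrier V" "x = \<phi> v" "y = \<phi> w"
      using surj xy by blast
    have "\<psi> (x \<oplus>\<^bsub>V'\<^esub> y) = v \<oplus>\<^bsub>V\<^esub> w"
      using vw \<psi>\<phi>[of "v \<oplus>\<^bsub>V\<^esub> w"] by (simp add: linear_maps_add[OF \<phi>_lin])
    then show "\<delta> (\<psi> (x \<oplus>\<^bsub>V'\<^esub> y)) = \<delta> (\<psi> x) \<oplus>\<^bsub>unit_rep\<^esub> \<delta> (\<psi> y)"
      using vw linear_maps_add[OF \<delta>] by (simp add: \<psi>\<phi>)
  next
    fix c x assume x: "x \<in> carrier V'"
    obtain v where v: "v \<in> carrier V" "x = \<phi> v" using surj x by blast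
    have "\<psi> (c \<odot>\<^bsub>V'\<^esub> x) = c \<odot>\<^bsub>V\<^esub> v"
      using v \<psi>\<phi>[of "c \<odot>\<^bsub>V\<^esub> v"] by (simp add: linear_maps_scale[OF \<phi>_lin])
    then show "\<delta> (\<psi> (c \<odot>\<^bsub>V'\<^esub> x)) = c \<odot>\<^bsub>unit_rep\<^esub> \<delta> (\<psi> x)"
      using v linear_maps_scale[OF \<delta>] by (simp add: \<psi>\<phi>)
  qed simp
  moreover have "\<delta> (\<psi> (act V' g x)) = \<delta> (\<psi> x)" if g: "g \<in> carrier G" and x: "x \<in> carrier V'" for g x
  proof -
    obtain v where v: "v \<in> carrier V" "x = \<phi> v" using surj x by blast
    have "act V' g x = \<phi> (act V g v)" using \<phi>_act[OF g v(1)] v(2) by simp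
    then show ?thesis
      using v g inv[OF g v(1)] by (simp add: \<psi>\<phi> fd_rep_act_closed[OF V])
  qed
  moreover have "\<phi> v \<in> carrier V'" "\<delta> (\<psi> (\<phi> v)) \<noteq> 0"
    using v by (simp_all add: \<psi>\<phi> linear_maps_closed[OF \<phi>_lin])
  moreover have "semisimple_rep G V'"
    using G V' unfolding semisimple_Rep_def by blast
  ultimately obtain x where x: "x \<in> carrier V'" "\<forall>g\<in>carrier G. act V' g x = x" "\<delta> (\<psi> x) \<noteq> 0"
    using semisimple_invariant_functional[OF V', of "\<lambda>x. \<delta> (\<psi> x)" "\<phi> v"] by blast
  obtain w where w: "w \<in> carrier V" "x = \<phi> w" using surj x(1) by blast
  have "act V g w = w" if "g \<in> carrier G" for g
  proof -
    have "\<phi> (act V g w) = \<phi> w" using \<phi>_act[OF that w(1)] x(2) that w(2) by simp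
    then show ?thesis
      using \<psi>\<phi>[OF w(1)] \<psi>\<phi>[OF fd_rep_act_closed[OF V that w(1)]] by simp
  qed
  then show ?thesis using w x(3) by (auto simp: \<psi>\<phi>)
qed

lemma subrep_fd_rep:
  assumes V: "fd_rep G V" and N: "subrep G N V"
  shows "fd_rep G (V\<lparr>carrier := N\<rparr>)"
proof -
  interpret V: fd_rep G V by fact
  interpret V: complex_space V by (rule complex_space.intro[OF V.vectorspace_axioms])
  have sub: "VectorSpace.subspace complex_ring N V" using N by (simp add: subrep_def)
  then have "submodule complex_ring N V" by simp
  then have NV: "N \<subseteq> carrier V" by (rule submodule.subset)
  have stable: "act V g v \<in> N" if "g \<in> carrier G" "v \<in> N" for g v
    using N that by (simp add: subrep_def)
  show ?thesis
  proof (intro fd_rep.intro fd_rep_axioms.intro V.group_axioms V.subspace_is_vs[OF sub]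
      V.subspace_fin_dim[OF V.fin_dim sub])
    fix g assume "g \<in> carrier G"
    then show "act (V\<lparr>carrier := N\<rparr>) g \<in> linear_maps (V\<lparr>carrier := N\<rparr>) (V\<lparr>carrier := N\<rparr>)"
      using NV stable fd_rep_act_linear[OF V] by (intro linear_mapsI) (auto simp: subset_iff)
  qed (use NV in \<open>auto simp: V.act_one V.act_mult subset_iff\<close>)
qed

text \<open>The dimension of a space of morphisms can be used only once it is known to be a
  finite-dimensional vector space; the first half is shown here.\<close>

lemma hom_space_vs:
  fixes A :: "('g, 'v) rep"
  assumes A: "fd_rep G A"
  shows "vectorspace complex_ring (hom_space G (unit_rep :: ('g, complex) rep) A)"
proof -
  interpret A: fd_rep G A by fact
  interpret A: complex_space A by (rule complex_space.intro[OF A.vectorspace_axioms])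
  let ?I = "unit_rep :: ('g, complex) rep"
  let ?H = "hom_space G ?I A"
  have hom_iff: "f \<in> rep_hom G ?I A \<longleftrightarrow> f \<in> linear_maps ?I A \<and> (\<forall>g\<in>carrier G. \<forall>z. act A g (f z) = f z)"
    for f
    by (auto simp: rep_hom_def)
  have cl: "f z \<in> carrier A" if "f \<in> rep_hom G ?I A" for f z
    using that linear_maps_closed[of f ?I A z] by (simp add: hom_iff)
  have add: "f (x + y) = f x \<oplus>\<^bsub>A\<^esub> f y" if "f \<in> rep_hom G ?I A" for f x y
    using that linear_maps_add[of f ?I A x y] by (simp add: hom_iff)
  have scale: "f (c * x) = c \<odot>\<^bsub>A\<^esub> f x" if "f \<in> rep_hom G ?I A" for f c x
    using that linear_maps_scale[of f ?I A x c] by (simp add: hom_iff)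
  have act: "act A g (f x) = f x" if "f \<in> rep_hom G ?I A" "g \<in> carrier G" for f g x
    using that by (simp add: hom_iff)
  have homI: "f \<in> rep_hom G ?I A"
    if "\<And>z. f z \<in> carrier A" "\<And>x y. f (x + y) = f x \<oplus>\<^bsub>A\<^esub> f y" "\<And>c x. f (c * x) = c \<odot>\<^bsub>A\<^esub> f x"
      "\<And>g x. g \<in> carrier G \<Longrightarrow> act A g (f x) = f x" for f
    using that unfolding hom_iff by (auto intro!: linear_mapsI)
  have act_zero: "act A g \<zero>\<^bsub>A\<^esub> = \<zero>\<^bsub>A\<^esub>" if "g \<in> carrier G" for g
    using fd_rep_act_scale[OF A that, of "\<zero>\<^bsub>A\<^esub>" 0] fd_rep_act_closed[OF A that, of "\<zero>\<^bsub>A\<^esub>"] by simp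
  have H: "carrier ?H = rep_hom G ?I A" "\<zero>\<^bsub>?H\<^esub> = (\<lambda>z. \<zero>\<^bsub>A\<^esub>)"
    "f \<oplus>\<^bsub>?H\<^esub> h = (\<lambda>z. f z \<oplus>\<^bsub>A\<^esub> h z)" "c \<odot>\<^bsub>?H\<^esub> f = (\<lambda>z. c \<odot>\<^bsub>A\<^esub> f z)" for c f h
    by (simp_all add: hom_space_def restrict_def)
  have Hadd: "(\<lambda>z. f z \<oplus>\<^bsub>A\<^esub> h z) \<in> rep_hom G ?I A"
    if "f \<in> rep_hom G ?I A" "h \<in> rep_hom G ?I A" for f h
    using that by (intro homI)
      (simp_all add: cl add scale act A.a_ac A.scale_add_right fd_rep_act_add[OF A])
  have Hscale: "(\<lambda>z. c \<odot>\<^bsub>A\<^esub> f z) \<in> rep_hom G ?I A" if "f \<in> rep_hom G ?I A" for f c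
    using that by (intro homI)
      (simp_all add: cl add scale act A.scale_scale mult.commute A.scale_add_right fd_rep_act_scale[OF A])
  show ?thesis
  proof (rule vs_criteria)
    show "\<zero>\<^bsub>?H\<^esub> \<in> carrier ?H"
      unfolding H by (intro homI) (simp_all add: act_zero)
    show "\<forall>f\<in>carrier ?H. \<exists>h\<in>carrier ?H. f \<oplus>\<^bsub>?H\<^esub> h = \<zero>\<^bsub>?H\<^esub>"
    proof
      fix f assume "f \<in> carrier ?H"
      then have f: "f \<in> rep_hom G ?I A" by (simp add: H)
      have "f z \<oplus>\<^bsub>A\<^esub> (- 1) \<odot>\<^bsub>A\<^esub> f z = \<zero>\<^bsub>A\<^esub>" for z
        using A.add_scale_minus_eq_zero_iff[OF cl[OF f] cl[OF f], of z 1 z] cl[OF f] by simp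
      then show "\<exists>h\<in>carrier ?H. f \<oplus>\<^bsub>?H\<^esub> h = \<zero>\<^bsub>?H\<^esub>"
        using Hscale[OF f, of "- 1"] by (intro bexI[of _ "\<lambda>z. (- 1) \<odot>\<^bsub>A\<^esub> f z"]) (simp_all add: H)
    qed
  qed (auto simp: H class_field Hadd Hscale cl A.a_ac A.scale_scale A.scale_add_left A.scale_add_right)
qed

text \<open>A morphism from the unit object is determined by the image of 1, an invariant vector, so the space
  of morphisms is a linear image of the space of invariants and has finite dimension. Being of
  dimension 1 it is generated by one morphism, and \<open>\<iota>\<close> is a nonzero multiple of it.\<close>

lemma invariants_eq_scalars:
  fixes A :: "('g, 'v) rep"
  assumes A: "fd_rep G A"
    and dim: "vectorspace.dim complex_ring (hom_space G (unit_rep :: ('g, complex) rep) A) = 1"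
    and \<iota>: "\<iota> \<in> rep_hom G (unit_rep :: ('g, complex) rep) A" "\<iota> 1 \<noteq> \<zero>\<^bsub>A\<^esub>"
    and a: "a \<in> carrier A" "\<And>g. g \<in> carrier G \<Longrightarrow> act A g a = a"
  shows "\<exists>c. a = c \<odot>\<^bsub>A\<^esub> \<iota> 1"
proof -
  let ?I = "unit_rep :: ('g, complex) rep"
  let ?H = "hom_space G ?I A"
  interpret A: fd_rep G A by fact
  interpret A: complex_space A by (rule complex_space.intro[OF A.vectorspace_axioms])
  interpret H: vectorspace complex_ring ?H by (rule hom_space_vs[OF A])
  let ?B = "{a \<in> carrier A. \<forall>g\<in>carrier G. act A g a = a}"
  have H: "carrier ?H = rep_hom G ?I A" "\<zero>\<^bsub>?H\<^esub> = (\<lambda>z. \<zero>\<^bsub>A\<^esub>)"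
    "f \<oplus>\<^bsub>?H\<^esub> h = (\<lambda>z. f z \<oplus>\<^bsub>A\<^esub> h z)" "c \<odot>\<^bsub>?H\<^esub> f = (\<lambda>z. c \<odot>\<^bsub>A\<^esub> f z)" for c f h
    by (simp_all add: hom_space_def restrict_def)
  have act_zero: "act A g \<zero>\<^bsub>A\<^esub> = \<zero>\<^bsub>A\<^esub>" if "g \<in> carrier G" for g
    using fd_rep_act_scale[OF A that, of "\<zero>\<^bsub>A\<^esub>" 0] fd_rep_act_closed[OF A that, of "\<zero>\<^bsub>A\<^esub>"] by simp
  have B: "VectorSpace.subspace complex_ring ?B A"
    by (rule subspaceI[OF A.vectorspace_axioms])
      (auto simp: act_zero fd_rep_act_add[OF A] fd_rep_act_scale[OF A])
  let ?T = "\<lambda>b z. z \<odot>\<^bsub>A\<^esub> b"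
  have T_hom: "?T b \<in> rep_hom G ?I A" if "b \<in> ?B" for b
    using that unfolding rep_hom_def
    by (auto intro!: linear_mapsI simp: A.scale_add_left A.scale_scale fd_rep_act_scale[OF A])
  interpret B: vectorspace complex_ring "A\<lparr>carrier := ?B\<rparr>" by (rule A.subspace_is_vs[OF B])
  have T: "?T \<in> linear_maps (A\<lparr>carrier := ?B\<rparr>) ?H"
  proof (rule linear_mapsI)
    fix b assume "b \<in> carrier (A\<lparr>carrier := ?B\<rparr>)"
    then have "b \<in> ?B" by simp
    then show "?T b \<in> carrier ?H" unfolding H by (rule T_hom)
  qed (auto simp: H A.scale_add_right A.scale_scale mult.commute)
  interpret T: linear_map complex_ring "A\<lparr>carrier := ?B\<rparr>" ?H ?T
    by unfold_locales (rule T)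
  have "f \<in> ?T ` ?B" if f: "f \<in> rep_hom G ?I A" for f
  proof (rule image_eqI)
    have lin: "f \<in> linear_maps ?I A" using f by (simp add: rep_hom_def)
    show "f = ?T (f 1)"
    proof
      fix z show "f z = ?T (f 1) z" using linear_maps_scale[OF lin, of 1 z] by simp
    qed
    show "f 1 \<in> ?B"
      using f linear_maps_closed[OF lin, of 1] by (auto simp: rep_hom_def)
  qed
  then have "?T ` carrier (A\<lparr>carrier := ?B\<rparr>) = carrier ?H"
    using T_hom by (auto simp: H simp del: mem_Collect_eq)
  then have "H.fin_dim"
    using T.rank_nullity_main(2) A.subspace_fin_dim[OF A.fin_dim B] by blast
  then obtain S where S: "finite S" "H.basis S"
    using H.finite_basis_exists by blast
  then have "card S = 1" using H.dim_basis dim by simp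
  then obtain f where f: "S = {f}" by (auto simp: card_1_singleton_iff)
  have fH: "f \<in> carrier ?H" and span: "H.span {f} = carrier ?H"
    using S(2) unfolding H.basis_def f by auto
  have ex: "\<exists>c. h = c \<odot>\<^bsub>?H\<^esub> f" if h: "h \<in> carrier ?H" for h
  proof -
    obtain k where "H.lincomb k {f} = h"
      using H.finite_in_span[of "{f}" h] h span fH by auto
    then show ?thesis
      using fH H.smult_closed[of "k f" f] by (auto simp: H.lincomb_def)
  qed
  have fA: "f z \<in> carrier A" for z
    using fH linear_maps_closed[of f ?I A z] by (simp add: H rep_hom_def)
  obtain k where k: "\<iota> = k \<odot>\<^bsub>?H\<^esub> f" using ex[of \<iota>] \<iota>(1) H by blast
  obtain c where c: "?T a = c \<odot>\<^bsub>?H\<^esub> f" using ex[of "?T a"] T_hom[of a] a H by auto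
  have k1: "\<iota> 1 = k \<odot>\<^bsub>A\<^esub> f 1" using fun_cong[OF k, of 1] by (simp add: H)
  have c1: "a = c \<odot>\<^bsub>A\<^esub> f 1" using fun_cong[OF c, of 1] a(1) by (simp add: H)
  have "k \<noteq> 0" using k1 \<iota>(2) fA by auto
  then have "a = (c / k) \<odot>\<^bsub>A\<^esub> \<iota> 1"
    using fA by (simp add: k1 c1 A.scale_scale)
  then show ?thesis by blast
qed

section \<open>Functions on a coset space\<close>

lemma fun_rep_ops [simp]:
  "f \<oplus>\<^bsub>fun_rep G H\<^esub> h = (\<lambda>x\<in>lcosets\<^bsub>G\<^esub> H. f x + h x)"
  "c \<odot>\<^bsub>fun_rep G H\<^esub> f = (\<lambda>x\<in>lcosets\<^bsub>G\<^esub> H. c * f x)"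
  by (simp_all add: fun_rep_def module.defs rep.defs class_ring.func_space_def)

lemma fun_rep_vs: "vectorspace complex_ring (fun_rep G H)"
proof (rule vectorspace_cong)
  \<comment> \<open>only the field of this vector space enters the construction of function spaces\<close>
  interpret vectorspace complex_ring "free_space {}" by (rule free_space_vs)
  show "vectorspace complex_ring (class_ring.func_space (lcosets\<^bsub>G\<^esub> H))"
    by (rule func_space_is_vs)
qed (simp_all add: fun_rep_def module.defs rep.defs)

lemma fun_mult_bilinear:
  "bilinear_map (fun_rep G H) (fun_rep G H) (fun_rep G H) (\<lambda>f h. \<lambda>x\<in>lcosets\<^bsub>G\<^esub> H. f x * h x)"
  by (rule bilinear_mapI) (auto simp: fun_eq_iff algebra_simps)

lemmas fun_mult_linear = tensor_lift_linear[OF fun_rep_vs fun_rep_vs fun_rep_vs fun_mult_bilinear,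
    folded fun_mult_def]
  and fun_mult_tens = tensor_lift_tens[OF fun_rep_vs fun_rep_vs fun_rep_vs fun_mult_bilinear,
    folded fun_mult_def]

section \<open>Algebras with a group action\<close>

locale equivariant_algebra = fd_rep G A + comm_algebra A times unit
  for G :: "('g, 'm) monoid_scheme" and A :: "('g, 'v) rep"
    and times :: "'v \<Rightarrow> 'v \<Rightarrow> 'v" (infixl \<open>\<cdot>\<close> 70) and unit :: 'v +
  assumes act_times: "\<lbrakk>g \<in> carrier G; a \<in> carrier A; b \<in> carrier A\<rbrakk>
      \<Longrightarrow> act A g (a \<cdot> b) = act A g a \<cdot> act A g b"
    and act_unit: "g \<in> carrier G \<Longrightarrow> act A g unit = unit"
    and unit_nonzero: "unit \<noteq> \<zero>\<^bsub>A\<^esub>"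
begin

lemmas act_closed [simp] = fd_rep_act_closed[OF fd_rep_axioms]
  and act_add = fd_rep_act_add[OF fd_rep_axioms]
  and act_scale = fd_rep_act_scale[OF fd_rep_axioms]

lemma character_act:
  assumes "character \<chi>" "g \<in> carrier G"
  shows "character (\<lambda>a. \<chi> (act A g a))"
  unfolding character_def using assms(2)
  by (simp add: act_unit act_times act_add act_scale characterD[OF assms(1)])

text \<open>The heart of the argument. The elements on which all translates of \<open>\<chi>\<close> vanish form an invariant
  ideal \<open>N\<close>. Its only invariant is 0, because invariants are scalars and \<open>\<chi>\<close> is 1 on the unit. By
  semisimplicity an invariant functional on \<open>N\<close> is then zero, in particular \<open>\<epsilon>\<close> is. As \<open>N\<close> is an
  ideal, \<open>\<epsilon> (b \<cdot> a) = 0\<close> for all \<open>b\<close> and all \<open>a\<close> in \<open>N\<close>, and nondegeneracy gives \<open>N = 0\<close>.\<close>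

lemma orbit_separates:
  assumes G: "semisimple_Rep G"
    and \<epsilon>: "\<epsilon> \<in> linear_maps A (unit_rep :: ('g, complex) rep)"
    and \<epsilon>_act: "\<And>g a. \<lbrakk>g \<in> carrier G; a \<in> carrier A\<rbrakk> \<Longrightarrow> \<epsilon> (act A g a) = \<epsilon> a"
    and nondegenerate: "\<And>a. \<lbrakk>a \<in> carrier A; \<And>b. b \<in> carrier A \<Longrightarrow> \<epsilon> (b \<cdot> a) = 0\<rbrakk> \<Longrightarrow> a = \<zero>\<^bsub>A\<^esub>"
    and scalars: "\<And>a. \<lbrakk>a \<in> carrier A; \<And>g. g \<in> carrier G \<Longrightarrow> act A g a = a\<rbrakk>
      \<Longrightarrow> \<exists>c. a = c \<odot>\<^bsub>A\<^esub> unit"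
    and \<chi>: "character \<chi>"
    and a: "a \<in> carrier A" "\<And>g. g \<in> carrier G \<Longrightarrow> \<chi> (act A g a) = 0"
  shows "a = \<zero>\<^bsub>A\<^esub>"
proof -
  let ?N = "{a \<in> carrier A. \<forall>g\<in>carrier G. \<chi> (act A g a) = 0}"
  let ?AN = "A\<lparr>carrier := ?N\<rparr>"
  note D = characterD[OF character_act[OF \<chi>]]
  have "subrep G ?N A"
    unfolding subrep_def
  proof (intro conjI ballI)
    show "VectorSpace.subspace complex_ring ?N A"
      by (rule subspaceI[OF vectorspace_axioms]) (auto simp: D)
    show "act A g w \<in> ?N" if "g \<in> carrier G" "w \<in> ?N" for g w
      using that by (auto simp flip: act_mult)
  qed
  then have N: "fd_rep G ?AN" by (rule subrep_fd_rep[OF fd_rep_axioms])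
  have \<epsilon>N: "\<epsilon> \<in> linear_maps ?AN (unit_rep :: ('g, complex) rep)"
    using linear_mapsD[OF \<epsilon>] by (intro linear_mapsI) auto
  have "\<epsilon> n = 0" if n: "n \<in> ?N" for n
  proof (rule ccontr)
    assume "\<epsilon> n \<noteq> 0"
    then have "\<exists>w\<in>carrier ?AN. (\<forall>g\<in>carrier G. act ?AN g w = w) \<and> \<epsilon> w \<noteq> 0"
      using n by (intro invariant_functional[OF G N \<epsilon>N, of n]) (auto simp: \<epsilon>_act)
    then obtain w where w: "w \<in> ?N" "\<forall>g\<in>carrier G. act A g w = w" "\<epsilon> w \<noteq> 0" by auto
    then obtain c where c: "w = c \<odot>\<^bsub>A\<^esub> unit" using scalars[of w] by blast
    have "\<chi> w = 0" using w by force
    then have "c = 0" using c by (simp add: characterD[OF \<chi>])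
    then have "w = \<zero>\<^bsub>A\<^esub>" using c by simp
    then show False using w(3) linear_functional_zero[OF vectorspace_axioms \<epsilon>] by simp
  qed
  moreover have "b \<cdot> a \<in> ?N" if "b \<in> carrier A" for b
    using that a by (simp add: D)
  ultimately show ?thesis using nondegenerate[OF a(1)] by blast
qed

definition stabilizer :: "('v \<Rightarrow> complex) \<Rightarrow> 'g set"
  where "stabilizer \<chi> = {h \<in> carrier G. \<forall>a\<in>carrier A. \<chi> (act A h a) = \<chi> a}"

lemma stabilizer_subgroup: "subgroup (stabilizer \<chi>) G"
proof (rule subgroupI)
  show "stabilizer \<chi> \<noteq> {}" using act_one by (auto simp: stabilizer_def)
  show "inv\<^bsub>G\<^esub> h \<in> stabilizer \<chi>" if "h \<in> stabilizer \<chi>" for h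
  proof -
    have h: "h \<in> carrier G" and eq: "\<And>a. a \<in> carrier A \<Longrightarrow> \<chi> (act A h a) = \<chi> a"
      using that by (auto simp: stabilizer_def)
    have "\<chi> (act A (inv\<^bsub>G\<^esub> h) a) = \<chi> a" if "a \<in> carrier A" for a
      using eq[of "act A (inv\<^bsub>G\<^esub> h) a"] that h by (simp add: act_one flip: act_mult)
    then show ?thesis using h by (simp add: stabilizer_def)
  qed
qed (auto simp: stabilizer_def act_mult)

text \<open>The coset \<open>g H\<close> of the stabilizer corresponds to the point \<open>\<chi> \<circ> g\<^sup>-\<^sup>1\<close> of the orbit of \<open>\<chi>\<close>;
  by the choice of the stabilizer any representative \<open>g\<close> gives the same point.\<close>

definition coset_character :: "('v \<Rightarrow> complex) \<Rightarrow> 'g set \<Rightarrow> 'v \<Rightarrow> complex"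
  where "coset_character \<chi> x a = \<chi> (act A (inv\<^bsub>G\<^esub> (SOME g. g \<in> x)) a)"

lemma coset_character_eq:
  assumes k: "k \<in> carrier G" and a: "a \<in> carrier A"
  shows "coset_character \<chi> (k <#\<^bsub>G\<^esub> stabilizer \<chi>) a = \<chi> (act A (inv\<^bsub>G\<^esub> k) a)"
proof -
  let ?H = "stabilizer \<chi>"
  have "k \<in> k <#\<^bsub>G\<^esub> ?H" by (rule lcos_self[OF k stabilizer_subgroup])
  then have "(SOME g. g \<in> k <#\<^bsub>G\<^esub> ?H) \<in> k <#\<^bsub>G\<^esub> ?H" by (rule someI)
  then obtain h where h: "h \<in> ?H" "(SOME g. g \<in> k <#\<^bsub>G\<^esub> ?H) = k \<otimes>\<^bsub>G\<^esub> h"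
    by (auto simp: l_coset_def)
  have hG: "h \<in> carrier G" and "inv\<^bsub>G\<^esub> h \<in> ?H"
    using h(1) subgroup.m_inv_closed[OF stabilizer_subgroup h(1)] by (simp_all add: stabilizer_def)
  then have "\<chi> (act A (inv\<^bsub>G\<^esub> h) (act A (inv\<^bsub>G\<^esub> k) a)) = \<chi> (act A (inv\<^bsub>G\<^esub> k) a)"
    using k a by (simp add: stabilizer_def)
  then show ?thesis
    using k a hG by (simp add: coset_character_def h(2) inv_mult_group act_mult)
qed

lemma lcosetsI: "k \<in> carrier G \<Longrightarrow> k <#\<^bsub>G\<^esub> H \<in> lcosets\<^bsub>G\<^esub> H"
  unfolding LCOSETS_def by blast

lemma lcosetsE:
  assumes "x \<in> lcosets\<^bsub>G\<^esub> H"
  obtains k where "k \<in> carrier G" "x = k <#\<^bsub>G\<^esub> H"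
  using assms by (auto simp: LCOSETS_def)

lemma coset_character_character:
  assumes "character \<chi>" and x: "x \<in> lcosets\<^bsub>G\<^esub> stabilizer \<chi>"
  shows "character (coset_character \<chi> x)"
proof -
  obtain k where k: "k \<in> carrier G" "x = k <#\<^bsub>G\<^esub> stabilizer \<chi>" by (rule lcosetsE[OF x])
  show ?thesis
    using character_act[OF assms(1), of "inv\<^bsub>G\<^esub> k"] k
    by (simp add: character_def coset_character_eq)
qed

lemma coset_character_distinct:
  assumes x: "x \<in> lcosets\<^bsub>G\<^esub> stabilizer \<chi>" and y: "y \<in> lcosets\<^bsub>G\<^esub> stabilizer \<chi>" and "x \<noteq> y"
  shows "\<exists>a\<in>carrier A. coset_character \<chi> x a \<noteq> coset_character \<chi> y a"
proof (rule ccontr)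
  have group: "group G" by (rule fd_rep.axioms(1)[OF fd_rep_axioms])
  let ?H = "stabilizer \<chi>"
  obtain k where k: "k \<in> carrier G" "x = k <#\<^bsub>G\<^esub> ?H" by (rule lcosetsE[OF x])
  obtain l where l: "l \<in> carrier G" "y = l <#\<^bsub>G\<^esub> ?H" by (rule lcosetsE[OF y])
  assume "\<not> ?thesis"
  then have eq: "\<chi> (act A (inv\<^bsub>G\<^esub> k) a) = \<chi> (act A (inv\<^bsub>G\<^esub> l) a)" if "a \<in> carrier A" for a
    using that k l by (auto simp: coset_character_eq)
  \<comment> \<open>substitute \<open>l a\<close> for \<open>a\<close>\<close>
  have "\<chi> (act A (inv\<^bsub>G\<^esub> k \<otimes>\<^bsub>G\<^esub> l) a) = \<chi> a" if "a \<in> carrier A" for a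
    using that k(1) l(1) eq[of "act A l a"] by (simp add: act_one flip: act_mult)
  then have "inv\<^bsub>G\<^esub> k \<otimes>\<^bsub>G\<^esub> l \<in> ?H" using k l by (simp add: stabilizer_def)
  then have "l \<in> k <#\<^bsub>G\<^esub> ?H"
    by (rule subgroup.lcos_module_rev[OF stabilizer_subgroup group k(1) l(1)])
  then have "x = y" using l_repr_independence[OF _ k(1) stabilizer_subgroup] k l by simp
  then show False using assms(3) by simp
qed

lemma finite_orbit:
  assumes "character \<chi>"
  shows "finite (lcosets\<^bsub>G\<^esub> stabilizer \<chi>)"
  by (rule characters_finite[OF fin_dim coset_character_character[OF assms] coset_character_distinct])

text \<open>The Gelfand transform, restricted to the orbit of \<open>\<chi>\<close>.\<close>

definition gelfand :: "('v \<Rightarrow> complex) \<Rightarrow> 'v \<Rightarrow> 'g set \<Rightarrow> complex"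
  where "gelfand \<chi> = (\<lambda>a\<in>carrier A. \<lambda>x\<in>lcosets\<^bsub>G\<^esub> stabilizer \<chi>. coset_character \<chi> x a)"

lemma gelfand_hom:
  assumes "character \<chi>"
  shows "gelfand \<chi> \<in> rep_hom G A (fun_rep G (stabilizer \<chi>))"
proof -
  let ?H = "stabilizer \<chi>"
  note D = characterD[OF coset_character_character[OF assms]]
  have "gelfand \<chi> \<in> linear_maps A (fun_rep G ?H)"
  proof (rule linear_mapsI)
    fix a assume a: "a \<in> carrier A"
    show "gelfand \<chi> a \<in> carrier (fun_rep G ?H)"
      using a by (simp add: gelfand_def)
    show "gelfand \<chi> (c \<odot>\<^bsub>A\<^esub> a) = c \<odot>\<^bsub>fun_rep G ?H\<^esub> gelfand \<chi> a" for c
      unfolding fun_rep_ops using a by (auto simp: gelfand_def D intro!: restrict_ext)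
    show "gelfand \<chi> (a \<oplus>\<^bsub>A\<^esub> b) = gelfand \<chi> a \<oplus>\<^bsub>fun_rep G ?H\<^esub> gelfand \<chi> b"
      if "b \<in> carrier A" for b
      unfolding fun_rep_ops using a that by (auto simp: gelfand_def D intro!: restrict_ext)
  qed
  moreover have "gelfand \<chi> (act A g a) = act (fun_rep G ?H) g (gelfand \<chi> a)"
    if g: "g \<in> carrier G" and a: "a \<in> carrier A" for g a
  proof -
    have "coset_character \<chi> x (act A g a) = gelfand \<chi> a ((inv\<^bsub>G\<^esub> g) <#\<^bsub>G\<^esub> x)"
      if x: "x \<in> lcosets\<^bsub>G\<^esub> ?H" for x
    proof -
      obtain k where k: "k \<in> carrier G" "x = k <#\<^bsub>G\<^esub> ?H" by (rule lcosetsE[OF x])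
      have gx: "(inv\<^bsub>G\<^esub> g) <#\<^bsub>G\<^esub> x = (inv\<^bsub>G\<^esub> g \<otimes>\<^bsub>G\<^esub> k) <#\<^bsub>G\<^esub> ?H"
        using k g lcos_m_assoc subgroup.subset[OF stabilizer_subgroup] by simp
      have "(inv\<^bsub>G\<^esub> g) <#\<^bsub>G\<^esub> x \<in> lcosets\<^bsub>G\<^esub> ?H"
        unfolding gx using k(1) g by (simp add: lcosetsI)
      then have "gelfand \<chi> a ((inv\<^bsub>G\<^esub> g) <#\<^bsub>G\<^esub> x) = \<chi> (act A (inv\<^bsub>G\<^esub> k) (act A g a))"
        using g a k(1) by (simp add: gelfand_def gx coset_character_eq inv_mult_group act_mult)
      then show ?thesis using g a k by (simp add: coset_character_eq)
    qed
    then show ?thesis using g a by (auto simp: gelfand_def)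
  qed
  ultimately show ?thesis by (simp add: rep_hom_def gelfand_def)
qed

lemma gelfand_bij:
  assumes \<chi>: "character \<chi>"
    and separates: "\<And>a. \<lbrakk>a \<in> carrier A; \<And>g. g \<in> carrier G \<Longrightarrow> \<chi> (act A g a) = 0\<rbrakk> \<Longrightarrow> a = \<zero>\<^bsub>A\<^esub>"
  shows "bij_betw (gelfand \<chi>) (carrier A) (carrier (fun_rep G (stabilizer \<chi>)))"
  unfolding bij_betw_def
proof
  let ?H = "stabilizer \<chi>"
  note D = characterD[OF coset_character_character[OF \<chi>]]
  show "inj_on (gelfand \<chi>) (carrier A)"
  proof
    fix a b assume ab: "a \<in> carrier A" "b \<in> carrier A" "gelfand \<chi> a = gelfand \<chi> b"
    let ?d = "a \<oplus>\<^bsub>A\<^esub> (- 1) \<odot>\<^bsub>A\<^esub> b"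
    have "\<chi> (act A g ?d) = 0" if g: "g \<in> carrier G" for g
    proof -
      let ?x = "inv\<^bsub>G\<^esub> g <#\<^bsub>G\<^esub> ?H"
      have x: "?x \<in> lcosets\<^bsub>G\<^esub> ?H" using g by (simp add: lcosetsI)
      have "coset_character \<chi> ?x a = coset_character \<chi> ?x b"
        using fun_cong[OF ab(3), of ?x] ab(1,2) x by (simp add: gelfand_def)
      then have "coset_character \<chi> ?x ?d = 0" using ab(1,2) x by (simp add: D)
      then show ?thesis using g ab(1,2) by (simp add: coset_character_eq)
    qed
    then have "?d = \<zero>\<^bsub>A\<^esub>" using ab(1,2) by (intro separates) simp_all
    then show "a = b" using ab(1,2) add_scale_minus_eq_zero_iff[of a b 1] by simp
  qed
  show "gelfand \<chi> ` carrier A = carrier (fun_rep G ?H)"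
  proof
    show "gelfand \<chi> ` carrier A \<subseteq> carrier (fun_rep G ?H)" by (auto simp: gelfand_def)
    show "carrier (fun_rep G ?H) \<subseteq> gelfand \<chi> ` carrier A"
    proof
      fix f assume f: "f \<in> carrier (fun_rep G ?H)"
      have "\<exists>a\<in>carrier A. \<forall>x\<in>lcosets\<^bsub>G\<^esub> ?H. coset_character \<chi> x a = f x"
        by (rule characters_interpolate[OF coset_character_character[OF \<chi>]
            coset_character_distinct finite_orbit[OF \<chi>]])
      then obtain a where a: "a \<in> carrier A" "\<forall>x\<in>lcosets\<^bsub>G\<^esub> ?H. coset_character \<chi> x a = f x" ..
      have "f = gelfand \<chi> a"
        using a f by (intro extensionalityI[of _ "lcosets\<^bsub>G\<^esub> ?H"]) (simp_all add: gelfand_def PiE_iff)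
      then show "f \<in> gelfand \<chi> ` carrier A" using a(1) by blast
    qed
  qed
qed

end

section \<open>Algebras in the category of representations\<close>

context rep_algebra
begin

abbreviation product :: "'v \<Rightarrow> 'v \<Rightarrow> 'v"
  where "product a b \<equiv> \<mu> (tens A A a b)"

lemma mu_linear: "\<mu> \<in> linear_maps (tensor_space A A) A"
  using rep_hom_linear[OF mu_hom] by simp

lemma iota_linear: "\<iota> \<in> linear_maps (unit_rep :: ('g, complex) rep) A"
  by (rule rep_hom_linear[OF iota_hom])

lemma product_unit: "a \<in> carrier A \<Longrightarrow> product (\<iota> 1) a = a"
proof -
  assume a: "a \<in> carrier A"
  let ?x = "tens (unit_rep :: ('g, complex) rep) A 1 a"
  have "?x \<in> carrier (unit_rep \<otimes>\<^sub>R A)"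
    using tens_closed[OF unit_rep_vs vectorspace_axioms _ a] by simp
  then have "\<mu> (tensor_mor unit_rep A A A \<iota> (id_mor A) ?x) = lunit_mor A ?x"
    using fun_cong[OF mu_unit, of ?x] by (simp add: compose_def)
  moreover have "tensor_mor unit_rep A A A \<iota> (id_mor A) ?x = tens A A (\<iota> 1) a"
    using a tensor_mor_tens[OF unit_rep_vs vectorspace_axioms vectorspace_axioms vectorspace_axioms
        iota_linear id_mor_linear[OF vectorspace_axioms], of 1 a] by simp
  ultimately show ?thesis
    using a smult_one[of a] by (simp add: lunit_mor_tens[OF vectorspace_axioms a])
qed

lemma product_commute:
  assumes "a \<in> carrier A" "b \<in> carrier A"
  shows "product a b = product b a"
  using fun_cong[OF mu_comm, of "tens A A a b"] assms
    flip_mor_tens[OF vectorspace_axioms vectorspace_axioms assms]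
    tens_closed[OF vectorspace_axioms vectorspace_axioms assms]
  by (simp add: compose_def)

lemma product_assoc:
  assumes a: "a \<in> carrier A" and b: "b \<in> carrier A" and c: "c \<in> carrier A"
  shows "product (product a b) c = product a (product b c)"
proof -
  note A = vectorspace_axioms
  note AA = tensor_rep_vs[OF A A]
  note id = id_mor_linear[OF A]
  have mu: "\<mu> \<in> linear_maps (A \<otimes>\<^sub>R A) A" using mu_linear by simp
  have ab: "tens A A a b \<in> carrier (A \<otimes>\<^sub>R A)" and bc: "tens A A b c \<in> carrier (A \<otimes>\<^sub>R A)"
    using tens_closed[OF A A] a b c by simp_all
  let ?x = "tens (A \<otimes>\<^sub>R A) A (tens A A a b) c"
  have "?x \<in> carrier ((A \<otimes>\<^sub>R A) \<otimes>\<^sub>R A)"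
    using tens_closed[OF AA A ab c] by simp
  then have "\<mu> (tensor_mor (A \<otimes>\<^sub>R A) A A A \<mu> (id_mor A) ?x) =
      \<mu> (tensor_mor A (A \<otimes>\<^sub>R A) A A (id_mor A) \<mu> (assoc_mor A A A ?x))"
    using fun_cong[OF mu_assoc, of ?x] by (simp add: compose_def)
  then show ?thesis
    using a c by (simp add: tensor_mor_tens[OF AA A A A mu id ab c]
        assoc_mor_tens[OF A A A a b c] tensor_mor_tens[OF A AA A A id mu a bc])
qed

lemma equivariant_algebra: "equivariant_algebra G A product (\<iota> 1)"
proof -
  interpret complex_space A by (rule complex_space.intro[OF vectorspace_axioms])
  note tens = bilinear_mapD[OF tens_bilinear[OF vectorspace_axioms vectorspace_axioms]]
  note mu = linear_mapsD[OF mu_linear]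
  have "comm_algebra A product (\<iota> 1)"
  proof unfold_locales
    show "\<iota> 1 \<in> carrier A" using linear_maps_closed[OF iota_linear, of 1] by simp
  qed (auto simp: tens mu product_unit product_assoc intro: product_commute)
  moreover have "\<iota> 1 \<noteq> \<zero>\<^bsub>A\<^esub>"
  proof
    assume "\<iota> 1 = \<zero>\<^bsub>A\<^esub>"
    then have "\<iota> 0 = \<iota> 1"
      using linear_maps_scale[OF iota_linear, of 1 0] by simp
    then show False using iota_inj by (simp add: inj_eq)
  qed
  moreover have "product (act A g a) (act A g b) = act A g (product a b)"
    if "g \<in> carrier G" "a \<in> carrier A" "b \<in> carrier A" for g a b
    using rep_hom_act[OF mu_hom that(1), of "tens A A a b"] that tens(1)
      tensor_rep_act_tens[OF fd_rep_axioms fd_rep_axioms that]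
    by simp
  moreover have "act A g (\<iota> 1) = \<iota> 1" if "g \<in> carrier G" for g
    using rep_hom_act[OF iota_hom that, of 1] by simp
  ultimately show ?thesis
    by (intro equivariant_algebra.intro equivariant_algebra_axioms.intro fd_rep_axioms) simp_all
qed

end

context rigid_rep_algebra
begin

text \<open>The pairing is \<open>e(a, b) = \<epsilon>(a b)\<close>, so \<open>\<epsilon>(a) = e(1, a)\<close>. Thus the counit inherits linearity and
  invariance from the pairing.\<close>

lemma counit_linear: "counit G A \<iota> \<in> linear_maps A (unit_rep :: ('g, complex) rep)"
  and counit_act: "\<lbrakk>g \<in> carrier G; a \<in> carrier A\<rbrakk> \<Longrightarrow> counit G A \<iota> (act A g a) = counit G A \<iota> a"
  and counit_nondegenerate: "\<lbrakk>a \<in> carrier A; \<And>b. b \<in> carrier A \<Longrightarrow> counit G A \<iota> (product b a) = 0\<rbrakk>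
    \<Longrightarrow> a = \<zero>\<^bsub>A\<^esub>"
proof -
  interpret equivariant_algebra G A product "\<iota> 1" by (rule equivariant_algebra)
  note A = vectorspace_axioms
  define e where "e = compose (carrier (A \<otimes>\<^sub>R A)) (counit G A \<iota>) \<mu>"
  have e: "e \<in> rep_hom G (A \<otimes>\<^sub>R A) unit_rep"
    using nondegenerate unfolding e_def nondegenerate_pairing_def by blast
  obtain i where i: "i \<in> rep_hom G unit_rep (A \<otimes>\<^sub>R A)" "rigidity_axioms A A e i"
    using nondegenerate unfolding e_def nondegenerate_pairing_def by blast
  note t = bilinear_mapD[OF tens_bilinear[OF A A]]
  have e_tens: "e (tens A A a b) = counit G A \<iota> (product a b)"
    if "a \<in> carrier A" "b \<in> carrier A" for a b
    using t(1)[OF that] by (simp add: e_def compose_def)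
  have e_unit: "e (tens A A (\<iota> 1) a) = counit G A \<iota> a" if "a \<in> carrier A" for a
    using e_tens[OF unit_closed that] product_unit[OF that] by simp
  note e_linear = rep_hom_linear[OF e]
  have "tens A A (\<iota> 1) \<in> linear_maps A (tensor_space A A)"
    using tens_bilinear[OF A A] unit_closed unfolding bilinear_map_def by blast
  note linear_maps_compose[OF this e_linear[unfolded linear_maps_tensor_rep]]
  note lin = linear_mapsD[OF this]
  show "counit G A \<iota> \<in> linear_maps A (unit_rep :: ('g, complex) rep)"
  proof (rule linear_mapsI)
    show "counit G A \<iota> (a \<oplus>\<^bsub>A\<^esub> b) = counit G A \<iota> a \<oplus>\<^bsub>unit_rep\<^esub> counit G A \<iota> b"
      if "a \<in> carrier A" "b \<in> carrier A" for a b
      using lin(2)[OF that] that by (simp add: e_unit)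
    show "counit G A \<iota> (c \<odot>\<^bsub>A\<^esub> a) = c \<odot>\<^bsub>unit_rep\<^esub> counit G A \<iota> a" if "a \<in> carrier A" for a c
      using lin(3)[OF that, of c] that by (simp add: e_unit)
  qed simp
  show "counit G A \<iota> (act A g a) = counit G A \<iota> a" if "g \<in> carrier G" "a \<in> carrier A" for g a
  proof -
    have "e (tens A A (\<iota> 1) (act A g a)) = e (tens A A (\<iota> 1) a)"
      using rep_hom_act[OF e that(1), of "tens A A (\<iota> 1) a"] t(1)[OF unit_closed that(2)]
        tensor_rep_act_tens[OF fd_rep_axioms fd_rep_axioms that(1) unit_closed that(2)] that(1)
      by (simp add: act_unit)
    then show ?thesis using that by (simp add: e_unit)
  qed
  show "a = \<zero>\<^bsub>A\<^esub>"
    if "a \<in> carrier A" "\<And>b. b \<in> carrier A \<Longrightarrow> counit G A \<iota> (product b a) = 0"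
  proof (rule rigidity_axioms_nondegenerate[OF A A e_linear rep_hom_linear[OF i(1)] i(2) that(1)])
    show "e (tens A A b a) = 0" if b: "b \<in> carrier A" for b
      using e_tens[OF b \<open>a \<in> carrier A\<close>] \<open>\<And>b. b \<in> carrier A \<Longrightarrow> counit G A \<iota> (product b a) = 0\<close>[OF b]
      by simp
  qed
qed

lemma iso_fun_rep:
  assumes G: "semisimple_Rep G"
  shows "\<exists>H. subgroup H G \<and> finite (lcosets\<^bsub>G\<^esub> H) \<and>
    rep_algebra_iso G A \<mu> \<iota> (fun_rep G H) (fun_mult G H) (fun_unit G H)"
proof -
  interpret equivariant_algebra G A product "\<iota> 1" by (rule equivariant_algebra)
  note A = vectorspace_axioms
  obtain \<chi> where \<chi>: "character \<chi>"
    using character_exists[OF fin_dim unit_nonzero] ..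
  define H where "H = stabilizer \<chi>"
  define \<phi> where "\<phi> = gelfand \<chi>"
  have scalars: "\<exists>c. a = c \<odot>\<^bsub>A\<^esub> \<iota> 1"
    if "a \<in> carrier A" "\<And>g. g \<in> carrier G \<Longrightarrow> act A g a = a" for a
    by (rule invariants_eq_scalars[OF fd_rep_axioms dim_hom_unit iota_hom unit_nonzero that])
  have separates: "a = \<zero>\<^bsub>A\<^esub>"
    if "a \<in> carrier A" "\<And>g. g \<in> carrier G \<Longrightarrow> \<chi> (act A g a) = 0" for a
    by (rule orbit_separates[OF G counit_linear counit_act counit_nondegenerate scalars \<chi> that])
  have bij: "bij_betw \<phi> (carrier A) (carrier (fun_rep G H))"
    unfolding \<phi>_def H_def by (rule gelfand_bij[OF \<chi> separates])
  have \<phi>: "\<phi> \<in> rep_hom G A (fun_rep G H)"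
    unfolding \<phi>_def H_def by (rule gelfand_hom[OF \<chi>])
  note \<phi>_linear = rep_hom_linear[OF \<phi>]
  note D = characterD[OF coset_character_character[OF \<chi>]]
  have \<phi>_product: "\<phi> (product a b) = fun_mult G H (tens (fun_rep G H) (fun_rep G H) (\<phi> a) (\<phi> b))"
    if "a \<in> carrier A" "b \<in> carrier A" for a b
    unfolding fun_mult_tens[OF linear_maps_closed[OF \<phi>_linear that(1)] linear_maps_closed[OF \<phi>_linear that(2)]]
    using that times_closed[OF that] by (auto simp: \<phi>_def H_def gelfand_def D intro!: restrict_ext)
  have \<phi>\<phi>: "tensor_mor A A (fun_rep G H) (fun_rep G H) \<phi> \<phi>
      \<in> linear_maps (tensor_space A A) (tensor_space (fun_rep G H) (fun_rep G H))"
    by (rule tensor_mor_linear[OF A A fun_rep_vs fun_rep_vs \<phi>_linear \<phi>_linear])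
  have mult: "\<phi> (\<mu> x) = fun_mult G H (tensor_mor A A (fun_rep G H) (fun_rep G H) \<phi> \<phi> x)"
    if "x \<in> carrier (tensor_space A A)" for x
  proof (rule tensor_linear_eqI[OF A A fun_rep_vs linear_maps_compose[OF mu_linear \<phi>_linear]
        linear_maps_compose[OF \<phi>\<phi> fun_mult_linear] _ that])
    show "\<phi> (product a b) =
        fun_mult G H (tensor_mor A A (fun_rep G H) (fun_rep G H) \<phi> \<phi> (tens A A a b))"
      if "a \<in> carrier A" "b \<in> carrier A" for a b
      unfolding tensor_mor_tens[OF A A fun_rep_vs fun_rep_vs \<phi>_linear \<phi>_linear that]
      by (rule \<phi>_product[OF that])
  qed
  have "\<phi> (\<iota> c) = fun_unit G H c" for c
  proof -
    have "\<iota> c = c \<odot>\<^bsub>A\<^esub> \<iota> 1" using linear_maps_scale[OF iota_linear, of 1 c] by simp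
    then show ?thesis by (auto simp: \<phi>_def H_def gelfand_def D fun_unit_def intro!: restrict_ext)
  qed
  then have "rep_algebra_iso G A \<mu> \<iota> (fun_rep G H) (fun_mult G H) (fun_unit G H)"
    unfolding rep_algebra_iso_def using \<phi> bij mult
    by (intro bexI[of _ \<phi>]) (auto simp: compose_def fun_unit_def intro!: restrict_ext)
  then show ?thesis
    using stabilizer_subgroup[of \<chi>] finite_orbit[OF \<chi>] unfolding H_def by blast
qed

end

theorem theorem2p2:
  fixes \<Gamma> :: "('g, 'm) monoid_scheme"
    and A :: "('g, 'v) rep"
    and \<mu> :: "('v \<times> 'v \<Rightarrow> complex) set \<Rightarrow> 'v"
    and \<iota> :: "complex \<Rightarrow> 'v"
  assumes "group \<Gamma>"
    and "semisimple_Rep \<Gamma>"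
    and "rigid_rep_algebra \<Gamma> A \<mu> \<iota>"
  shows "\<exists>H. subgroup H \<Gamma> \<and> finite (lcosets\<^bsub>\<Gamma>\<^esub> H) \<and>
    rep_algebra_iso \<Gamma> A \<mu> \<iota> (fun_rep \<Gamma> H) (fun_mult \<Gamma> H) (fun_unit \<Gamma> H)"
  by (rule rigid_rep_algebra.iso_fun_rep[OF assms(3,2)])

end
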